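(* Let $L$ be a Haantjes operator on a manifold $\mathsf M$. Assume that at a point $\mathsf p\in\mathsf M$ its characteristic polynomial factorises as $\chi_{L(\mathsf p)}(\lambda)=p_1(\lambda)p_2(\lambda)$, where $p_1$ and $p_2$ are coprime monic real polynomials, and let $k=\deg p_1$, $s=\deg p_2$. Then, in a neighbourhood of $\mathsf p$, there exists a coordinate system $u=(u^1,\dots,u^k)$, $v=(v^1,\dots,v^s)$ such that: (i) the operator $L$ has the form $$L=\begin{pmatrix}A(u,v)&0_{k\times s}\\ 0_{s\times k}&B(u,v)\end{pmatrix};$$ (ii) $A$ is Haantjes with respect to $u$, and $B$ is Haantjes with respect to $v$; (iii) $A A_{v^j}-A_{v^j}A=0$ for all $j=1,\dots,s$, where $A_{v^j}=\frac{\partial A}{\partial v^j}$ is the matrix of entrywise derivatives; (iv) $BB_{u^i}-B_{u^i}B=0$ for all $i=1,\dots,k$, where $B_{u^i}=\frac{\partial B}{\partial u^i}$ is the matrix of entrywise derivatives. Moreover, every block diagonal operator of the form in (i) satisfying (ii), (iii), (iv) is Haantjes.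
   Context: An operator (field) is a smooth $(1,1)$-tensor field, viewed as a field of endomorphisms of the tangent spaces. The Nijenhuis torsion of an operator $L$ is $$\mathcal N_L(\xi,\eta)=L^2[\xi,\eta]+[L\xi,L\eta]-L[L\xi,\eta]-L[\xi,L\eta],$$ and its Haantjes torsion is $$\mathcal H_L(\xi,\eta)=L^2\mathcal N_L(\xi,\eta)+\mathcal N_L(L\xi,L\eta)-L\,\mathcal N_L(L\xi,\eta)-L\,\mathcal N_L(\xi,L\eta).$$ $L$ is a Haantjes operator if $\mathcal H_L=0$. "$A$ is Haantjes with respect to $u$" means that for each fixed $v$ the matrix $A(\cdot,v)$, viewed as an operator field in the coordinates $u^1,\dots,u^k$, is Haantjes; similarly for $B$ with respect to $v$ (with $u$ fixed). *)

theory Defs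
  imports "HOL-Analysis.Analysis" "HOL-Computational_Algebra.Polynomial"
begin

section \<open>Smooth maps\<close>

text \<open>The first argument is a linear subspace \<open>V\<close> in which \<open>S\<close> is meant to be relatively open.
  Calculus is done inside \<open>V\<close>: for \<open>x, w \<in> V\<close> the vector
  \<open>frechet_derivative f (at x within V) w\<close> is uniquely determined whenever \<open>f\<close> is differentiable
  at \<open>x\<close> within \<open>V\<close>. For \<open>V = UNIV\<close> this is ordinary calculus on open sets; other subspaces
  are only needed for the coordinate subspaces below.\<close>

primrec Ck_on ::
  "'a::euclidean_space set \<Rightarrow> nat \<Rightarrow> ('a \<Rightarrow> 'b::real_normed_vector) \<Rightarrow> 'a set \<Rightarrow> bool"
where
  "Ck_on V 0 f S \<longleftrightarrow> continuous_on S f"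
| "Ck_on V (Suc m) f S \<longleftrightarrow>
     (\<forall>x\<in>S. f differentiable (at x within V)) \<and>
     (\<forall>w\<in>V. Ck_on V m (\<lambda>x. frechet_derivative f (at x within V) w) S)"

definition smooth_on ::
  "'a::euclidean_space set \<Rightarrow> ('a \<Rightarrow> 'b::real_normed_vector) \<Rightarrow> 'a set \<Rightarrow> bool"
where
  "smooth_on V f S \<longleftrightarrow> (\<forall>m. Ck_on V m f S)"

definition partial_deriv :: "'n \<Rightarrow> (real^'n \<Rightarrow> 'b::real_normed_vector) \<Rightarrow> real^'n \<Rightarrow> 'b"
where
  "partial_deriv j f x = frechet_derivative f (at x) (axis j 1)"


section \<open>Nijenhuis and Haantjes torsion in linear coordinates\<close>

text \<open>Vector fields on a relatively open subset of \<open>V\<close> are maps with values in \<open>V\<close>; an operator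
  field is a matrix-valued map (whose values are assumed to preserve \<open>V\<close> in all uses).\<close>

definition smooth_vector_field :: "(real^'n) set \<Rightarrow> (real^'n) set \<Rightarrow> (real^'n \<Rightarrow> real^'n) \<Rightarrow> bool"
where
  "smooth_vector_field V S \<xi> \<longleftrightarrow> smooth_on V \<xi> S \<and> \<xi> ` S \<subseteq> V"

definition lie_bracket ::
  "(real^'n) set \<Rightarrow> (real^'n \<Rightarrow> real^'n) \<Rightarrow> (real^'n \<Rightarrow> real^'n) \<Rightarrow> (real^'n \<Rightarrow> real^'n)"
where
  "lie_bracket V \<xi> \<eta> = (\<lambda>x. frechet_derivative \<eta> (at x within V) (\<xi> x)
                          - frechet_derivative \<xi> (at x within V) (\<eta> x))"

definition apply_op ::
  "(real^'n \<Rightarrow> real^'n^'n) \<Rightarrow> (real^'n \<Rightarrow> real^'n) \<Rightarrow> (real^'n \<Rightarrow> real^'n)"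
where
  "apply_op L \<xi> = (\<lambda>x. L x *v \<xi> x)"

definition nijenhuis_torsion ::
  "(real^'n) set \<Rightarrow> (real^'n \<Rightarrow> real^'n^'n) \<Rightarrow>
   (real^'n \<Rightarrow> real^'n) \<Rightarrow> (real^'n \<Rightarrow> real^'n) \<Rightarrow> (real^'n \<Rightarrow> real^'n)"
where
  "nijenhuis_torsion V L \<xi> \<eta> = (\<lambda>x.
       apply_op L (apply_op L (lie_bracket V \<xi> \<eta>)) x
     + lie_bracket V (apply_op L \<xi>) (apply_op L \<eta>) x
     - apply_op L (lie_bracket V (apply_op L \<xi>) \<eta>) x
     - apply_op L (lie_bracket V \<xi> (apply_op L \<eta>)) x)"

definition haantjes_torsion ::
  "(real^'n) set \<Rightarrow> (real^'n \<Rightarrow> real^'n^'n) \<Rightarrow>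
   (real^'n \<Rightarrow> real^'n) \<Rightarrow> (real^'n \<Rightarrow> real^'n) \<Rightarrow> (real^'n \<Rightarrow> real^'n)"
where
  "haantjes_torsion V L \<xi> \<eta> = (\<lambda>x.
       apply_op L (apply_op L (nijenhuis_torsion V L \<xi> \<eta>)) x
     + nijenhuis_torsion V L (apply_op L \<xi>) (apply_op L \<eta>) x
     - apply_op L (nijenhuis_torsion V L (apply_op L \<xi>) \<eta>) x
     - apply_op L (nijenhuis_torsion V L \<xi> (apply_op L \<eta>)) x)"

definition haantjes_on :: "(real^'n) set \<Rightarrow> (real^'n) set \<Rightarrow> (real^'n \<Rightarrow> real^'n^'n) \<Rightarrow> bool"
where
  "haantjes_on V S L \<longleftrightarrow>
     (\<forall>\<xi> \<eta>. smooth_vector_field V S \<xi> \<and> smooth_vector_field V S \<eta> \<longrightarrow>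
        (\<forall>x\<in>S. haantjes_torsion V L \<xi> \<eta> x = 0))"


section \<open>Manifolds and operator fields\<close>

text \<open>A chart is a pair of its domain and its coordinate map; the values of the map outside the
  domain are irrelevant. The dimension of the manifold is \<open>CARD('n)\<close>.\<close>

type_synonym ('a, 'n) chart = "'a set \<times> ('a \<Rightarrow> real^'n)"

definition topological_chart :: "'a topology \<Rightarrow> ('a, 'n::finite) chart \<Rightarrow> bool"
where
  "topological_chart X = (\<lambda>(U, \<phi>).
     openin X U \<and> open (\<phi> ` U) \<and>
     homeomorphic_map (subtopology X U) (top_of_set (\<phi> ` U)) \<phi>)"

definition transition ::
  "('a, 'n::finite) chart \<Rightarrow> ('a, 'n) chart \<Rightarrow> real^'n \<Rightarrow> real^'n"
where
  "transition c d = snd d \<circ> inv_into (fst c) (snd c)"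

definition smoothly_compatible :: "('a, 'n::finite) chart \<Rightarrow> ('a, 'n) chart \<Rightarrow> bool"
where
  "smoothly_compatible c d \<longleftrightarrow>
     smooth_on UNIV (transition c d) (snd c ` (fst c \<inter> fst d)) \<and>
     smooth_on UNIV (transition d c) (snd d ` (fst c \<inter> fst d))"

text \<open>The atlas is maximal, so that its members are exactly the (smooth) local coordinate
  systems.\<close>

definition smooth_manifold :: "'a topology \<Rightarrow> ('a, 'n::finite) chart set \<Rightarrow> bool"
where
  "smooth_manifold X \<A> \<longleftrightarrow>
     Hausdorff_space X \<and> second_countable X \<and>
     (\<forall>c\<in>\<A>. topological_chart X c) \<and>
     (\<Union>c\<in>\<A>. fst c) = topspace X \<and>
     (\<forall>c\<in>\<A>. \<forall>d\<in>\<A>. smoothly_compatible c d) \<and>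
     (\<forall>c. topological_chart X c \<and> (\<forall>d\<in>\<A>. smoothly_compatible c d) \<longrightarrow> c \<in> \<A>)"

text \<open>A smooth \<open>(1,1)\<close>-tensor field, given by its matrix \<open>L c\<close> in every chart \<open>c\<close> as a function of
  the coordinates; the matrices act on coordinate column vectors of the tangent spaces, hence
  are conjugated by the Jacobi matrix under a change of chart.\<close>

definition operator_field ::
  "('a, 'n::finite) chart set \<Rightarrow> (('a, 'n) chart \<Rightarrow> real^'n \<Rightarrow> real^'n^'n) \<Rightarrow> bool"
where
  "operator_field \<A> L \<longleftrightarrow>
     (\<forall>c\<in>\<A>. smooth_on UNIV (L c) (snd c ` fst c)) \<and>
     (\<forall>c\<in>\<A>. \<forall>d\<in>\<A>. \<forall>q \<in> fst c \<inter> fst d.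
        let J = jacobian (transition c d) (at (snd c q))
        in L d (snd d q) ** J = J ** L c (snd c q))"

definition haantjes_operator ::
  "('a, 'n::finite) chart set \<Rightarrow> (('a, 'n) chart \<Rightarrow> real^'n \<Rightarrow> real^'n^'n) \<Rightarrow> bool"
where
  "haantjes_operator \<A> L \<longleftrightarrow>
     operator_field \<A> L \<and> (\<forall>c\<in>\<A>. haantjes_on UNIV (snd c ` fst c) (L c))"

definition charpoly :: "real^'n^'n \<Rightarrow> real poly"
where
  "charpoly A = det (mat [:0, 1:] - (\<chi> i j. [:A $ i $ j:]))"


section \<open>Splitting the coordinates into two groups\<close>

text \<open>The coordinates \<open>(u, v)\<close> are the coordinates of \<open>real^'n\<close>, where \<open>K\<close> is the set of indices of
  the coordinates \<open>u\<close> and \<open>- K\<close> that of the coordinates \<open>v\<close>; \<open>K\<close> or \<open>- K\<close> may be empty. A point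
  \<open>(u, v)\<close> is written \<open>u + v\<close> with \<open>u \<in> coord_space K\<close> and \<open>v \<in> coord_space (- K)\<close>, and a square
  matrix indexed by \<open>K\<close> is represented by its extension by zero.\<close>

definition coord_space :: "'n set \<Rightarrow> (real^'n) set"
where
  "coord_space K = {x. \<forall>i. i \<notin> K \<longrightarrow> x $ i = 0}"

definition matrix_on :: "'n set \<Rightarrow> real^'n^'n \<Rightarrow> bool"
where
  "matrix_on K A \<longleftrightarrow> (\<forall>i j. \<not> (i \<in> K \<and> j \<in> K) \<longrightarrow> A $ i $ j = 0)"

definition block_diag :: "'n set \<Rightarrow> real^'n^'n \<Rightarrow> real^'n^'n \<Rightarrow> real^'n^'n"
where
  "block_diag K A B =
     (\<chi> i j. if i \<in> K \<and> j \<in> K then A $ i $ j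
             else if i \<notin> K \<and> j \<notin> K then B $ i $ j
             else 0)"

definition smooth_block ::
  "'n set \<Rightarrow> (real^'n) set \<Rightarrow> (real^'n \<Rightarrow> real^'n^'n) \<Rightarrow> bool"
where
  "smooth_block K W A \<longleftrightarrow> smooth_on UNIV A W \<and> (\<forall>x\<in>W. matrix_on K (A x))"

text \<open>\<open>A\<close> is Haantjes with respect to the coordinates in \<open>K\<close>: for all fixed values \<open>v\<close> of the other
  coordinates, \<open>A(\<cdot>, v)\<close> is a Haantjes operator on the slice, an open subset of
  \<open>coord_space K\<close>.\<close>

definition haantjes_wrt ::
  "'n set \<Rightarrow> (real^'n) set \<Rightarrow> (real^'n \<Rightarrow> real^'n^'n) \<Rightarrow> bool"
where
  "haantjes_wrt K W A \<longleftrightarrow>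
     (\<forall>v \<in> coord_space (- K).
        haantjes_on (coord_space K) {u \<in> coord_space K. u + v \<in> W} (\<lambda>u. A (u + v)))"

end

theory Submission
  imports Defs "HOL-Computational_Algebra.Polynomial_Factorial" "HOL-Computational_Algebra.Field_as_Ring"
begin

text \<open>At a point, both torsions are tensors in the value and the first derivative of \<open>L\<close>. For a block
  diagonal operator the mixed components of the Haantjes tensor are the square of the Sylvester
  operator \<open>C \<mapsto> (b \<mapsto> A C\<^sub>b - C\<^bsub>B b\<^esub>)\<close> applied to the commutators \<open>[A, A\<^sub>v]\<close>, respectively \<open>[B, B\<^sub>u]\<close>.
  This gives the converse part at once; it also gives (iii) and (iv) as soon as the spectra of the
  blocks are disjoint, because the Sylvester operator is then injective.

  To find the coordinates, extend the spectral projection \<open>P0\<close> of \<open>L(p)\<close> to a smooth field \<open>P\<close> of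
  projections commuting with \<open>L\<close>, by solving a Riccati equation with the implicit function theorem.
  The obstruction to the involutivity of \<open>im P\<close> and of \<open>ker P\<close> is again killed by a product of injective
  Sylvester operators, so that both distributions are integrable. The theorem of Frobenius is proved
  by integrating \<open>\<gamma>' = P(\<gamma>) (P0 z)\<close>. The implicit function theorem and the smooth dependence of the
  solutions of differential equations on parameters are both instances of a statement on smooth
  families of fixed points \<open>y = I (g(z, y))\<close>, where \<open>I\<close> is the identity or integration.\<close>

section \<open>Torsion tensors at a point\<close>

text \<open>The factors \<open>p1\<close> and \<open>p2\<close> are real and may have no real roots,
  so neither eigenvectors nor triangular forms of the blocks are at hand. The spectral information
  is condensed in \<open>separated\<close>: no nonzero off-diagonal matrix commutes with
  \<open>L\<close>. This follows from a Bezout identity, persists under small perturbations and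
  changes of chart, and is used through the injectivity of commutator maps in one argument at a
  time. The implicit function theorem is applied on the whole matrix space: the block diagonal part
  of the unknown is added to the Riccati equation, so that the off-diagonal matrices need not become
  a space of their own. A contraction constant \<open>1 / 2\<close> for \<open>g\<close> is
  inherited by the linearised fixed point equation. The derivative of a family of fixed points is
  therefore again such a family, which closes the induction over the order of differentiability. The
  curves in the theorem of Frobenius run for the fixed time one, because integration over the unit
  interval does not increase the supremum norm; smallness comes from the parameter
  \<open>z\<close>.\<close>

lemma bounded_bilinear_matrix_vector_mult:
  "bounded_bilinear ((*v) :: real^'n^'m \<Rightarrow> real^'n \<Rightarrow> real^'m)"
  by (simp add: bilinear_conv_bounded_bilinear[symmetric] bilinear_def linear_iff
      matrix_vector_right_distrib matrix_vector_mult_add_rdistrib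
      matrix_vector_mult_scaleR scaleR_matrix_vector_assoc[symmetric])

lemma scaleR_matrix_mult_left: "(c *\<^sub>R A) ** B = c *\<^sub>R (A ** (B::real^'n^'m))"
  by (simp add: matrix_matrix_mult_def vec_eq_iff sum_distrib_left ac_simps)

lemma scaleR_matrix_mult_right: "A ** (c *\<^sub>R B) = c *\<^sub>R (A ** (B::real^'n^'m))"
  by (simp add: matrix_matrix_mult_def vec_eq_iff sum_distrib_left ac_simps)

lemma matrix_add_rdistrib: "(A + B) ** C = A ** C + B ** (C :: 'a::semiring_1^'k^'n)"
  by (simp add: matrix_matrix_mult_def vec_eq_iff sum.distrib distrib_right)

lemma bounded_bilinear_matrix_mult:
  "bounded_bilinear ((**) :: real^'n^'m \<Rightarrow> real^'k^'n \<Rightarrow> real^'k^'m)"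
  by (simp add: bilinear_conv_bounded_bilinear[symmetric] bilinear_def linear_iff
      matrix_add_ldistrib matrix_add_rdistrib scaleR_matrix_mult_left scaleR_matrix_mult_right)

lemmas has_derivative_mv = bounded_bilinear.FDERIV[OF bounded_bilinear_matrix_vector_mult]
lemmas has_derivative_mm = bounded_bilinear.FDERIV[OF bounded_bilinear_matrix_mult]

text \<open>Restricting \<open>f\<close> to the line through \<open>x\<close> in direction
  \<open>w\<close>, which stays in \<open>V\<close>, turns the claim into uniqueness of a derivative
  on \<open>real\<close>. As a linear map, a derivative within a proper subspace is not unique; only
  its values on \<open>V\<close> can be computed.\<close>

lemma frechet_derivative_within_subspace:
  fixes f :: "'a::euclidean_space \<Rightarrow> 'b::real_normed_vector"
  assumes V: "subspace V" "x \<in> V" "w \<in> V" and f': "(f has_derivative f') (at x within V)"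
  shows "frechet_derivative f (at x within V) w = f' w"
proof -
  have *: "((\<lambda>t::real. f (x + t *\<^sub>R w)) has_derivative (\<lambda>t. g (t *\<^sub>R w))) (at 0)"
    if g: "(f has_derivative g) (at x within V)" for g
  proof -
    have l: "((\<lambda>t::real. x + t *\<^sub>R w) has_derivative (\<lambda>t. t *\<^sub>R w)) (at 0)"
      by (auto intro!: derivative_eq_intros)
    have "range (\<lambda>t::real. x + t *\<^sub>R w) \<subseteq> V"
      using V by (auto intro: subspace_add subspace_scale)
    then have "(f has_derivative g) (at (x + 0 *\<^sub>R w) within range (\<lambda>t::real. x + t *\<^sub>R w))"
      using has_derivative_subset[OF g] by simp
    from has_derivative_in_compose[OF l this] show ?thesis by simp
  qed
  have d: "(f has_derivative frechet_derivative f (at x within V)) (at x within V)"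
    using f' frechet_derivative_works differentiableI by blast
  have "(\<lambda>t::real. frechet_derivative f (at x within V) (t *\<^sub>R w)) = (\<lambda>t. f' (t *\<^sub>R w))"
    using has_derivative_unique[OF *[OF d] *[OF f']] .
  from fun_cong[OF this, of 1] show ?thesis by simp
qed

text \<open>Constancy is asked for on \<open>V\<close> only, because the induction continues with
  the derivative picked by \<open>frechet_derivative\<close>, which is known to vanish only at
  points of \<open>V\<close> and in directions of \<open>V\<close>.\<close>

lemma Ck_on_const:
  fixes f :: "'a::euclidean_space \<Rightarrow> 'b::real_normed_vector"
  assumes "subspace V" "S \<subseteq> V" "\<And>x. x \<in> V \<Longrightarrow> f x = c"
  shows "Ck_on V m f S"
  using assms(3)
proof (induction m arbitrary: f c)
  case 0
  then have "continuous_on S f \<longleftrightarrow> continuous_on S (\<lambda>_. c)"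
    using assms(2) by (intro continuous_on_cong) auto
  then show ?case by simp
next
  case (Suc m)
  have d: "(f has_derivative (\<lambda>_. 0)) (at x within V)" if "x \<in> V" for x
    using Suc.prems that has_derivative_transform[of x V f "\<lambda>_. c"] by force
  have "Ck_on V m (\<lambda>x. frechet_derivative f (at x within V) w) S" if "w \<in> V" for w
    using frechet_derivative_within_subspace[OF assms(1) _ that d] by (intro Suc.IH[of _ 0]) auto
  then show ?case using d assms(2) by (auto simp: differentiable_def)
qed

lemma smooth_vector_field_const:
  assumes "subspace V" "S \<subseteq> V" "a \<in> V"
  shows "smooth_vector_field V S (\<lambda>_. a)"
  using assms Ck_on_const[OF assms(1,2), of "\<lambda>_. a" a]
  by (auto simp: smooth_vector_field_def smooth_on_def)

lemma smooth_on_differentiable: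
  "smooth_on V f S \<Longrightarrow> x \<in> S \<Longrightarrow> f differentiable (at x within V)"
  unfolding smooth_on_def by (metis Ck_on.simps(2))

text \<open>The torsion at a point where \<open>L\<close> equals \<open>M\<close> and has derivative
  \<open>T\<close>: the derivatives of the two vector fields cancel from the four brackets, and only
  the one-jet of \<open>L\<close> remains.\<close>

definition nijenhuis_tensor ::
  "real^'n^'n \<Rightarrow> (real^'n \<Rightarrow> real^'n^'n) \<Rightarrow> real^'n \<Rightarrow> real^'n \<Rightarrow> real^'n"
where
  "nijenhuis_tensor M T a b =
     T (M *v a) *v b - T (M *v b) *v a - M *v (T a *v b) + M *v (T b *v a)"

definition haantjes_tensor ::
  "real^'n^'n \<Rightarrow> (real^'n \<Rightarrow> real^'n^'n) \<Rightarrow> real^'n \<Rightarrow> real^'n \<Rightarrow> real^'n"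
where
  "haantjes_tensor M T a b =
     M *v (M *v nijenhuis_tensor M T a b) + nijenhuis_tensor M T (M *v a) (M *v b)
     - M *v nijenhuis_tensor M T (M *v a) b - M *v nijenhuis_tensor M T a (M *v b)"

lemma lie_bracket_at:
  assumes "subspace V" "x \<in> V" "\<xi> x \<in> V" "\<eta> x \<in> V"
    and "(\<xi> has_derivative X') (at x within V)" "(\<eta> has_derivative Y') (at x within V)"
  shows "lie_bracket V \<xi> \<eta> x = Y' (\<xi> x) - X' (\<eta> x)"
  using assms by (simp add: lie_bracket_def frechet_derivative_within_subspace)

lemma apply_op_has_derivative:
  assumes "(L has_derivative T) (at x within V)" "(\<xi> has_derivative X') (at x within V)"
  shows "(apply_op L \<xi> has_derivative (\<lambda>h. L x *v X' h + T h *v \<xi> x)) (at x within V)"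
  unfolding apply_op_def by (rule has_derivative_mv[OF assms])

lemma nijenhuis_torsion_at:
  assumes V: "subspace V" "x \<in> V" "\<xi> x \<in> V" "\<eta> x \<in> V" "\<And>v. v \<in> V \<Longrightarrow> L x *v v \<in> V"
    and D: "(L has_derivative T) (at x within V)"
    "\<xi> differentiable (at x within V)" "\<eta> differentiable (at x within V)"
  shows "nijenhuis_torsion V L \<xi> \<eta> x = nijenhuis_tensor (L x) T (\<xi> x) (\<eta> x)"
proof -
  obtain X' Y' where X: "(\<xi> has_derivative X') (at x within V)"
    and Y: "(\<eta> has_derivative Y') (at x within V)"
    using D by (auto simp: differentiable_def)
  note d = apply_op_has_derivative[OF D(1) X] apply_op_has_derivative[OF D(1) Y]
  have m: "apply_op L \<xi> x \<in> V" "apply_op L \<eta> x \<in> V"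
    using V by (auto simp: apply_op_def)
  show ?thesis
    using lie_bracket_at[OF V(1,2) V(3,4) X Y] lie_bracket_at[OF V(1,2) m d]
      lie_bracket_at[OF V(1,2) m(1) V(4) d(1) Y] lie_bracket_at[OF V(1,2) V(3) m(2) X d(2)]
    by (simp add: nijenhuis_torsion_def nijenhuis_tensor_def apply_op_def
        matrix_vector_mult_diff_distrib matrix_vector_right_distrib)
qed

lemma haantjes_torsion_at:
  assumes V: "subspace V" "x \<in> V" "\<xi> x \<in> V" "\<eta> x \<in> V" "\<And>v. v \<in> V \<Longrightarrow> L x *v v \<in> V"
    and D: "(L has_derivative T) (at x within V)"
    "\<xi> differentiable (at x within V)" "\<eta> differentiable (at x within V)"
  shows "haantjes_torsion V L \<xi> \<eta> x = haantjes_tensor (L x) T (\<xi> x) (\<eta> x)"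
proof -
  have d: "apply_op L \<zeta> differentiable (at x within V)" if "\<zeta> differentiable (at x within V)" for \<zeta>
    using that apply_op_has_derivative[OF D(1)] by (meson differentiable_def)
  have m: "apply_op L \<zeta> x \<in> V" if "\<zeta> x \<in> V" for \<zeta>
    using V(5) that by (auto simp: apply_op_def)
  have N: "nijenhuis_torsion V L \<alpha> \<beta> x = nijenhuis_tensor (L x) T (\<alpha> x) (\<beta> x)"
    if "\<alpha> x \<in> V" "\<beta> x \<in> V" "\<alpha> differentiable (at x within V)" "\<beta> differentiable (at x within V)"
    for \<alpha> \<beta>
    using nijenhuis_torsion_at[OF V(1,2) that(1,2) V(5) D(1) that(3,4)] by blast
  show ?thesis
    using V D d m unfolding haantjes_torsion_def haantjes_tensor_def
    by (simp add: N) (simp add: apply_op_def N)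
qed

text \<open>Constant fields with values in \<open>V\<close> are smooth and realise every pair of
  vectors, and for arbitrary fields only the values at the point matter. The quantifier over vector
  fields thus becomes linear algebra at each point.\<close>

lemma haantjes_on_iff_tensor:
  assumes V: "subspace V" "S \<subseteq> V" "\<And>x v. x \<in> S \<Longrightarrow> v \<in> V \<Longrightarrow> L x *v v \<in> V"
    and D: "\<And>x. x \<in> S \<Longrightarrow> (L has_derivative T x) (at x within V)"
  shows "haantjes_on V S L \<longleftrightarrow> (\<forall>x\<in>S. \<forall>a\<in>V. \<forall>b\<in>V. haantjes_tensor (L x) (T x) a b = 0)"
proof
  assume H: "haantjes_on V S L"
  show "\<forall>x\<in>S. \<forall>a\<in>V. \<forall>b\<in>V. haantjes_tensor (L x) (T x) a b = 0"
  proof (intro ballI)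
    fix x a b assume "x \<in> S" "a \<in> V" "b \<in> V"
    with haantjes_torsion_at[OF V(1), of x "\<lambda>_. a" "\<lambda>_. b" L "T x"] D V
      H[unfolded haantjes_on_def, rule_format, of "\<lambda>_. a" "\<lambda>_. b" x]
    show "haantjes_tensor (L x) (T x) a b = 0"
      by (auto simp: smooth_vector_field_const)
  qed
next
  assume H: "\<forall>x\<in>S. \<forall>a\<in>V. \<forall>b\<in>V. haantjes_tensor (L x) (T x) a b = 0"
  show "haantjes_on V S L"
    unfolding haantjes_on_def
  proof (intro allI impI ballI, elim conjE)
    fix \<xi> \<eta> x
    assume "smooth_vector_field V S \<xi>" "smooth_vector_field V S \<eta>" "x \<in> S"
    then have s: "smooth_on V \<xi> S" "smooth_on V \<eta> S" "\<xi> x \<in> V" "\<eta> x \<in> V" "x \<in> V"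
      using V(2) by (auto simp: smooth_vector_field_def)
    then show "haantjes_torsion V L \<xi> \<eta> x = 0"
      using haantjes_torsion_at[where L = L and \<xi> = \<xi> and \<eta> = \<eta>, OF V(1) s(5,3,4) V(3)[OF \<open>x \<in> S\<close>] D[OF \<open>x \<in> S\<close>]]
        \<open>x \<in> S\<close> H
        smooth_on_differentiable[OF s(1)] smooth_on_differentiable[OF s(2)] by simp
  qed
qed


section \<open>Block diagonal operators\<close>

definition coord_proj :: "'n set \<Rightarrow> real^'n^'n"
where
  "coord_proj K = (\<chi> i j. if i = j \<and> i \<in> K then 1 else 0)"

lemma coord_proj_mv: "coord_proj K *v x = (\<chi> i. if i \<in> K then x $ i else 0)"
proof -
  have "(\<Sum>j\<in>UNIV. (if i = j \<and> i \<in> K then 1 else 0) * x $ j) = (if i \<in> K then x $ i else 0)" for i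
    using sum.delta'[of UNIV i "\<lambda>j. x $ j"] by (auto simp: if_distrib[of "\<lambda>c. c * _"] cong: if_cong)
  then show ?thesis
    by (simp add: coord_proj_def matrix_vector_mult_def)
qed

lemma subspace_coord_space: "subspace (coord_space K)"
  by (auto simp: coord_space_def subspace_def)

lemma coord_proj_in [simp]: "coord_proj K *v x \<in> coord_space K"
  by (simp add: coord_proj_mv coord_space_def)

lemma coord_proj_id: "x \<in> coord_space K \<Longrightarrow> coord_proj K *v x = x"
  by (auto simp: coord_proj_mv coord_space_def vec_eq_iff)

lemma coord_proj_kill: "x \<in> coord_space (- K) \<Longrightarrow> coord_proj K *v x = 0"
  by (auto simp: coord_proj_mv coord_space_def vec_eq_iff)

lemma coord_proj_add_compl: "coord_proj K + coord_proj (- K) = mat 1"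
  by (auto simp: coord_proj_def mat_def vec_eq_iff)

lemma coord_decomp: "x = coord_proj K *v x + coord_proj (- K) *v x"
  by (auto simp: coord_proj_mv vec_eq_iff)

lemma coord_space_disjoint:
  "x \<in> coord_space K \<Longrightarrow> x \<in> coord_space (- K) \<Longrightarrow> x = 0"
  by (auto simp: coord_space_def vec_eq_iff)

lemma coord_space_add_eq_0:
  assumes "x \<in> coord_space K" "y \<in> coord_space (- K)" "x + y = 0"
  shows "x = 0" "y = 0"
proof -
  have "x = - y" using assms(3) by (simp add: eq_neg_iff_add_eq_0)
  then show "x = 0"
    using coord_space_disjoint assms subspace_neg[OF subspace_coord_space] by metis
  then show "y = 0" using assms by simp
qed

lemma matrix_on_in: "matrix_on K A \<Longrightarrow> A *v x \<in> coord_space K"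
  by (auto simp: matrix_on_def coord_space_def matrix_vector_mult_def intro!: sum.neutral)

lemma matrix_on_kill: "matrix_on K A \<Longrightarrow> x \<in> coord_space (- K) \<Longrightarrow> A *v x = 0"
  by (force simp: matrix_on_def coord_space_def matrix_vector_mult_def vec_eq_iff intro!: sum.neutral)

lemma matrix_on_kill': "matrix_on (- K) A \<Longrightarrow> x \<in> coord_space K \<Longrightarrow> A *v x = 0"
  by (rule matrix_on_kill) auto

lemma block_diag_eq_add: "matrix_on K A \<Longrightarrow> matrix_on (- K) B \<Longrightarrow> block_diag K A B = A + B"
  by (auto simp: matrix_on_def block_diag_def vec_eq_iff)

lemma matrix_on_derivative:
  fixes A :: "real^'n \<Rightarrow> real^'n^'n"
  assumes "open W" "x \<in> W" "\<And>y. y \<in> W \<Longrightarrow> matrix_on K (A y)" "(A has_derivative T) (at x)"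
  shows "matrix_on K (T h)"
  unfolding matrix_on_def
proof (intro allI impI)
  fix i j assume ij: "\<not> (i \<in> K \<and> j \<in> K)"
  have "bounded_linear (\<lambda>M::real^'n^'n. M $ i $ j)"
    using bounded_linear_compose[OF bounded_linear_vec_nth bounded_linear_vec_nth] by blast
  then have "((\<lambda>y. A y $ i $ j) has_derivative (\<lambda>h. T h $ i $ j)) (at x)"
    using assms(4) bounded_linear.has_derivative by blast
  moreover have "((\<lambda>y. A y $ i $ j) has_derivative (\<lambda>h. 0)) (at x)"
  proof (rule has_derivative_transform_within_open[of "\<lambda>_. 0"])
    show "\<And>y. y \<in> W \<Longrightarrow> 0 = A y $ i $ j" using assms(3) ij by (auto simp: matrix_on_def)
  qed (use assms in auto)
  ultimately show "T h $ i $ j = 0" using has_derivative_unique fun_cong by metis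
qed

lemma coord_space_closed [simp]:
  "x \<in> coord_space K \<Longrightarrow> y \<in> coord_space K \<Longrightarrow> x + y \<in> coord_space K"
  "x \<in> coord_space K \<Longrightarrow> y \<in> coord_space K \<Longrightarrow> x - y \<in> coord_space K"
  "0 \<in> coord_space K"
  "x \<in> coord_space K \<Longrightarrow> c *\<^sub>R x \<in> coord_space K"
  "x \<in> coord_space K \<Longrightarrow> - x \<in> coord_space K"
  by (auto simp: coord_space_def)

text \<open>Only derivatives in directions of \<open>coord_space K\<close> contribute, and the other
  block annihilates \<open>coord_space K\<close>. This is why freezing the remaining coordinates, as
  in \<open>haantjes_wrt\<close>, captures the pure components completely.\<close>

lemma nijenhuis_tensor_block:
  assumes "matrix_on K A" "matrix_on (- K) B" "\<And>h. matrix_on K (T h)" "\<And>h. matrix_on (- K) (U h)"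
    and "a \<in> coord_space K" "b \<in> coord_space K"
  shows "nijenhuis_tensor (A + B) (\<lambda>h. T h + U h) a b = nijenhuis_tensor A T a b"
    and "nijenhuis_tensor A T a b \<in> coord_space K"
proof -
  have k: "B *v x = 0" "U h *v x = 0" if "x \<in> coord_space K" for x h
    using assms(2,4) that matrix_on_kill' by blast+
  show "nijenhuis_tensor (A + B) (\<lambda>h. T h + U h) a b = nijenhuis_tensor A T a b"
    and "nijenhuis_tensor A T a b \<in> coord_space K"
    using assms
    by (simp_all add: nijenhuis_tensor_def matrix_vector_mult_add_rdistrib k matrix_on_in)
qed

lemma haantjes_tensor_block:
  assumes "matrix_on K A" "matrix_on (- K) B" "\<And>h. matrix_on K (T h)" "\<And>h. matrix_on (- K) (U h)"
    and "a \<in> coord_space K" "b \<in> coord_space K"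
  shows "haantjes_tensor (A + B) (\<lambda>h. T h + U h) a b = haantjes_tensor A T a b"
proof -
  have M: "(A + B) *v x = A *v x" if "x \<in> coord_space K" for x
    using assms that by (simp add: matrix_vector_mult_add_rdistrib matrix_on_kill')
  show ?thesis
    using assms
    by (simp add: haantjes_tensor_def M matrix_on_in nijenhuis_tensor_block[OF assms(1-4)])
qed

lemma nijenhuis_tensor_antisym: "nijenhuis_tensor M T a b = - nijenhuis_tensor M T b a"
  by (simp add: nijenhuis_tensor_def)

lemma haantjes_tensor_antisym: "haantjes_tensor M T a b = - haantjes_tensor M T b a"
  unfolding haantjes_tensor_def
  by (subst (1 2 3 4) nijenhuis_tensor_antisym) (simp add: vec.neg algebra_simps)

text \<open>The first bracket lies in \<open>coord_space K\<close>, the second in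
  \<open>coord_space (- K)\<close>: the mixed component decouples into one expression for each
  block.\<close>

lemma nijenhuis_tensor_mixed:
  assumes "matrix_on K A" "matrix_on (- K) B" "\<And>h. matrix_on K (T h)" "\<And>h. matrix_on (- K) (U h)"
    and "a \<in> coord_space K" "b \<in> coord_space (- K)"
  shows "nijenhuis_tensor (A + B) (\<lambda>h. T h + U h) a b
    = (A *v (T b *v a) - T (B *v b) *v a) - (B *v (U a *v b) - U (A *v a) *v b)"
proof -
  have k: "A *v x = 0" "T h *v x = 0" if "x \<in> coord_space (- K)" for x h
    using assms(1,3) that matrix_on_kill by blast+
  have k': "B *v x = 0" "U h *v x = 0" if "x \<in> coord_space K" for x h
    using assms(2,4) that matrix_on_kill' by blast+
  show ?thesis
    using assms
    by (simp add: nijenhuis_tensor_def matrix_vector_mult_add_rdistrib k k' matrix_on_in)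
qed

text \<open>The right-hand side is grouped as the square of \<open>C \<mapsto> (b \<mapsto> A C\<^sub>b - C\<^bsub>B b\<^esub>)\<close> and of its analogue with the
  two blocks exchanged.\<close>

lemma haantjes_tensor_mixed:
  assumes "matrix_on K A" "matrix_on (- K) B" "\<And>h. matrix_on K (T h)" "\<And>h. matrix_on (- K) (U h)"
    and "a \<in> coord_space K" "b \<in> coord_space (- K)"
    and C: "\<And>h x. C h x = A *v (T h *v x) - T h *v (A *v x)"
    and E: "\<And>h x. E h x = B *v (U h *v x) - U h *v (B *v x)"
  shows "haantjes_tensor (A + B) (\<lambda>h. T h + U h) a b
    = (A *v (A *v C b a - C (B *v b) a) - (A *v C (B *v b) a - C (B *v (B *v b)) a))
    - (B *v (B *v E a b - E (A *v a) b) - (B *v E (A *v a) b - E (A *v (A *v a)) b))"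
proof -
  have M: "(A + B) *v x = A *v x" if "x \<in> coord_space K" for x
    using assms that by (simp add: matrix_vector_mult_add_rdistrib matrix_on_kill')
  have M': "(A + B) *v x = B *v x" if "x \<in> coord_space (- K)" for x
    using assms that by (simp add: matrix_vector_mult_add_rdistrib matrix_on_kill)
  have k: "A *v x = 0" "T h *v x = 0" if "x \<in> coord_space (- K)" for x h
    using assms(1,3) that matrix_on_kill by blast+
  have k': "B *v x = 0" "U h *v x = 0" if "x \<in> coord_space K" for x h
    using assms(2,4) that matrix_on_kill' by blast+
  show ?thesis
    using assms(1-6)
    by (simp add: haantjes_tensor_def M M' k k' matrix_on_in nijenhuis_tensor_mixed[OF assms(1-4)] C E
        matrix_vector_mult_diff_distrib matrix_vector_right_distrib matrix_vector_mult_add_rdistrib)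
qed

lemma linear_matrix_commutator:
  assumes "linear T"
  shows "linear (\<lambda>h. A *v (T h *v x) - T h *v (A *v (x::real^'n)))"
  using assms
  by (simp add: linear_iff matrix_vector_mult_add_rdistrib matrix_vector_right_distrib
      scaleR_matrix_vector_assoc[symmetric] matrix_vector_mult_scaleR algebra_simps)

lemma nijenhuis_tensor_linear_right:
  assumes "linear T"
  shows "linear (nijenhuis_tensor M T a)"
  using assms
  by (simp add: linear_iff nijenhuis_tensor_def matrix_vector_mult_add_rdistrib
      matrix_vector_right_distrib scaleR_matrix_vector_assoc[symmetric] matrix_vector_mult_scaleR
      algebra_simps)

lemma haantjes_tensor_linear_right:
  assumes "linear T"
  shows "linear (haantjes_tensor M T a)"
  using nijenhuis_tensor_linear_right[OF assms, of M]
  by (simp add: linear_iff haantjes_tensor_def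
      matrix_vector_right_distrib matrix_vector_mult_scaleR algebra_simps)

lemma commutes_partial_iff:
  assumes "linear T"
  shows "(\<forall>b\<in>coord_space K. \<forall>x. A *v (T b *v x) - T b *v (A *v x) = 0)
    \<longleftrightarrow> (\<forall>j\<in>K. A ** T (axis j 1) - T (axis j 1) ** A = (0::real^'n^'n))" (is "?L \<longleftrightarrow> ?R")
proof
  assume ?L
  then show ?R
    by (auto simp: coord_space_def axis_def matrix_eq matrix_vector_mult_diff_rdistrib
        matrix_vector_mul_assoc[symmetric])
next
  assume R: ?R
  show ?L
  proof (intro ballI allI)
    fix b x assume b: "b \<in> coord_space K"
    define C where "C = (\<lambda>h. A *v (T h *v x) - T h *v (A *v x))"
    have C: "linear C" unfolding C_def by (rule linear_matrix_commutator[OF assms])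
    have z: "C (axis j 1) = 0" if "j \<in> K" for j
      using bspec[OF R that] by (simp add: C_def matrix_eq matrix_vector_mult_diff_rdistrib
        matrix_vector_mul_assoc[symmetric])
    have "C b = C (\<Sum>j\<in>UNIV. b $ j *\<^sub>R axis j 1)"
      using basis_expansion[of b] by (simp add: scalar_mult_eq_scaleR)
    also have "\<dots> = (\<Sum>j\<in>UNIV. b $ j *\<^sub>R C (axis j 1))"
      by (simp add: linear_sum[OF C] linear_cmul[OF C])
    also have "\<dots> = 0"
      using b z by (intro sum.neutral) (auto simp: coord_space_def)
    finally show "A *v (T b *v x) - T b *v (A *v x) = 0" by (simp add: C_def)
  qed
qed

text \<open>The slice map \<open>u \<mapsto> A (u + v)\<close> has \<open>T (u + v)\<close> as a
  derivative within \<open>coord_space K\<close>, and each point of \<open>W\<close> lies on exactly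
  one slice.\<close>

lemma haantjes_wrt_iff_tensor:
  assumes D: "\<And>x. x \<in> W \<Longrightarrow> (A has_derivative T x) (at x)"
    and A: "\<And>x. x \<in> W \<Longrightarrow> matrix_on K (A x)"
  shows "haantjes_wrt K W A \<longleftrightarrow>
    (\<forall>x\<in>W. \<forall>a\<in>coord_space K. \<forall>b\<in>coord_space K. haantjes_tensor (A x) (T x) a b = 0)"
proof -
  have d: "((\<lambda>u. A (u + v)) has_derivative T (u + v)) (at u within coord_space K)" if "u + v \<in> W" for u v
  proof -
    have "((\<lambda>u. u + v) has_derivative (\<lambda>h. h)) (at u)" by (auto intro!: derivative_eq_intros)
    from has_derivative_compose[OF this D[OF that]] show ?thesis
      by (rule has_derivative_at_withinI)
  qed
  have "haantjes_wrt K W A \<longleftrightarrow> (\<forall>v\<in>coord_space (- K). \<forall>x\<in>{u \<in> coord_space K. u + v \<in> W}.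
      \<forall>a\<in>coord_space K. \<forall>b\<in>coord_space K. haantjes_tensor (A (x + v)) (T (x + v)) a b = 0)"
    unfolding haantjes_wrt_def
    by (intro ball_cong refl haantjes_on_iff_tensor) (auto simp: subspace_coord_space matrix_on_in A d)
  also have "\<dots> \<longleftrightarrow> (\<forall>x\<in>W. \<forall>a\<in>coord_space K. \<forall>b\<in>coord_space K. haantjes_tensor (A x) (T x) a b = 0)"
    (is "?L \<longleftrightarrow> ?R")
  proof
    assume L: ?L
    show ?R
    proof
      fix x assume "x \<in> W"
      then show "\<forall>a\<in>coord_space K. \<forall>b\<in>coord_space K. haantjes_tensor (A x) (T x) a b = 0"
        using bspec[OF bspec[OF L, of "coord_proj (- K) *v x"], of "coord_proj K *v x"]
        by (simp flip: coord_decomp)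
    qed
  qed auto
  finally show ?thesis .
qed

text \<open>By bilinearity it is enough to take arguments from the two coordinate spaces. The pure
  components vanish by (ii). Every term of a mixed component contains a commutator
  \<open>[A, A\<^sub>v]\<close> or \<open>[B, B\<^sub>u]\<close>, because the blocks preserve their
  coordinate spaces and so keep the directions \<open>B b\<close> and \<open>A a\<close>
  admissible.\<close>

proposition block_diag_haantjes:
  fixes W :: "(real^'n) set"
  assumes W: "open W" and A: "smooth_block K W A" and B: "smooth_block (- K) W B"
    and HA: "haantjes_wrt K W A" and HB: "haantjes_wrt (- K) W B"
    and CA: "\<forall>x\<in>W. \<forall>j. j \<notin> K \<longrightarrow> A x ** partial_deriv j A x - partial_deriv j A x ** A x = 0"
    and CB: "\<forall>x\<in>W. \<forall>i\<in>K. B x ** partial_deriv i B x - partial_deriv i B x ** B x = 0"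
  shows "haantjes_on UNIV W (\<lambda>x. block_diag K (A x) (B x))"
proof -
  define T where "T x = frechet_derivative A (at x)" for x
  define U where "U x = frechet_derivative B (at x)" for x
  have m: "matrix_on K (A x)" "matrix_on (- K) (B x)" if "x \<in> W" for x
    using A B that by (auto simp: smooth_block_def)
  have D: "(A has_derivative T x) (at x)" "(B has_derivative U x) (at x)" if "x \<in> W" for x
    using A B that smooth_on_differentiable frechet_derivative_works
    unfolding smooth_block_def T_def U_def by blast+
  have mT: "matrix_on K (T x h)" "matrix_on (- K) (U x h)" if "x \<in> W" for x h
    using matrix_on_derivative[OF W that] m D[OF that] by blast+
  have lin: "linear (T x)" "linear (U x)" if "x \<in> W" for x
    using D[OF that] has_derivative_linear by blast+
  have "((\<lambda>x. block_diag K (A x) (B x)) has_derivative (\<lambda>h. T x h + U x h)) (at x)" if "x \<in> W" for x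
    by (rule has_derivative_transform_within_open[OF has_derivative_add[OF D[OF that]] W that])
      (simp add: block_diag_eq_add m)
  moreover have "haantjes_tensor (block_diag K (A x) (B x)) (\<lambda>h. T x h + U x h) a b = 0"
    if x: "x \<in> W" for x a b
  proof -
    let ?H = "haantjes_tensor (A x + B x) (\<lambda>h. T x h + U x h)"
    have HKK: "?H a b = 0" if "a \<in> coord_space K" "b \<in> coord_space K" for a b
      using haantjes_tensor_block[OF m[OF x] mT[OF x] that] HA x that
      by (simp add: haantjes_wrt_iff_tensor[OF D(1) m(1)])
    have HLL: "?H a b = 0" if "a \<in> coord_space (- K)" "b \<in> coord_space (- K)" for a b
      using haantjes_tensor_block[OF m(2)[OF x] _ mT(2)[OF x] _ that, of "A x" "T x"] HB x that m(1) mT(1)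
      by (simp add: haantjes_wrt_iff_tensor[OF D(2) m(2)] add.commute)
    have HKL: "?H a b = 0" if "a \<in> coord_space K" "b \<in> coord_space (- K)" for a b
    proof -
      define C where "C h y = A x *v (T x h *v y) - T x h *v (A x *v y)" for h y
      define E where "E h y = B x *v (U x h *v y) - U x h *v (B x *v y)" for h y
      have "C h y = 0" if "h \<in> coord_space (- K)" for h y
        using commutes_partial_iff[OF lin(1)[OF x], of "- K" "A x"] CA x that
        by (auto simp: partial_deriv_def T_def C_def)
      moreover have "E h y = 0" if "h \<in> coord_space K" for h y
        using commutes_partial_iff[OF lin(2)[OF x], of K "B x"] CB x that
        by (auto simp: partial_deriv_def U_def E_def)
      ultimately show ?thesis
        using haantjes_tensor_mixed[OF m[OF x] mT[OF x] that C_def E_def] that m[OF x]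
        by (simp add: matrix_on_in)
    qed
    have HLK: "?H a b = 0" if "a \<in> coord_space (- K)" "b \<in> coord_space K" for a b
      using haantjes_tensor_antisym HKL[OF that(2,1)] by (metis neg_0_equal_iff_equal)
    have L: "linear (?H c)" for c
      by (intro haantjes_tensor_linear_right linear_compose_add lin x)
    have add: "?H c (y + z) = ?H c y + ?H c z" for c y z
      using L linear_add by blast
    have add': "?H (y + z) c = ?H y c + ?H z c" for c y z
      unfolding haantjes_tensor_antisym[of _ _ _ c] add by simp
    have "?H (coord_proj K *v a + coord_proj (- K) *v a) (coord_proj K *v b + coord_proj (- K) *v b) = 0"
      unfolding add add' by (simp add: HKK HLL HKL HLK)
    then show ?thesis
      unfolding coord_decomp[symmetric] block_diag_eq_add[OF m[OF x]] .
  qed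
  ultimately show ?thesis
    by (subst haantjes_on_iff_tensor) auto
qed


section \<open>Spectral projections\<close>

lemma matrix_diff_rdistrib: "(A - B) ** C = A ** C - B ** (C :: 'a::ring_1^'k^'n)"
  by (simp add: matrix_matrix_mult_def vec_eq_iff sum_subtractf left_diff_distrib)

lemma matrix_diff_ldistrib: "A ** (B - C) = A ** B - A ** (C :: 'a::ring_1^'k^'n)"
  by (simp add: matrix_matrix_mult_def vec_eq_iff sum_subtractf right_diff_distrib)

lemmas matrix_ring_simps = matrix_add_ldistrib matrix_add_rdistrib
  matrix_diff_ldistrib matrix_diff_rdistrib matrix_mul_assoc
  scaleR_matrix_mult_left scaleR_matrix_mult_right


section \<open>Evaluation of polynomials at a matrix\<close>

definition poly_mat :: "real^'n^'n \<Rightarrow> real poly \<Rightarrow> real^'n^'n"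
where
  "poly_mat A p = fold_coeffs (\<lambda>c B. c *\<^sub>R mat 1 + A ** B) p 0"

lemma poly_mat_0 [simp]: "poly_mat A 0 = 0"
  by (simp add: poly_mat_def)

lemma poly_mat_pCons: "poly_mat A (pCons c p) = c *\<^sub>R mat 1 + A ** poly_mat A p"
  by (cases "p = 0 \<and> c = 0") (auto simp: poly_mat_def)

lemma poly_mat_1 [simp]: "poly_mat A 1 = mat 1"
  by (simp add: one_pCons poly_mat_pCons)

lemma poly_mat_add: "poly_mat A (p + q) = poly_mat A p + poly_mat A q"
  by (induction p q rule: poly_induct2)
    (auto simp: poly_mat_pCons matrix_add_ldistrib scaleR_add_left)

lemma poly_mat_smult: "poly_mat A (smult c p) = c *\<^sub>R poly_mat A p"
  by (induction p) (auto simp: poly_mat_pCons scaleR_add_right scaleR_matrix_mult_right)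

lemma poly_mat_mult: "poly_mat A (p * q) = poly_mat A p ** poly_mat A q"
  by (induction p)
    (auto simp: poly_mat_pCons poly_mat_add poly_mat_smult matrix_add_rdistrib matrix_mul_assoc
      scaleR_matrix_mult_left)

lemma poly_mat_diff: "poly_mat A (p - q) = poly_mat A p - poly_mat A q"
  using poly_mat_add[of A "p - q" q] by simp

lemma poly_mat_sum: "poly_mat A (\<Sum>i\<in>I. f i) = (\<Sum>i\<in>I. poly_mat A (f i))"
  by (induction I rule: infinite_finite_induct) (auto simp: poly_mat_add)

lemma poly_mat_commute:
  assumes "A ** B = B ** A"
  shows "poly_mat A p ** B = B ** poly_mat A p"
proof (induction p)
  case (pCons c p)
  have "A ** poly_mat A p ** B = A ** (B ** poly_mat A p)"
    by (simp add: pCons flip: matrix_mul_assoc)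
  also have "\<dots> = B ** (A ** poly_mat A p)"
    by (simp add: assms matrix_mul_assoc)
  finally show ?case
    by (simp add: poly_mat_pCons matrix_add_ldistrib matrix_add_rdistrib scaleR_matrix_mult_left
        scaleR_matrix_mult_right)
qed simp

lemma poly_mat_commute': "poly_mat A p ** A = A ** poly_mat A p"
  by (rule poly_mat_commute) simp

lemma poly_mat_conj:
  assumes "B ** T = T ** A"
  shows "poly_mat B p ** T = T ** poly_mat A p"
proof (induction p)
  case (pCons c p)
  have "B ** poly_mat B p ** T = B ** (T ** poly_mat A p)"
    by (simp add: pCons flip: matrix_mul_assoc)
  also have "\<dots> = T ** (A ** poly_mat A p)"
    by (simp add: assms matrix_mul_assoc)
  finally show ?case
    by (simp add: poly_mat_pCons matrix_add_ldistrib matrix_add_rdistrib scaleR_matrix_mult_left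
        scaleR_matrix_mult_right)
qed simp

section \<open>The characteristic matrix and the theorem of Cayley and Hamilton\<close>

definition const_mat :: "real^'n^'m \<Rightarrow> real poly^'n^'m"
where
  "const_mat A = (\<chi> i j. [:A $ i $ j:])"

lemma const_mat_mult:
  fixes A :: "real^'n^'m" and B :: "real^'k^'n"
  shows "const_mat (A ** B) = const_mat A ** const_mat B"
proof -
  have "[:\<Sum>k\<in>I. f k * g k:] = (\<Sum>k\<in>I. [:f k * g k:])" for I :: "'n set" and f g :: "'n \<Rightarrow> real"
    by (simp add: poly_eq_iff coeff_sum coeff_pCons split: nat.split)
  then show ?thesis
    by (simp add: const_mat_def matrix_matrix_mult_def vec_eq_iff mult.commute)
qed

lemma const_mat_1 [simp]: "const_mat (mat 1) = mat 1"
  by (simp add: const_mat_def mat_def vec_eq_iff one_pCons)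

definition char_mat :: "real^'n^'n \<Rightarrow> real poly^'n^'n"
where
  "char_mat A = mat [:0, 1:] - const_mat A"

lemma charpoly_eq_det: "charpoly A = det (char_mat A)"
  by (simp add: charpoly_def char_mat_def const_mat_def)

lemma mat_scalar_mult: "mat c ** A = (\<chi> i j. c * A $ i $ j)"
  for A :: "'a::comm_ring_1^'k^'n"
  by (simp add: matrix_matrix_mult_def mat_def vec_eq_iff if_distrib[of "\<lambda>c. c * _"] cong: if_cong)

lemma mat_scalar_mult': "A ** mat c = (\<chi> i j. c * A $ i $ j)"
  for A :: "'a::comm_ring_1^'n^'k"
  by (simp add: matrix_matrix_mult_def mat_def vec_eq_iff if_distrib mult.commute cong: if_cong)

lemma mat_commute: "mat c ** A = A ** mat c"
  for A :: "'a::comm_ring_1^'n^'n"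
  by (simp add: mat_scalar_mult mat_scalar_mult')

lemma charpoly_conj:
  fixes A T T' :: "real^'n^'n"
  assumes "T ** T' = mat 1" "T' ** T = mat 1"
  shows "charpoly (T ** A ** T') = charpoly A"
proof -
  have "const_mat T ** mat [:0,1:] ** const_mat T' = mat [:0,1:]"
    by (simp add: assms flip: mat_commute[of _ "const_mat T"] matrix_mul_assoc const_mat_mult)
  then have "char_mat (T ** A ** T') = const_mat T ** char_mat A ** const_mat T'"
    by (simp add: char_mat_def matrix_diff_ldistrib matrix_diff_rdistrib const_mat_mult)
  then have "charpoly (T ** A ** T') = det (const_mat T ** const_mat T') * charpoly A"
    by (simp add: charpoly_eq_det det_mul)
  then show ?thesis
    by (simp add: assms flip: const_mat_mult)
qed

text \<open>Cramer's rule holds at the infinitely many real points where the determinant does not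
  vanish, hence as a polynomial identity.\<close>

lemma poly_adjugate:
  fixes M :: "real poly^'n^'n"
  assumes "det M \<noteq> 0"
  obtains D where "M ** D = mat (det M)"
proof -
  define R where "R k j = (\<chi> i l. if l = k then (if i = j then 1 else 0) else M $ i $ l)" for k j
  define D :: "real poly^'n^'n" where "D = (\<chi> k j. det (R k j))"
  have poly_det: "poly (det N) c = det (\<chi> i j. poly (N $ i $ j) c)" for N :: "real poly^'n^'n" and c
    by (simp add: det_def poly_sum poly_prod poly_of_int)
  have "(M ** D) $ i $ j = mat (det M) $ i $ j" for i j
  proof -
    have "poly (det M * ((M ** D) $ i $ j - mat (det M) $ i $ j)) c = 0" for c
    proof (cases "poly (det M) c = 0")
      case False
      define N :: "real^'n^'n" where "N = (\<chi> i j. poly (M $ i $ j) c)"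
      have d: "det N = poly (det M) c" by (simp add: N_def poly_det)
      define b :: "real^'n" where "b = axis j 1"
      have "N *v (\<chi> k. det (\<chi> i l. if l = k then b $ i else N $ i $ l) / det N) = b"
        using cramer[of N _ b] d False by simp
      moreover have "(\<chi> i l. if l = k then b $ i else N $ i $ l)
          = (\<chi> i l. poly (R k j $ i $ l) c)" for k
        by (auto simp: R_def N_def b_def axis_def vec_eq_iff)
      ultimately have "N *v (\<chi> k. poly (D $ k $ j) c / det N) = b"
        by (simp add: D_def poly_det)
      then have "(N *v (\<chi> k. poly (D $ k $ j) c / det N)) $ i = b $ i" by simp
      then have "(\<Sum>k\<in>UNIV. N $ i $ k * poly (D $ k $ j) c) / det N = b $ i"
        by (simp add: matrix_vector_mult_def sum_divide_distrib)
      then have "(\<Sum>k\<in>UNIV. N $ i $ k * poly (D $ k $ j) c) = b $ i * det N"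
        using d False by (simp add: field_simps)
      then show ?thesis
        by (simp add: matrix_matrix_mult_def poly_sum N_def[symmetric] mat_def b_def axis_def d)
          (auto simp: N_def)
    qed simp
    then have "det M * ((M ** D) $ i $ j - mat (det M) $ i $ j) = 0"
      using poly_all_0_iff_0 by blast
    then show ?thesis using assms by simp
  qed
  then show ?thesis using that[of D] by (simp add: vec_eq_iff)
qed

text \<open>Read the entries of \<open>char_mat A\<close> as polynomials in \<open>A\<close>. Column
  \<open>l\<close>, applied to the basis vectors \<open>e\<^sub>i\<close> and summed, gives
  \<open>A e\<^sub>l\<close> minus column \<open>l\<close> of \<open>A\<close>, that is zero.
  Multiplying by the matrix \<open>D\<close> of the adjugate identity shows that
  \<open>charpoly A\<close>, evaluated at \<open>A\<close>, kills each basis vector.\<close>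

theorem cayley_hamilton:
  fixes A :: "real^'n^'n"
  assumes "charpoly A \<noteq> 0"
  shows "poly_mat A (charpoly A) = 0"
proof -
  obtain D where D: "char_mat A ** D = mat (charpoly A)"
    using poly_adjugate assms by (metis charpoly_eq_det)
  have *: "(if i = j then charpoly A else 0) = [:0, 1:] * D $ i $ j - (\<Sum>l\<in>UNIV. smult (A $ i $ l) (D $ l $ j))" for i j
  proof -
    have "mat (charpoly A) $ i $ j = (char_mat A ** D) $ i $ j" by (simp add: D)
    also have "\<dots> = [:0, 1:] * D $ i $ j - (\<Sum>l\<in>UNIV. smult (A $ i $ l) (D $ l $ j))"
      by (simp add: char_mat_def matrix_diff_rdistrib mat_scalar_mult)
        (simp add: matrix_matrix_mult_def const_mat_def)
    finally show ?thesis by (simp add: mat_def)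
  qed
  have "poly_mat A (charpoly A) *v axis j 1 = 0" for j
  proof -
    have "poly_mat A (charpoly A) *v axis j 1
        = (\<Sum>i\<in>UNIV. poly_mat A (if i = j then charpoly A else 0) *v axis i 1)"
      by (simp add: if_distrib[of "poly_mat A"] if_distribR if_distrib[of "\<lambda>M. M *v _"] cong: if_cong)
    also have "\<dots> = (\<Sum>i\<in>UNIV. A *v (poly_mat A (D $ i $ j) *v axis i 1))
       - (\<Sum>i\<in>UNIV. \<Sum>l\<in>UNIV. A $ i $ l *\<^sub>R (poly_mat A (D $ l $ j) *v axis i 1))"
      unfolding * by (simp add: poly_mat_diff poly_mat_mult poly_mat_sum poly_mat_smult poly_mat_pCons
        matrix_vector_mult_diff_rdistrib sum_subtractf matrix_vector_mul_assoc
        linear_sum[OF bounded_linear.linear[OF bounded_bilinear.bounded_linear_left[OF bounded_bilinear_matrix_vector_mult]]]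
        scaleR_matrix_vector_assoc)
    also have "(\<Sum>i\<in>UNIV. \<Sum>l\<in>UNIV. A $ i $ l *\<^sub>R (poly_mat A (D $ l $ j) *v axis i 1))
       = (\<Sum>l\<in>UNIV. poly_mat A (D $ l $ j) *v (\<Sum>i\<in>UNIV. A $ i $ l *\<^sub>R axis i 1))"
      by (subst sum.swap)
        (simp add: linear_sum[OF bounded_linear.linear[OF bounded_bilinear.bounded_linear_right[OF bounded_bilinear_matrix_vector_mult]]]
          matrix_vector_mult_scaleR)
    also have "\<dots> = (\<Sum>l\<in>UNIV. A *v (poly_mat A (D $ l $ j) *v axis l 1))"
    proof (rule sum.cong[OF refl])
      fix l
      have "A *v axis l 1 = (\<Sum>i\<in>UNIV. A $ i $ l *\<^sub>R axis i 1)"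
        using basis_expansion[of "A *v axis l 1"]
        by (simp add: matrix_vector_mult_basis column_def scalar_mult_eq_scaleR)
      then show "poly_mat A (D $ l $ j) *v (\<Sum>i\<in>UNIV. A $ i $ l *\<^sub>R axis i 1)
        = A *v (poly_mat A (D $ l $ j) *v axis l 1)"
        by (metis matrix_vector_mul_assoc poly_mat_commute')
    qed
    finally show ?thesis by simp
  qed
  then show ?thesis
    by (simp add: matrix_vector_mult_basis column_def vec_eq_iff)
qed

text \<open>This is the remainder theorem with matrix coefficients. It turns the vanishing of rows
  of \<open>poly_mat A q\<close> into a divisibility statement about determinants.\<close>

lemma char_mat_dvd:
  fixes A :: "real^'n^'n"
  obtains C where "mat q - const_mat (poly_mat A q) = char_mat A ** C"
proof -
  have "\<exists>C. mat q - const_mat (poly_mat A q) = char_mat A ** C"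
  proof (induction q)
    case 0
    have "mat 0 - const_mat (poly_mat A 0) = char_mat A ** 0"
      by (simp add: const_mat_def vec_eq_iff mat_def matrix_matrix_mult_def)
    then show ?case by blast
  next
    case (pCons c q)
    then obtain C where C: "mat q - const_mat (poly_mat A q) = char_mat A ** C" by blast
    let ?X = "mat [:0, 1:] :: real poly^'n^'n"
    have com: "const_mat A ** char_mat A = char_mat A ** const_mat A"
      by (simp add: char_mat_def matrix_diff_ldistrib matrix_diff_rdistrib mat_commute)
    have "mat (pCons c q) - const_mat (poly_mat A (pCons c q)) =
        ?X ** mat q - const_mat A ** const_mat (poly_mat A q)"
      by (simp add: poly_mat_pCons mat_scalar_mult flip: const_mat_mult)
        (simp add: vec_eq_iff mat_def const_mat_def)
    \<comment> \<open>Telescoping of the Horner rule: \<open>\<lambda> q(\<lambda>) - A q(A) =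
      (\<lambda> - A) q(\<lambda>) + A (q(\<lambda>) - q(A))\<close>.\<close>
    also have "\<dots> = char_mat A ** mat q + const_mat A ** (mat q - const_mat (poly_mat A q))"
      by (simp add: char_mat_def matrix_diff_ldistrib matrix_diff_rdistrib)
    also have "\<dots> = char_mat A ** (mat q + const_mat A ** C)"
      by (simp add: C matrix_add_ldistrib matrix_mul_assoc com)
    finally show ?case by blast
  qed
  then show ?thesis using that by blast
qed


section \<open>Determinants of the diagonal blocks and their degrees\<close>

lemma degree_det_le:
  fixes X :: "real poly^'n^'n"
  assumes "\<And>i j. degree (X $ i $ j) \<le> d i"
  shows "degree (det X) \<le> (\<Sum>i\<in>UNIV. d i)"
  unfolding det_def
proof (rule degree_sum_le)
  fix p :: "'n \<Rightarrow> 'n"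
  have "degree (\<Prod>i\<in>UNIV. X $ i $ p i) \<le> (\<Sum>i\<in>UNIV. degree (X $ i $ p i))"
    using degree_prod_sum_le[of UNIV "\<lambda>i. X $ i $ p i"] by (simp add: o_def)
  also have "\<dots> \<le> (\<Sum>i\<in>UNIV. d i)" by (intro sum_mono assms)
  finally show "degree (of_int (sign p) * (\<Prod>i\<in>UNIV. X $ i $ p i)) \<le> (\<Sum>i\<in>UNIV. d i)"
    by (cases p rule: sign_cases) auto
qed simp

lemma degree_char_mat_le: "degree (char_mat A $ i $ j) \<le> 1"
  by (auto simp: char_mat_def mat_def const_mat_def intro!: degree_diff_le)

text \<open>The determinants of the two diagonal blocks of \<open>\<lambda> - B\<close> divide powers of \<open>q1\<close> and \<open>q2\<close>,
  and their product is \<open>q1 * q2\<close>; by coprimality they have the same degrees as \<open>q1\<close> and \<open>q2\<close>.\<close>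

lemma block_det_dvd:
  fixes B :: "real^'n^'n"
  assumes B: "\<And>i j. (i \<in> K) \<noteq> (j \<in> K) \<Longrightarrow> B $ i $ j = 0"
    and q: "\<And>i j. i \<in> K \<Longrightarrow> poly_mat B q $ i $ j = 0"
  shows "det (\<chi> i j. if i \<in> K then char_mat B $ i $ j else if i = j then 1 else 0) dvd q ^ card K"
proof -
  obtain C where C: "mat q - const_mat (poly_mat B q) = char_mat B ** C"
    using char_mat_dvd by blast
  let ?X = "(\<chi> i j. if i \<in> K then char_mat B $ i $ j else if i = j then 1 else 0) :: real poly^'n^'n"
  \<comment> \<open>\<open>Y\<close> keeps the rows in \<open>K\<close> of the quotient
    \<open>C\<close> and completes them by rows of the identity, as \<open>?X\<close> does for
    \<open>char_mat B\<close>. On the rows in \<open>K\<close> the remainder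
    \<open>poly_mat B q\<close> vanishes, so the product is diagonal, with \<open>q\<close> on
    \<open>K\<close> and \<open>1\<close> elsewhere.\<close>
  define Y :: "real poly^'n^'n" where "Y = (\<chi> i j. if i \<in> K then C $ i $ j else if i = j then 1 else 0)"
  have z: "char_mat B $ i $ l = 0" if "i \<in> K" "l \<notin> K" for i l
    using that B[of i l] by (auto simp: char_mat_def const_mat_def mat_def)
  have e: "(?X ** Y) $ i $ j = (if i = j then (if i \<in> K then q else 1) else 0)" for i j
  proof (cases "i \<in> K")
    case True
    have "(?X ** Y) $ i $ j = (\<Sum>l\<in>UNIV. char_mat B $ i $ l * C $ l $ j)"
      using True z by (simp add: matrix_matrix_mult_def Y_def) (intro sum.cong; auto)
    also have "\<dots> = (mat q - const_mat (poly_mat B q)) $ i $ j"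
      by (simp add: C matrix_matrix_mult_def)
    finally show ?thesis using True q by (auto simp: mat_def const_mat_def)
  next
    case False
    then show ?thesis
      by (simp add: matrix_matrix_mult_def if_distrib[of "\<lambda>c. c * _"] Y_def cong: if_cong)
        (metis)
  qed
  have "det ?X * det Y = det (?X ** Y)" by (simp add: det_mul)
  also have "\<dots> = (\<Prod>i\<in>UNIV. if i \<in> K then q else 1)"
    by (subst det_diagonal) (simp_all add: e)
  also have "\<dots> = q ^ card K"
    by (simp add: prod.If_cases)
  finally have "q ^ card K = det ?X * det Y" by (rule sym)
  then show ?thesis by (rule dvdI)
qed

lemma card_eq_degree:
  fixes B :: "real^'n^'n"
  assumes B: "\<And>i j. (i \<in> K) \<noteq> (j \<in> K) \<Longrightarrow> B $ i $ j = 0"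
    and q: "\<And>i j. i \<in> K \<Longrightarrow> poly_mat B q1 $ i $ j = 0"
      "\<And>i j. i \<notin> K \<Longrightarrow> poly_mat B q2 $ i $ j = 0"
    and chi: "charpoly B = q1 * q2" "coprime q1 q2" "q1 \<noteq> 0" "q2 \<noteq> 0"
    and deg: "degree q1 + degree q2 = CARD('n)"
  shows "card K = degree q1"
proof -
  \<comment> \<open>Each block is padded with rows of the identity, which keeps the matrix type; the
    product of the two padded blocks is the whole characteristic matrix.\<close>
  define X where "X S = (\<chi> i j. if i \<in> S then char_mat B $ i $ j else if i = j then 1 else 0)" for S
  have "X K ** X (- K) = char_mat B"
  proof -
    have "(X K ** X (- K)) $ i $ j = char_mat B $ i $ j" for i j
    proof (cases "i \<in> K")
      case True
      have z: "char_mat B $ i $ l = 0" if "l \<notin> K" for l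
        using that True B[of i l] by (auto simp: char_mat_def const_mat_def mat_def)
      have "(X K ** X (- K)) $ i $ j = (\<Sum>l\<in>UNIV. char_mat B $ i $ l * (if l = j then 1 else 0))"
        using True z by (simp add: matrix_matrix_mult_def X_def) (intro sum.cong; auto)
      then show ?thesis by (simp add: if_distrib cong: if_cong)
    next
      case False
      then show ?thesis
        by (simp add: matrix_matrix_mult_def if_distrib[of "\<lambda>c. c * _"] X_def cong: if_cong)
    qed
    then show ?thesis by (simp add: vec_eq_iff)
  qed
  then have det: "det (X K) * det (X (- K)) = q1 * q2"
    by (metis charpoly_eq_det chi(1) det_mul)
  have dvd: "det (X K) dvd q1 ^ card K" "det (X (- K)) dvd q2 ^ card (- K)"
    unfolding X_def using q B by (intro block_det_dvd; auto)+
  have le: "degree (det (X S)) \<le> card S" for S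
  proof -
    have "degree (det (X S)) \<le> (\<Sum>i\<in>UNIV. if i \<in> S then 1 else 0)"
      by (rule degree_det_le) (auto simp: X_def intro!: degree_char_mat_le[unfolded One_nat_def])
    then show ?thesis by (simp add: sum.If_cases)
  qed
  have nz: "det (X K) \<noteq> 0" "det (X (- K)) \<noteq> 0"
    using det chi by auto
  have card: "card K + card (- K) = CARD('n)"
    using card_Un_disjoint[of K "- K"] by simp
  have "degree (det (X K)) + degree (det (X (- K))) = CARD('n)"
    using degree_mult_eq[OF nz] degree_mult_eq[OF chi(3,4)] det deg by simp
  \<comment> \<open>The degree of each determinant is at most the size of its block, and the degrees
    add up to the sum of the sizes, hence both bounds are attained. The same counting ends the
    proof, once coprimality has confined each determinant to its own factor.\<close>
  then have eq: "degree (det (X K)) = card K" "degree (det (X (- K))) = card (- K)"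
    using le[of K] le[of "- K"] card by linarith+
  have "coprime (det (X K)) q2"
    using dvd(1) chi(2) by (meson coprime_divisors coprime_power_left_iff dvd_refl coprime_imp_coprime dvd_trans)
  moreover have "det (X K) dvd q1 * q2" using det by (metis dvd_triv_left)
  ultimately have "det (X K) dvd q1" by (simp add: coprime_dvd_mult_left_iff)
  then have 1: "card K \<le> degree q1" using eq chi dvd_imp_degree_le by metis
  have "coprime (det (X (- K))) q1"
    using dvd(2) chi(2) by (meson coprime_commute coprime_divisors coprime_power_left_iff dvd_refl)
  moreover have "det (X (- K)) dvd q1 * q2" using det by (metis dvd_triv_right)
  ultimately have "det (X (- K)) dvd q2" by (simp add: coprime_dvd_mult_right_iff)
  then have "card (- K) \<le> degree q2" using eq chi dvd_imp_degree_le by metis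
  then show ?thesis using 1 card deg by linarith
qed

section \<open>Normal form of a projection\<close>

lemma dim_coord_space: "dim (coord_space K :: (real^'n) set) = card K"
  using dim_substandard_cart[where 'a = real, of K] by (simp add: coord_space_def dim_vec_eq)

lemma range_idempotent: "P ** P = P \<Longrightarrow> y \<in> range ((*v) P) \<longleftrightarrow> P *v y = (y :: real^'n)"
  by (auto simp: matrix_vector_mul_assoc image_iff) (metis)

lemma card_add_card_Compl: "card K + card (- K) = CARD('n)" for K :: "'n::finite set"
  using card_Un_disjoint[of K "- K"] by simp

lemma dim_range_complement:
  fixes P :: "real^'n^'n"
  assumes "P ** P = P"
  shows "dim (range ((*v) P)) + dim (range ((*v) (mat 1 - P))) = CARD('n)"
proof -
  let ?R = "range ((*v) P)" and ?S = "range ((*v) (mat 1 - P))"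
  have Q: "(mat 1 - P) ** (mat 1 - P) = mat 1 - P"
    using assms by (simp add: matrix_diff_ldistrib matrix_diff_rdistrib)
  have sub: "subspace (range ((*v) M))" for M :: "real^'n^'n"
    by (simp add: linear_subspace_image)
  have "x = P *v x + (mat 1 - P) *v x" for x
    by (simp add: matrix_vector_mult_diff_rdistrib)
  then have "{x + y |x y. x \<in> ?R \<and> y \<in> ?S} = UNIV"
    by blast
  moreover have "?R \<inter> ?S = {0}"
  proof -
    have "x = 0" if "x \<in> ?R" "x \<in> ?S" for x
      using that range_idempotent[OF assms] range_idempotent[OF Q]
      by (metis eq_iff_diff_eq_0 matrix_vector_mul_lid matrix_vector_mult_diff_rdistrib)
    moreover have "0 \<in> ?R" "0 \<in> ?S" using subspace_0[OF sub] by blast+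
    ultimately show ?thesis by blast
  qed
  ultimately show ?thesis
    using dim_sums_Int[OF sub[of P] sub[of "mat 1 - P"]] by simp
qed

text \<open>\<open>T\<close> is the direct sum of two isomorphisms, from \<open>im P\<close> onto
  \<open>coord_space K\<close> and from \<open>ker P\<close> onto \<open>coord_space (- K)\<close>,
  which exist since the dimensions agree.\<close>

lemma projection_normal_form:
  fixes P :: "real^'n^'n" and K :: "'n set"
  assumes P: "P ** P = P" and card: "card K = dim (range ((*v) P))"
  obtains T T' where "T ** T' = mat 1" "T' ** T = mat 1" "T ** P = coord_proj K ** T"
proof -
  let ?Q = "mat 1 - P"
  have Q: "?Q ** ?Q = ?Q" using P by (simp add: matrix_diff_ldistrib matrix_diff_rdistrib)
  have sub: "subspace (range ((*v) M))" for M :: "real^'n^'n"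
    by (simp add: linear_subspace_image)
  have card': "card (- K) = dim (range ((*v) ?Q))"
    using card_add_card_Compl[of K] dim_range_complement[OF P] card by simp
  obtain f where f: "linear f" "f ` range ((*v) P) = coord_space K" "inj_on f (range ((*v) P))"
    using subspace_isomorphism[OF sub subspace_coord_space] card dim_coord_space by metis
  obtain g where g: "linear g" "g ` range ((*v) ?Q) = coord_space (- K)" "inj_on g (range ((*v) ?Q))"
    using subspace_isomorphism[OF sub subspace_coord_space] card' dim_coord_space by metis
  define h where "h x = f (P *v x) + g (?Q *v x)" for x
  have m: "f (P *v x) \<in> coord_space K" "g (?Q *v x) \<in> coord_space (- K)" for x
    using f(2) g(2) by blast+
  have lin: "linear h"
    using linear_compose_add[OF linear_compose[OF matrix_vector_mul_linear f(1)]
        linear_compose[OF matrix_vector_mul_linear g(1)]]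
    by (simp add: h_def[abs_def] o_def)
  have "x = 0" if "h x = 0" for x
  proof -
    have "f (P *v x) = 0" "g (?Q *v x) = 0"
      using coord_space_add_eq_0[OF m] that by (auto simp: h_def)
    then have "f (P *v x) = f (P *v 0)" "g (?Q *v x) = g (?Q *v 0)"
      using linear_0[OF f(1)] linear_0[OF g(1)] by simp_all
    then have "P *v x = P *v 0" "?Q *v x = ?Q *v 0"
      using f(3) g(3) by (meson inj_onD rangeI)+
    then show "x = 0" by (simp add: matrix_vector_mult_diff_rdistrib)
  qed
  then have "inj h" using linear_injective_0[OF lin] by blast
  then obtain h' where h': "linear h'" "\<forall>x. h' (h x) = x" "\<forall>x. h (h' x) = x"
    using linear_injective_isomorphism[OF lin] by blast
  have "matrix h ** matrix h' = mat 1" "matrix h' ** matrix h = mat 1"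
    using h' lin by (auto simp: matrix_eq fun_cong[OF matrix_vector_mul(2)[OF lin]] fun_cong[OF matrix_vector_mul(2)[OF h'(1)]] simp flip: matrix_vector_mul_assoc)
  moreover have "matrix h ** P = coord_proj K ** matrix h"
  proof -
    have "h (P *v x) = coord_proj K *v h x" for x
    proof -
      have "h (P *v x) = f (P *v x)"
        using P linear_0[OF g(1)] by (simp add: h_def matrix_vector_mul_assoc matrix_diff_rdistrib)
      also have "\<dots> = coord_proj K *v h x"
        by (simp add: h_def matrix_vector_right_distrib coord_proj_id[OF m(1)] coord_proj_kill[OF m(2)])
      finally show ?thesis .
    qed
    then show ?thesis
      by (simp add: matrix_eq fun_cong[OF matrix_vector_mul(2)[OF lin]] flip: matrix_vector_mul_assoc)
  qed
  ultimately show ?thesis using that by blast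
qed

text \<open>For a projection \<open>P\<close> commuting with \<open>M\<close> this says that the restrictions of \<open>M\<close> to \<open>im P\<close> and
  \<open>ker P\<close> have no common eigenvalue.\<close>

definition separated :: "real^'n^'n \<Rightarrow> real^'n^'n \<Rightarrow> bool"
where
  "separated M P \<longleftrightarrow>
    (\<forall>X. M ** X = X ** M \<and> X = P ** X ** (mat 1 - P) + (mat 1 - P) ** X ** P \<longrightarrow> X = 0)"

text \<open>With \<open>a * p1 + b * p2 = 1\<close>, the value of \<open>b * p2\<close> at
  \<open>A\<close> is the identity on the kernel of \<open>p1(A)\<close> and zero on that of
  \<open>p2(A)\<close>. Being a polynomial in \<open>A\<close>, it commutes with everything that
  commutes with \<open>A\<close>, which yields separation. Its rank is found in a basis adapted to
  \<open>P\<close>, where \<open>card_eq_degree\<close> applies.\<close>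

proposition spectral_projection:
  fixes A :: "real^'n^'n"
  assumes chi: "charpoly A = p1 * p2" "coprime p1 p2" "p1 \<noteq> 0" "p2 \<noteq> 0"
    and deg: "degree p1 + degree p2 = CARD('n)"
  obtains P where "P ** P = P" "A ** P = P ** A" "separated A P" "dim (range ((*v) P)) = degree p1"
proof -
  obtain a b where ab: "a * p1 + b * p2 = 1"
    using bezout_coefficients_fst_snd[of p1 p2] chi(2) by (metis coprime_imp_gcd_eq_1)
  have CH: "poly_mat A (p1 * p2) = 0"
    using cayley_hamilton[of A] chi by auto
  have CH': "poly_mat A (r * (p1 * p2)) = 0" for r
    by (subst poly_mat_mult) (simp add: CH)
  define P where "P = poly_mat A (b * p2)"
  have Q: "mat 1 - P = poly_mat A (a * p1)"
    unfolding P_def poly_mat_1[of A, symmetric] poly_mat_diff[symmetric] ab[symmetric] by simp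
  have "P - P ** P = poly_mat A (b * p2 * (1 - b * p2))"
    by (simp add: P_def poly_mat_mult poly_mat_diff matrix_diff_ldistrib)
  also have "b * p2 * (1 - b * p2) = (a * b) * (p1 * p2)"
    unfolding ab[symmetric] by (simp add: algebra_simps)
  finally have PP: "P ** P = P" by (simp add: CH')
  have AP: "A ** P = P ** A" by (simp add: P_def poly_mat_commute')
  have p1P: "poly_mat A p1 ** P = 0"
    unfolding P_def poly_mat_mult[symmetric] using CH'[of b] by (simp add: algebra_simps)
  have p2Q: "poly_mat A p2 ** (mat 1 - P) = 0"
    unfolding Q poly_mat_mult[symmetric] using CH'[of a] by (simp add: algebra_simps)
  have sep: "separated A P"
    unfolding separated_def
  proof (intro allI impI, elim conjE)
    fix X assume com: "A ** X = X ** A" and X: "X = P ** X ** (mat 1 - P) + (mat 1 - P) ** X ** P"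
    note c = poly_mat_commute[OF com]
    have 1: "P ** X ** (mat 1 - P) = 0"
    proof -
      \<comment> \<open>\<open>mat 1 - P\<close> is a polynomial in \<open>A\<close> with the factor
        \<open>p1\<close>, so it can be moved past \<open>X\<close> next to \<open>P\<close>, where
        \<open>p1(A)\<close> gives zero.\<close>
      have "P ** X ** (mat 1 - P) = P ** poly_mat A a ** poly_mat A p1 ** X"
        unfolding Q by (simp add: c[symmetric] flip: matrix_mul_assoc)
          (simp add: poly_mat_mult matrix_mul_assoc)
      also have "P ** poly_mat A a ** poly_mat A p1 = poly_mat A a ** (poly_mat A p1 ** P)"
        by (simp add: P_def mult_ac flip: poly_mat_mult)
      finally show ?thesis by (simp add: p1P)
    qed
    have 2: "(mat 1 - P) ** X ** P = 0"
    proof -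
      have "(mat 1 - P) ** X ** P = (mat 1 - P) ** poly_mat A b ** poly_mat A p2 ** X"
        using c[of "b * p2"] by (simp add: P_def flip: matrix_mul_assoc)
          (simp add: poly_mat_mult matrix_mul_assoc)
      also have "(mat 1 - P) ** poly_mat A b ** poly_mat A p2 = poly_mat A b ** (poly_mat A p2 ** (mat 1 - P))"
        by (simp add: Q mult_ac flip: poly_mat_mult)
      finally show ?thesis by (simp add: p2Q)
    qed
    show "X = 0" using X 1 2 by simp
  qed
  have "dim (range ((*v) P)) = degree p1"
  proof -
    have "dim (range ((*v) P)) \<le> card (UNIV :: 'n set)"
      using dim_subset_UNIV[of "range ((*v) P)"] by simp
    then obtain K :: "'n set" where K: "card K = dim (range ((*v) P))"
      using obtain_subset_with_card_n by metis
    obtain T T' where T: "T ** T' = mat 1" "T' ** T = mat 1" "T ** P = coord_proj K ** T"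
      using projection_normal_form[OF PP K] .
    define B where "B = T ** A ** T'"
    have BT: "B ** T = T ** A"
      by (simp add: B_def T flip: matrix_mul_assoc)
    have Pi: "coord_proj K = T ** P ** T'"
      by (simp add: T flip: matrix_mul_assoc)
    have Pi': "coord_proj (- K) = T ** (mat 1 - P) ** T'"
      using coord_proj_add_compl[of K] by (simp add: matrix_diff_ldistrib matrix_diff_rdistrib T(1,2) Pi eq_diff_eq add.commute)
    have pB: "poly_mat B q = T ** poly_mat A q ** T'" for q
      using poly_mat_conj[OF BT, of q] by (metis T(1) matrix_mul_assoc matrix_mul_rid)
    have entry: "(coord_proj S ** N) $ i $ j = (if i \<in> S then N $ i $ j else 0)"
      "(N ** coord_proj S) $ i $ j = (if j \<in> S then N $ i $ j else 0)"
      for S and N :: "real^'n^'n" and i j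
      by (simp_all add: matrix_matrix_mult_def coord_proj_def if_distrib[of "\<lambda>c. c * _"]
          if_distrib[of "\<lambda>c. _ * c"] cong: if_cong flip: if_if_eq_conj)
    have com: "coord_proj K ** B = B ** coord_proj K"
    proof -
      have "T' ** (T ** N) = N" for N :: "real^'n^'n" by (simp add: T(2) matrix_mul_assoc)
      then show ?thesis by (simp add: Pi B_def flip: matrix_mul_assoc)
        (simp add: AP matrix_mul_assoc)
    qed
    show ?thesis unfolding K[symmetric]
    proof (rule card_eq_degree[OF _ _ _ _ chi(2-4) deg])
      show "charpoly B = p1 * p2" unfolding B_def using charpoly_conj[OF T(1,2)] chi by simp
      show "B $ i $ j = 0" if "(i \<in> K) \<noteq> (j \<in> K)" for i j
        using arg_cong[OF com, of "\<lambda>N. N $ i $ j"] that by (auto simp: entry split: if_splits)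
      have "coord_proj K ** poly_mat B p1 = T ** (P ** poly_mat A p1) ** T'"
        by (metis pB Pi T(2) matrix_mul_assoc matrix_mul_rid)
      then have z: "coord_proj K ** poly_mat B p1 = 0"
        using p1P by (simp add: poly_mat_commute[OF AP])
      show "poly_mat B p1 $ i $ j = 0" if "i \<in> K" for i j
        using arg_cong[OF z, of "\<lambda>N. N $ i $ j"] that by (simp add: entry)
      have "A ** (mat 1 - P) = (mat 1 - P) ** A"
        by (simp add: matrix_diff_ldistrib matrix_diff_rdistrib AP)
      have "coord_proj (- K) ** poly_mat B p2 = T ** ((mat 1 - P) ** poly_mat A p2) ** T'"
        by (metis pB Pi' T(2) matrix_mul_assoc matrix_mul_rid)
      then have z: "coord_proj (- K) ** poly_mat B p2 = 0"
        using p2Q by (simp add: poly_mat_commute[OF \<open>A ** (mat 1 - P) = (mat 1 - P) ** A\<close>])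
      show "poly_mat B p2 $ i $ j = 0" if "i \<notin> K" for i j
        using arg_cong[OF z, of "\<lambda>N. N $ i $ j"] that by (simp add: entry)
    qed
  qed
  with PP AP sep show ?thesis using that by blast
qed


section \<open>Families of differentiable functions\<close>

text \<open>\<open>t\<close> is a parameter that is never differentiated: time for differential
  equations, a single point for the implicit function theorem. Joint continuity in
  \<open>(t, x)\<close> is recorded at every order, because differentiability in \<open>x\<close>
  for each fixed \<open>t\<close> does not give it.\<close>

primrec Ck_family ::
  "'t::topological_space set \<Rightarrow> 'a::euclidean_space set \<Rightarrow> nat \<Rightarrow> ('t \<Rightarrow> 'a \<Rightarrow> 'b::real_normed_vector) \<Rightarrow> bool"
where
  "Ck_family T U 0 f \<longleftrightarrow> continuous_on (T \<times> U) (\<lambda>p. f (fst p) (snd p))"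
| "Ck_family T U (Suc m) f \<longleftrightarrow>
     continuous_on (T \<times> U) (\<lambda>p. f (fst p) (snd p)) \<and>
     (\<forall>t\<in>T. \<forall>x\<in>U. f t differentiable (at x)) \<and>
     (\<forall>w. Ck_family T U m (\<lambda>t x. frechet_derivative (f t) (at x) w))"

lemma Ck_family_continuous:
  "Ck_family T U m f \<Longrightarrow> continuous_on (T \<times> U) (\<lambda>p. f (fst p) (snd p))"
  by (cases m) auto

lemma Ck_family_has_derivative:
  assumes "Ck_family T U (Suc m) f" "t \<in> T" "x \<in> U"
  shows "(f t has_derivative frechet_derivative (f t) (at x)) (at x)"
  using assms frechet_derivative_works by auto

lemma frechet_derivative_eqI: "(f has_derivative f') (at x) \<Longrightarrow> frechet_derivative f (at x) = f'"
  using frechet_derivative_at by metis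

lemma frechet_derivative_transform:
  assumes "open U" "x \<in> U" "\<And>y. y \<in> U \<Longrightarrow> f y = g y"
  shows "frechet_derivative f (at x) = frechet_derivative g (at x)"
proof -
  have "(f has_derivative D) (at x) \<longleftrightarrow> (g has_derivative D) (at x)" for D
    using has_derivative_transform_within_open[OF _ assms(1,2), of f D UNIV g]
      has_derivative_transform_within_open[OF _ assms(1,2), of g D UNIV f] assms(3) by auto
  then show ?thesis by (simp add: frechet_derivative_def)
qed

lemma Ck_family_cong:
  assumes "open U" "\<And>t x. t \<in> T \<Longrightarrow> x \<in> U \<Longrightarrow> f t x = g t x" "Ck_family T U m f"
  shows "Ck_family T U m g"
  using assms(2,3)
proof (induction m arbitrary: f g)
  case 0
  then show ?case
    by (auto elim!: continuous_on_eq)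
next
  case (Suc m)
  have "g t differentiable (at x)" if "t \<in> T" "x \<in> U" for t x
  proof -
    have "(f t has_derivative frechet_derivative (f t) (at x)) (at x)"
      using Ck_family_has_derivative[OF Suc.prems(2) that] .
    then have "(g t has_derivative frechet_derivative (f t) (at x)) (at x)"
      using has_derivative_transform_within_open[OF _ assms(1) that(2)] Suc.prems(1)[OF that(1)] by blast
    then show ?thesis by (auto simp: differentiable_def)
  qed
  moreover have "continuous_on (T \<times> U) (\<lambda>p. g (fst p) (snd p))"
    using Suc.prems by (auto elim!: continuous_on_eq)
  moreover have "Ck_family T U m (\<lambda>t x. frechet_derivative (g t) (at x) w)" for w
  proof (rule Suc.IH)
    show "frechet_derivative (f t) (at x) w = frechet_derivative (g t) (at x) w" if "t \<in> T" "x \<in> U" for t x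
      using frechet_derivative_transform[OF assms(1) that(2)] Suc.prems(1)[OF that(1)] by metis
    show "Ck_family T U m (\<lambda>t x. frechet_derivative (f t) (at x) w)"
      using Suc.prems(2) by simp
  qed
  ultimately show ?case by simp
qed

lemma Ck_family_SucI:
  assumes "open U" "continuous_on (T \<times> U) (\<lambda>p. f (fst p) (snd p))"
    and f': "\<And>t x. t \<in> T \<Longrightarrow> x \<in> U \<Longrightarrow> (f t has_derivative f' t x) (at x)"
    and "\<And>w. Ck_family T U m (\<lambda>t x. f' t x w)"
  shows "Ck_family T U (Suc m) f"
proof -
  have "Ck_family T U m (\<lambda>t x. frechet_derivative (f t) (at x) w)" for w
    using frechet_derivative_eqI[OF f'] by (intro Ck_family_cong[OF assms(1) _ assms(4)[of w]]) auto
  then show ?thesis using assms by (auto simp: differentiable_def)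
qed

lemma Ck_family_Suc: "Ck_family T U (Suc m) f \<Longrightarrow> Ck_family T U m f"
  by (induction m arbitrary: f) auto

lemma Ck_family_subset: "Ck_family T U m f \<Longrightarrow> T' \<subseteq> T \<Longrightarrow> U' \<subseteq> U \<Longrightarrow> Ck_family T' U' m f"
proof (induction m arbitrary: f)
  case 0
  then show ?case using continuous_on_subset by (fastforce simp: Sigma_mono)
next
  case (Suc m)
  have "T' \<times> U' \<subseteq> T \<times> U" using Suc.prems by blast
  then show ?case using Suc continuous_on_subset by fastforce
qed

lemma Ck_family_const: "Ck_family T U m (\<lambda>t x. c)"
  by (induction m arbitrary: c) (auto simp: frechet_derivative_eqI[OF has_derivative_const])

lemma Ck_family_linear:
  assumes "bounded_linear h"
  shows "Ck_family T U m (\<lambda>t x. h x)"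
proof (cases m)
  case 0
  then show ?thesis
    by (auto intro!: bounded_linear.continuous_on[OF assms] continuous_intros)
next
  case (Suc k)
  have D: "(h has_derivative h) (at x)" for x
    using assms by (rule bounded_linear_imp_has_derivative)
  have "frechet_derivative h (at x) w = h w" for x w
    using frechet_derivative_eqI[OF D] by simp
  then show ?thesis
    using Suc D by (auto intro!: bounded_linear.continuous_on[OF assms] continuous_intros
        simp: Ck_family_const differentiable_def)
qed

lemma Ck_family_bounded_linear:
  assumes h: "bounded_linear h" and U: "open U"
  shows "Ck_family T U m f \<Longrightarrow> Ck_family T U m (\<lambda>t x. h (f t x))"
proof (induction m arbitrary: f)
  case 0
  then show ?case by (auto intro: bounded_linear.continuous_on[OF h])
next
  case (Suc m)
  show ?case
  proof (rule Ck_family_SucI[OF U])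
    show "((\<lambda>x. h (f t x)) has_derivative (\<lambda>w. h (frechet_derivative (f t) (at x) w))) (at x)"
      if "t \<in> T" "x \<in> U" for t x
      using bounded_linear.has_derivative[OF h Ck_family_has_derivative[OF Suc.prems that]] .
  qed (use Suc in \<open>auto intro: bounded_linear.continuous_on[OF h]\<close>)
qed

lemma Ck_family_add:
  assumes U: "open U"
  shows "Ck_family T U m f \<Longrightarrow> Ck_family T U m g \<Longrightarrow> Ck_family T U m (\<lambda>t x. f t x + g t x)"
proof (induction m arbitrary: f g)
  case 0
  then show ?case by (auto intro: continuous_intros)
next
  case (Suc m)
  show ?case
  proof (rule Ck_family_SucI[OF U])
    show "((\<lambda>x. f t x + g t x) has_derivative
        (\<lambda>w. frechet_derivative (f t) (at x) w + frechet_derivative (g t) (at x) w)) (at x)"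
      if "t \<in> T" "x \<in> U" for t x
      using has_derivative_add[OF Ck_family_has_derivative[OF Suc.prems(1) that]
          Ck_family_has_derivative[OF Suc.prems(2) that]] .
  qed (use Suc in \<open>auto intro: continuous_intros\<close>)
qed

lemma Ck_family_sum:
  assumes U: "open U"
  shows "(\<And>i. i \<in> I \<Longrightarrow> Ck_family T U m (f i)) \<Longrightarrow> Ck_family T U m (\<lambda>t x. \<Sum>i\<in>I. f i t x)"
  by (induction I rule: infinite_finite_induct) (auto simp: Ck_family_const Ck_family_add[OF U])

lemma Ck_family_bilinear:
  assumes h: "bounded_bilinear h" and U: "open U"
  shows "Ck_family T U m f \<Longrightarrow> Ck_family T U m g \<Longrightarrow> Ck_family T U m (\<lambda>t x. h (f t x) (g t x))"
proof (induction m arbitrary: f g)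
  case 0
  then show ?case by (auto intro: bounded_bilinear.continuous_on[OF h])
next
  case (Suc m)
  show ?case
  proof (rule Ck_family_SucI[OF U])
    show "((\<lambda>x. h (f t x) (g t x)) has_derivative (\<lambda>w. h (f t x) (frechet_derivative (g t) (at x) w)
        + h (frechet_derivative (f t) (at x) w) (g t x))) (at x)"
      if "t \<in> T" "x \<in> U" for t x
      using bounded_bilinear.FDERIV[OF h Ck_family_has_derivative[OF Suc.prems(1) that]
          Ck_family_has_derivative[OF Suc.prems(2) that]] .
    show "Ck_family T U m (\<lambda>t x. h (f t x) (frechet_derivative (g t) (at x) w)
        + h (frechet_derivative (f t) (at x) w) (g t x))" for w
      using Suc.prems Ck_family_Suc[OF Suc.prems(1)] Ck_family_Suc[OF Suc.prems(2)]
      by (intro Ck_family_add[OF U] Suc.IH) auto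
  qed (use Suc in \<open>auto intro: bounded_bilinear.continuous_on[OF h]\<close>)
qed

lemma continuous_on_family_compose:
  assumes "continuous_on (T \<times> U) (\<lambda>p. f (fst p) (snd p))"
    and "continuous_on (T \<times> W) (\<lambda>p. g (fst p) (snd p))"
    and "\<And>t x. t \<in> T \<Longrightarrow> x \<in> U \<Longrightarrow> f t x \<in> W"
  shows "continuous_on (T \<times> U) (\<lambda>p. g (fst p) (f (fst p) (snd p)))"
proof -
  have "continuous_on (T \<times> U) (\<lambda>p. (fst p, f (fst p) (snd p)))"
    using assms(1) by (intro continuous_intros)
  moreover have "(\<lambda>p. (fst p, f (fst p) (snd p))) ` (T \<times> U) \<subseteq> T \<times> W"
    using assms(3) by force
  ultimately show ?thesis
    using continuous_on_compose2[OF assms(2)] by fastforce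
qed

lemma Ck_family_compose:
  fixes g :: "'t::topological_space \<Rightarrow> 'c::euclidean_space \<Rightarrow> 'b::real_normed_vector"
  assumes U: "open U" and W: "open W" and fW: "\<And>t x. t \<in> T \<Longrightarrow> x \<in> U \<Longrightarrow> f t x \<in> W"
  shows "Ck_family T U m f \<Longrightarrow> Ck_family T W m g \<Longrightarrow> Ck_family T U m (\<lambda>t x. g t (f t x))"
proof (induction m arbitrary: g)
  case (0 g)
  then show ?case using continuous_on_family_compose[OF _ _ fW] by simp
next
  case (Suc m)
  let ?f' = "\<lambda>t x. frechet_derivative (f t) (at x)"
  let ?g' = "\<lambda>t x. frechet_derivative (g t) (at x)"
  show ?case
  proof (rule Ck_family_SucI[OF U])
    show "continuous_on (T \<times> U) (\<lambda>p. g (fst p) (f (fst p) (snd p)))"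
      using continuous_on_family_compose[OF Ck_family_continuous[OF Suc.prems(1)]
          Ck_family_continuous[OF Suc.prems(2)] fW] .
    \<comment> \<open>The direction in which \<open>g t\<close> is differentiated varies with
      \<open>(t, x)\<close>, whereas \<open>Ck_family\<close> speaks of fixed directions. Expanding
      it in a basis separates the two dependences and leaves sums and products.\<close>
    show "((\<lambda>x. g t (f t x)) has_derivative (\<lambda>w. \<Sum>i\<in>Basis. (?f' t x w \<bullet> i) *\<^sub>R ?g' t (f t x) i)) (at x)"
      if "t \<in> T" "x \<in> U" for t x
    proof -
      have g': "(g t has_derivative ?g' t (f t x)) (at (f t x))"
        using Ck_family_has_derivative[OF Suc.prems(2) that(1) fW[OF that]] .
      have "((\<lambda>x. g t (f t x)) has_derivative (\<lambda>w. ?g' t (f t x) (?f' t x w))) (at x)"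
        using has_derivative_compose[OF Ck_family_has_derivative[OF Suc.prems(1) that] g'] .
      moreover have "?g' t (f t x) v = (\<Sum>i\<in>Basis. (v \<bullet> i) *\<^sub>R ?g' t (f t x) i)" for v
      proof -
        have lin: "linear (?g' t (f t x))" using g' has_derivative_linear by blast
        have "?g' t (f t x) (\<Sum>i\<in>Basis. (v \<bullet> i) *\<^sub>R i) = (\<Sum>i\<in>Basis. (v \<bullet> i) *\<^sub>R ?g' t (f t x) i)"
          by (simp only: linear_sum[OF lin] linear_cmul[OF lin] o_def)
        then show ?thesis by (simp only: euclidean_representation)
      qed
      then have "(\<lambda>w. ?g' t (f t x) (?f' t x w)) = (\<lambda>w. \<Sum>i\<in>Basis. (?f' t x w \<bullet> i) *\<^sub>R ?g' t (f t x) i)"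
        by (rule ext)
      ultimately show ?thesis by (rule back_subst)
    qed
    have "Ck_family T U m (\<lambda>t x. ?f' t x w \<bullet> i)" for i w
      using Suc.prems(1) by (intro Ck_family_bounded_linear[OF bounded_linear_inner_left U]) auto
    moreover have "Ck_family T U m (\<lambda>t x. ?g' t (f t x) i)" for i
      using Suc.prems Ck_family_Suc by (intro Suc.IH) auto
    ultimately show "Ck_family T U m (\<lambda>t x. \<Sum>i\<in>Basis. (?f' t x w \<bullet> i) *\<^sub>R ?g' t (f t x) i)" for w
      by (intro Ck_family_sum[OF U] Ck_family_bilinear[OF bounded_bilinear_scaleR U])
  qed
qed

lemma Ck_family_Pair:
  assumes "open U" "Ck_family T U m f" "Ck_family T U m g"
  shows "Ck_family T U m (\<lambda>t x. (f t x, g t x))"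
  using Ck_family_add[OF assms(1) Ck_family_bounded_linear[OF bounded_linear_Pair[OF bounded_linear_ident bounded_linear_zero] assms(1,2)]
    Ck_family_bounded_linear[OF bounded_linear_Pair[OF bounded_linear_zero bounded_linear_ident] assms(1,3)]]
  unfolding add_Pair add_0_left add_0_right .

section \<open>Smooth maps as constant families\<close>

lemma Ck_on_UNIV_eq:
  assumes "open U" "T \<noteq> {}"
  shows "Ck_on UNIV m f U \<longleftrightarrow> Ck_family T U m (\<lambda>_. f)"
proof (induction m arbitrary: f)
  case (0 f)
  have "continuous_on U f" if "continuous_on (T \<times> U) (\<lambda>p. f (snd p))"
  proof -
    obtain t where "t \<in> T" using assms by blast
    then show ?thesis
      by (auto intro!: continuous_on_compose2[OF that, of U "\<lambda>x. (t, x)", simplified] continuous_intros)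
  qed
  moreover have "continuous_on (T \<times> U) (\<lambda>p. f (snd p))" if "continuous_on U f"
    by (auto intro!: continuous_on_compose2[OF that] continuous_intros)
  ultimately show ?case by auto
next
  case (Suc m f)
  have "continuous_on (T \<times> U) (\<lambda>p. f (snd p))" if "\<forall>x\<in>U. f differentiable (at x)"
  proof -
    have "continuous_on U f"
      using that by (auto intro!: continuous_at_imp_continuous_on differentiable_imp_continuous_within)
    then show ?thesis
      by (rule continuous_on_compose2) (auto intro!: continuous_intros)
  qed
  then show ?case using assms(2) by (auto simp: Suc)
qed

lemma smooth_on_iff_family:
  "open U \<Longrightarrow> T \<noteq> {} \<Longrightarrow> smooth_on UNIV f U \<longleftrightarrow> (\<forall>m. Ck_family T U m (\<lambda>_. f))"
  by (simp add: smooth_on_def Ck_on_UNIV_eq)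

lemma smooth_on_family: "open U \<Longrightarrow> smooth_on UNIV f U \<Longrightarrow> Ck_family T U m (\<lambda>_. f)"
  by (metis Ck_family_subset UNIV_not_empty order_refl smooth_on_iff_family top_greatest)

lemma smooth_onI_family: "open U \<Longrightarrow> (\<And>m. Ck_family (UNIV :: real set) U m (\<lambda>_. f)) \<Longrightarrow> smooth_on UNIV f U"
  by (metis UNIV_not_empty smooth_on_iff_family)

lemma smooth_on_cong:
  assumes "open U" "smooth_on UNIV f U" "\<And>x. x \<in> U \<Longrightarrow> f x = g x"
  shows "smooth_on UNIV g U"
  using assms(1) by (rule smooth_onI_family)
    (rule Ck_family_cong[OF assms(1) _ smooth_on_family[OF assms(1,2)]], simp add: assms(3))

lemma smooth_on_subset:
  "smooth_on UNIV f U \<Longrightarrow> open U \<Longrightarrow> open U' \<Longrightarrow> U' \<subseteq> U \<Longrightarrow> smooth_on UNIV f U'"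
  by (meson Ck_family_subset order_refl smooth_onI_family smooth_on_family)

lemma smooth_on_const: "open U \<Longrightarrow> smooth_on UNIV (\<lambda>x. c) U"
  by (simp add: Ck_family_const smooth_onI_family)

lemma smooth_on_linear: "open U \<Longrightarrow> bounded_linear h \<Longrightarrow> smooth_on UNIV h U"
  by (simp add: Ck_family_linear smooth_onI_family)

lemma smooth_on_bounded_linear:
  "open U \<Longrightarrow> bounded_linear h \<Longrightarrow> smooth_on UNIV f U \<Longrightarrow> smooth_on UNIV (\<lambda>x. h (f x)) U"
  by (rule smooth_onI_family) (auto intro: Ck_family_bounded_linear smooth_on_family)

lemma smooth_on_add:
  "open U \<Longrightarrow> smooth_on UNIV f U \<Longrightarrow> smooth_on UNIV g U \<Longrightarrow> smooth_on UNIV (\<lambda>x. f x + g x) U"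
  by (rule smooth_onI_family) (auto intro: Ck_family_add smooth_on_family)

lemma smooth_on_diff:
  "open U \<Longrightarrow> smooth_on UNIV f U \<Longrightarrow> smooth_on UNIV g U \<Longrightarrow> smooth_on UNIV (\<lambda>x. f x - g x) U"
  using smooth_on_add[of U f "\<lambda>x. - g x"] smooth_on_bounded_linear[of U uminus g]
    bounded_linear_minus[OF bounded_linear_ident] by auto

lemma smooth_on_bilinear:
  "open U \<Longrightarrow> bounded_bilinear h \<Longrightarrow> smooth_on UNIV f U \<Longrightarrow> smooth_on UNIV g U \<Longrightarrow>
   smooth_on UNIV (\<lambda>x. h (f x) (g x)) U"
  by (rule smooth_onI_family) (auto intro: Ck_family_bilinear smooth_on_family)

lemma smooth_on_compose:
  "open U \<Longrightarrow> open W \<Longrightarrow> smooth_on UNIV f U \<Longrightarrow> smooth_on UNIV g W \<Longrightarrow> (\<And>x. x \<in> U \<Longrightarrow> f x \<in> W) \<Longrightarrow>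
   smooth_on UNIV (\<lambda>x. g (f x)) U"
  by (rule smooth_onI_family) (auto intro: Ck_family_compose smooth_on_family)

lemma smooth_on_Pair:
  "open U \<Longrightarrow> smooth_on UNIV f U \<Longrightarrow> smooth_on UNIV g U \<Longrightarrow> smooth_on UNIV (\<lambda>x. (f x, g x)) U"
  by (rule smooth_onI_family) (auto intro: Ck_family_Pair smooth_on_family)

lemma smooth_on_has_derivative:
  "smooth_on UNIV f U \<Longrightarrow> x \<in> U \<Longrightarrow> (f has_derivative frechet_derivative f (at x)) (at x)"
  using smooth_on_differentiable frechet_derivative_works by blast

lemma smooth_on_continuous: "smooth_on UNIV f U \<Longrightarrow> continuous_on U f"
  unfolding smooth_on_def by (metis Ck_on.simps(1))

lemma smooth_on_derivative: "smooth_on UNIV f U \<Longrightarrow> smooth_on UNIV (\<lambda>x. frechet_derivative f (at x) w) U"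
  unfolding smooth_on_def by (metis Ck_on.simps(2) UNIV_I)


section \<open>Smooth families of fixed points\<close>

text \<open>A tube around the compact curve, with one radius for all \<open>t\<close>. Violations at
  radii tending to zero would have a subsequence along which \<open>t\<close> converges, and
  \<open>p\<close> and \<open>c t\<close> would then tend to the same point of
  \<open>W\<close>.\<close>

lemma uniform_near_curve:
  fixes F :: "'t::metric_space \<Rightarrow> 'p::metric_space \<Rightarrow> 'q::metric_space"
  assumes T: "compact T" and c: "continuous_on T c" and W: "open W" "\<And>t. t \<in> T \<Longrightarrow> c t \<in> W"
    and F: "continuous_on (T \<times> W) (\<lambda>p. F (fst p) (snd p))" and e: "e > 0"
  obtains d where "d > 0"
    "\<And>t p. t \<in> T \<Longrightarrow> dist p (c t) < d \<Longrightarrow> p \<in> W \<and> dist (F t p) (F t (c t)) < e"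
proof (rule ccontr)
  assume "\<not> thesis"
  then have "\<exists>t p. t \<in> T \<and> dist p (c t) < inverse (real (Suc n)) \<and>
      \<not> (p \<in> W \<and> dist (F t p) (F t (c t)) < e)" for n
    using that[of "inverse (real (Suc n))"] by auto
  then obtain t p where tp: "\<And>n. t n \<in> T" "\<And>n. dist (p n) (c (t n)) < inverse (real (Suc n))"
    "\<And>n. \<not> (p n \<in> W \<and> dist (F (t n) (p n)) (F (t n) (c (t n))) < e)"
    by metis
  obtain l r where l: "l \<in> T" "strict_mono r" "(t \<circ> r) \<longlonglongrightarrow> l"
    using T tp(1) unfolding compact_def by metis
  have tr: "(\<lambda>n. t (r n)) \<longlonglongrightarrow> l" using l(3) by (simp add: o_def)
  have ct: "(\<lambda>n. c (t (r n))) \<longlonglongrightarrow> c l"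
    using continuous_on_tendsto_compose[OF c tr l(1)] tp(1) by simp
  have "(\<lambda>n. dist (p (r n)) (c (t (r n)))) \<longlonglongrightarrow> 0"
  proof (rule tendsto_sandwich[OF _ _ tendsto_const])
    show "(\<lambda>n. inverse (real (Suc (r n)))) \<longlonglongrightarrow> 0"
      using LIMSEQ_subseq_LIMSEQ[OF LIMSEQ_inverse_real_of_nat l(2)] by (simp add: o_def)
    show "\<forall>\<^sub>F n in sequentially. dist (p (r n)) (c (t (r n))) \<le> inverse (real (Suc (r n)))"
      using tp(2) less_imp_le by (intro always_eventually) blast
  qed auto
  then have h0: "(\<lambda>n. dist (p (r n)) (c (t (r n))) + dist (c (t (r n))) (c l)) \<longlonglongrightarrow> 0 + 0"
    using ct by (intro tendsto_add) (simp_all flip: tendsto_dist_iff)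
  have "(\<lambda>n. dist (p (r n)) (c l)) \<longlonglongrightarrow> 0"
  proof (rule tendsto_sandwich[OF _ _ tendsto_const])
    show "\<forall>\<^sub>F n in sequentially. dist (p (r n)) (c l) \<le> dist (p (r n)) (c (t (r n))) + dist (c (t (r n))) (c l)"
      by (intro always_eventually allI dist_triangle)
  qed (use h0 in auto)
  then have pr: "(\<lambda>n. p (r n)) \<longlonglongrightarrow> c l"
    using tendsto_dist_iff by blast
  let ?G = "\<lambda>q. F (fst q) (snd q)"
  have in2: "(t (r n), c (t (r n))) \<in> T \<times> W" for n
    using tp(1) W(2) by blast
  have evW: "eventually (\<lambda>n. p (r n) \<in> W) sequentially"
    using topological_tendstoD[OF pr W(1) W(2)[OF l(1)]] .
  have in1: "eventually (\<lambda>n. (t (r n), p (r n)) \<in> T \<times> W) sequentially"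
    using evW by eventually_elim (use tp(1) in blast)
  have lW: "(l, c l) \<in> T \<times> W" using l(1) W(2) by blast
  have "(\<lambda>n. ?G (t (r n), p (r n))) \<longlonglongrightarrow> ?G (l, c l)"
    using continuous_on_tendsto_compose[OF F tendsto_Pair[OF tr pr] lW in1] by simp
  moreover have "(\<lambda>n. ?G (t (r n), c (t (r n)))) \<longlonglongrightarrow> ?G (l, c l)"
    using continuous_on_tendsto_compose[OF F tendsto_Pair[OF tr ct] lW] in2 by simp
  ultimately have "(\<lambda>n. dist (F (t (r n)) (p (r n))) (F (t (r n)) (c (t (r n))))) \<longlonglongrightarrow> 0"
    using tendsto_dist by fastforce
  then have "eventually (\<lambda>n. dist (F (t (r n)) (p (r n))) (F (t (r n)) (c (t (r n)))) < e) sequentially"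
    using e by (rule order_tendstoD(2))
  with evW have "eventually (\<lambda>n::nat. False) sequentially"
    by eventually_elim (use tp(3) in blast)
  then show False by simp
qed

text \<open>A bound on one-sided difference quotients passes to the limit. It serves to turn the
  Lipschitz constant of \<open>g\<close> into a bound for its partial derivative.\<close>

lemma norm_derivative_le:
  fixes f :: "'a::real_normed_vector \<Rightarrow> 'b::real_normed_vector"
  assumes f': "(f has_derivative f') (at p)" and d: "d > 0"
    and le: "\<And>t. 0 < t \<Longrightarrow> t < d \<Longrightarrow> norm (f (p + t *\<^sub>R k) - f p) \<le> c * t"
  shows "norm (f' k) \<le> c"
proof -
  have "((\<lambda>t::real. p + t *\<^sub>R k) has_derivative (\<lambda>t. t *\<^sub>R k)) (at 0)"
    by (auto intro!: derivative_eq_intros)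
  moreover have "(f has_derivative f') (at (p + 0 *\<^sub>R k))" using f' by simp
  ultimately have "((\<lambda>t. f (p + t *\<^sub>R k)) has_derivative (\<lambda>t. f' (t *\<^sub>R k))) (at 0)"
    by (rule has_derivative_compose)
  then have "((\<lambda>t. f (p + t *\<^sub>R k)) has_vector_derivative f' k) (at 0)"
    by (simp add: has_vector_derivative_def linear_cmul[OF has_derivative_linear[OF f']])
  then have "((\<lambda>t. (f (p + t *\<^sub>R k) - f p - t *\<^sub>R f' k) /\<^sub>R \<bar>t\<bar>) \<longlongrightarrow> 0) (at 0)"
    by (simp add: has_vector_derivative_def has_derivative_def)
  then have "((\<lambda>t. (f (p + t *\<^sub>R k) - f p - t *\<^sub>R f' k) /\<^sub>R \<bar>t\<bar>) \<longlongrightarrow> 0) (at_right 0)"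
    by (simp add: filterlim_at_split)
  then have "((\<lambda>t. (f (p + t *\<^sub>R k) - f p) /\<^sub>R t - f' k) \<longlongrightarrow> 0) (at_right 0)"
    by (rule Lim_transform_eventually)
      (auto simp: scaleR_diff_right intro!: eventually_mono[OF eventually_at_right_less[of 0]])
  then have lim: "((\<lambda>t. norm ((f (p + t *\<^sub>R k) - f p) /\<^sub>R t)) \<longlongrightarrow> norm (f' k)) (at_right 0)"
    by (rule tendsto_norm[OF iffD2[OF Lim_null]])
  have "eventually (\<lambda>t. norm ((f (p + t *\<^sub>R k) - f p) /\<^sub>R t) \<le> c) (at_right 0)"
    unfolding eventually_at_right_field
  proof (intro exI[of _ d] conjI allI impI)
    fix t :: real assume t: "0 < t" "t < d"
    have "norm ((f (p + t *\<^sub>R k) - f p) /\<^sub>R t) = norm (f (p + t *\<^sub>R k) - f p) / t"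
      using t by (simp add: divide_inverse mult.commute)
    also have "\<dots> \<le> c" using le[OF t] t by (simp add: pos_divide_le_eq)
    finally show "norm ((f (p + t *\<^sub>R k) - f p) /\<^sub>R t) \<le> c" .
  qed (use d in simp)
  then show ?thesis
    by (intro tendsto_upperbound[OF lim]) auto
qed

text \<open>\<open>I\<close> is linear and does not increase the supremum norm, so that a
  contraction constant of \<open>g\<close> is also one for \<open>g\<close> followed by
  \<open>I\<close>. It acts on all functions but is constrained only on those that are continuous on
  the compact set \<open>T\<close>.\<close>

locale sup_nonexpansive =
  fixes T :: "'t::metric_space set" and I :: "('t \<Rightarrow> 'b::euclidean_space) \<Rightarrow> 't \<Rightarrow> 'b"
  assumes compact_T: "compact T" and T_nonempty: "T \<noteq> {}"
    and I_cont: "continuous_on T \<phi> \<Longrightarrow> continuous_on T (I \<phi>)"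
    and I_add: "continuous_on T \<phi> \<Longrightarrow> continuous_on T \<psi> \<Longrightarrow> t \<in> T \<Longrightarrow>
      I (\<lambda>s. \<phi> s + \<psi> s) t = I \<phi> t + I \<psi> t"
    and I_scale: "continuous_on T \<phi> \<Longrightarrow> t \<in> T \<Longrightarrow> I (\<lambda>s. c *\<^sub>R \<phi> s) t = c *\<^sub>R I \<phi> t"
    and I_bound: "continuous_on T \<phi> \<Longrightarrow> (\<And>s. s \<in> T \<Longrightarrow> norm (\<phi> s) \<le> C) \<Longrightarrow> t \<in> T \<Longrightarrow>
      norm (I \<phi> t) \<le> C"
begin

lemma I_diff:
  assumes "continuous_on T \<phi>" "continuous_on T \<psi>" "t \<in> T"
  shows "I (\<lambda>s. \<phi> s - \<psi> s) t = I \<phi> t - I \<psi> t"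
  using I_add[OF assms(1) continuous_on_minus[OF assms(2)] assms(3)] I_scale[OF assms(2,3), of "-1"]
  by simp

text \<open>The maximum \<open>m\<close> of \<open>norm (u - v)\<close> satisfies
  \<open>m \<le> m / 2 + \<delta>\<close>. The case \<open>\<delta> = 0\<close> is uniqueness; a
  positive \<open>\<delta>\<close> allows comparison with approximate solutions.\<close>

lemma fixed_point_estimate:
  assumes c: "continuous_on T \<phi>" "continuous_on T \<psi>" "continuous_on T u" "continuous_on T v"
    and u: "\<And>s. s \<in> T \<Longrightarrow> u s = I \<phi> s" and v: "\<And>s. s \<in> T \<Longrightarrow> v s = I \<psi> s"
    and le: "\<And>s. s \<in> T \<Longrightarrow> norm (\<phi> s - \<psi> s) \<le> norm (u s - v s) / 2 + \<delta>"
    and t: "t \<in> T"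
  shows "norm (u t - v t) \<le> 2 * \<delta>"
proof -
  have "continuous_on T (\<lambda>s. norm (u s - v s))" using c by (intro continuous_intros)
  then obtain s where s: "s \<in> T" "\<And>t. t \<in> T \<Longrightarrow> norm (u t - v t) \<le> norm (u s - v s)"
    using continuous_attains_sup[OF compact_T T_nonempty, of "\<lambda>s. norm (u s - v s)"] by blast
  have "norm (u s - v s) = norm (I (\<lambda>s. \<phi> s - \<psi> s) s)"
    using s u v c by (simp add: I_diff)
  also have "\<dots> \<le> norm (u s - v s) / 2 + \<delta>"
  proof (rule I_bound[OF _ _ s(1)])
    show "continuous_on T (\<lambda>s. \<phi> s - \<psi> s)" using c by (intro continuous_intros)
    show "norm (\<phi> r - \<psi> r) \<le> norm (u s - v s) / 2 + \<delta>" if "r \<in> T" for r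
      using le[OF that] s(2)[OF that] by linarith
  qed
  finally show ?thesis using s(2)[OF t] by linarith
qed

text \<open>Picard iteration from zero. The bound \<open>r / 2\<close> for \<open>g t 0\<close> and
  the Lipschitz constant \<open>1 / 2\<close> keep the iterates in the ball, and the increments are
  at most \<open>r * (1/2)^n\<close>, so that the limit is uniform.\<close>

lemma fixed_point_exists:
  assumes g: "continuous_on (T \<times> cball 0 r) (\<lambda>p. g (fst p) (snd p))"
    and lip: "\<And>t x x'. t \<in> T \<Longrightarrow> x \<in> cball 0 r \<Longrightarrow> x' \<in> cball 0 r \<Longrightarrow>
      norm (g t x - g t x') \<le> norm (x - x') / 2"
    and small: "\<And>t. t \<in> T \<Longrightarrow> norm (g t 0) \<le> r / 2"
  obtains y where "continuous_on T y" "\<And>t. t \<in> T \<Longrightarrow> y t \<in> cball 0 r"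
    "\<And>t. t \<in> T \<Longrightarrow> y t = I (\<lambda>s. g s (y s)) t"
proof -
  obtain t0 where "t0 \<in> T" using T_nonempty by blast
  then have r: "0 \<le> r" using small[of t0] norm_ge_zero[of "g t0 0"] by linarith
  have gr: "norm (g t x) \<le> r" if "t \<in> T" "x \<in> cball 0 r" for t x
  proof -
    have "norm (g t x - g t 0) \<le> norm x / 2" using lip[OF that(1,2), of 0] r by simp
    then show ?thesis
      using small[OF that(1)] that(2) norm_triangle_sub[of "g t x" "g t 0"] by simp
  qed
  have gc: "continuous_on T (\<lambda>s. g s (y s))"
    if "continuous_on T y" "\<And>t. t \<in> T \<Longrightarrow> y t \<in> cball 0 r" for y
  proof -
    have "continuous_on T (\<lambda>s. (s, y s))" using that(1) by (intro continuous_intros)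
    moreover have "(\<lambda>s. (s, y s)) ` T \<subseteq> T \<times> cball 0 r" using that(2) by blast
    ultimately show ?thesis using continuous_on_compose2[OF g] by fastforce
  qed
  define Y where "Y = rec_nat (\<lambda>_. 0) (\<lambda>n y. I (\<lambda>s. g s (y s)))"
  have Y0: "Y 0 = (\<lambda>_. 0)" and YS: "Y (Suc n) = I (\<lambda>s. g s (Y n s))" for n
    by (simp_all add: Y_def)
  have inv: "continuous_on T (Y n) \<and> (\<forall>t\<in>T. Y n t \<in> cball 0 r)" for n
  proof (induction n)
    case 0
    then show ?case using r by (simp add: Y0)
  next
    case (Suc n)
    then have "continuous_on T (\<lambda>s. g s (Y n s))" using gc by blast
    then show ?case
      using I_cont I_bound[of "\<lambda>s. g s (Y n s)" r] gr Suc by (auto simp: YS)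
  qed
  have gY: "continuous_on T (\<lambda>s. g s (Y n s))" for n using inv gc by blast
  define f where "f n t = Y (Suc n) t - Y n t" for n t
  have f: "norm (f n t) \<le> r * (1/2)^n" if "t \<in> T" for n t
    using that
  proof (induction n arbitrary: t)
    case 0
    then show ?case using inv[of 1] by (auto simp: f_def Y0)
  next
    case (Suc n)
    have "f (Suc n) t = I (\<lambda>s. g s (Y (Suc n) s) - g s (Y n s)) t"
      unfolding f_def YS[of n] YS[of "Suc n"] using I_diff[OF gY[of "Suc n"] gY[of n] Suc.prems] YS[of n] by simp
    also have "norm \<dots> \<le> r * (1/2)^Suc n"
    proof (rule I_bound[OF _ _ Suc.prems])
      show "continuous_on T (\<lambda>s. g s (Y (Suc n) s) - g s (Y n s))"
        by (rule continuous_on_diff[OF gY gY])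
      show "norm (g s (Y (Suc n) s) - g s (Y n s)) \<le> r * (1/2)^Suc n" if "s \<in> T" for s
        using lip[OF that, of "Y (Suc n) s" "Y n s"] inv that Suc.IH[OF that] by (auto simp: f_def)
    qed
    finally show ?case .
  qed
  define y where "y t = (\<Sum>n. f n t)" for t
  have "uniform_limit T (\<lambda>n t. \<Sum>i<n. f i t) y sequentially"
    unfolding y_def[abs_def]
    by (rule Weierstrass_m_test[OF f]) (auto intro!: summable_mult summable_geometric)
  moreover have "(\<Sum>i<n. f i t) = Y n t" for n t
    using sum_lessThan_telescope[of "\<lambda>n. Y n t" n] by (simp add: f_def Y0)
  ultimately have lim: "uniform_limit T Y y sequentially" by simp
  have yc: "continuous_on T y"
    by (rule uniform_limit_theorem[OF _ lim]) (use inv in auto)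
  have yr: "y t \<in> cball 0 r" if "t \<in> T" for t
  proof -
    have "(\<lambda>n. Y n t) \<longlonglongrightarrow> y t" using tendsto_uniform_limitI[OF lim that] .
    then show ?thesis
      by (rule Lim_in_closed_set[OF closed_cball, rotated 2]) (use inv that in auto)
  qed
  have "y t = I (\<lambda>s. g s (y s)) t" if t: "t \<in> T" for t
  proof -
    have "norm (y t - I (\<lambda>s. g s (y s)) t) \<le> 2 * e" if e: "e > 0" for e
    proof -
      obtain N where N: "\<And>n t. n \<ge> N \<Longrightarrow> t \<in> T \<Longrightarrow> dist (Y n t) (y t) < e"
        using uniform_limitD[OF lim e] by (auto simp: eventually_sequentially)
      have "norm (I (\<lambda>s. g s (Y N s) - g s (y s)) t) \<le> e"
      proof (rule I_bound[OF _ _ t])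
        show "continuous_on T (\<lambda>s. g s (Y N s) - g s (y s))"
          by (rule continuous_on_diff[OF gY gc[OF yc yr]])
        show "norm (g s (Y N s) - g s (y s)) \<le> e" if "s \<in> T" for s
          using lip[OF that, of "Y N s" "y s"] inv[of N] yr[OF that] that N[OF order_refl that] e
          by (auto simp: dist_norm)
      qed
      then have "norm (Y (Suc N) t - I (\<lambda>s. g s (y s)) t) \<le> e"
        unfolding YS using I_diff[OF gY gc[OF yc yr] t, of N] by simp
      moreover have "norm (y t - Y (Suc N) t) < e"
        using N[of "Suc N" t] t by (simp add: dist_norm norm_minus_commute)
      ultimately show ?thesis
        using norm_triangle_ineq[of "y t - Y (Suc N) t" "Y (Suc N) t - I (\<lambda>s. g s (y s)) t"] by simp
    qed
    have "norm (y t - I (\<lambda>s. g s (y s)) t) \<le> 0"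
    proof (rule field_le_epsilon)
      fix e :: real assume "e > 0"
      then show "norm (y t - I (\<lambda>s. g s (y s)) t) \<le> 0 + e"
        using \<open>\<And>e. e > 0 \<Longrightarrow> norm (y t - I (\<lambda>s. g s (y s)) t) \<le> 2 * e\<close>[of "e / 2"] by simp
    qed
    then show ?thesis by simp
  qed
  then show ?thesis using that yc yr by blast
qed


text \<open>\<open>W\<close> is an arbitrary open set containing the solution curves, because the
  linearised equation lives over the whole space of \<open>x\<close> and not over a ball. The
  solution \<open>y\<close> is part of the data, so that the notion can be transferred to its
  derivative.\<close>

definition solution_family ::
  "'z::euclidean_space set \<Rightarrow> ('z \<times> 'b) set \<Rightarrow> ('t \<Rightarrow> 'z \<times> 'b \<Rightarrow> 'b) \<Rightarrow> ('t \<Rightarrow> 'z \<Rightarrow> 'b) \<Rightarrow> bool"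
where
  "solution_family U W g y \<longleftrightarrow> open U \<and> open W \<and>
     (\<forall>t\<in>T. \<forall>z x x'. (z, x) \<in> W \<and> (z, x') \<in> W \<longrightarrow> norm (g t (z, x) - g t (z, x')) \<le> norm (x - x') / 2) \<and>
     (\<forall>z\<in>U. continuous_on T (\<lambda>t. y t z) \<and>
        (\<forall>t\<in>T. (z, y t z) \<in> W \<and> y t z = I (\<lambda>s. g s (z, y s z)) t))"

context
  fixes U :: "'z::euclidean_space set" and W g y
  assumes sol: "solution_family U W g y"
    and g_cont: "continuous_on (T \<times> W) (\<lambda>p. g (fst p) (snd p))"
begin

lemma solution_family_open: "open U" "open W"
  using sol by (auto simp: solution_family_def)

lemma solution_family_lip:
  "t \<in> T \<Longrightarrow> (z, x) \<in> W \<Longrightarrow> (z, x') \<in> W \<Longrightarrow> norm (g t (z, x) - g t (z, x')) \<le> norm (x - x') / 2"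
  using sol by (auto simp: solution_family_def)

lemma solution_family_at:
  assumes "z \<in> U"
  shows "continuous_on T (\<lambda>t. y t z)" "\<And>t. t \<in> T \<Longrightarrow> (z, y t z) \<in> W"
    "\<And>t. t \<in> T \<Longrightarrow> y t z = I (\<lambda>s. g s (z, y s z)) t"
    "continuous_on T (\<lambda>s. (z, y s z))" "continuous_on T (\<lambda>s. g s (z, y s z))"
proof -
  show c: "continuous_on T (\<lambda>t. y t z)" and W: "\<And>t. t \<in> T \<Longrightarrow> (z, y t z) \<in> W"
    and "\<And>t. t \<in> T \<Longrightarrow> y t z = I (\<lambda>s. g s (z, y s z)) t"
    using sol assms unfolding solution_family_def by blast+
  show c': "continuous_on T (\<lambda>s. (z, y s z))" using c by (intro continuous_intros)
  have "continuous_on T (\<lambda>s. (s, z, y s z))"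
    by (intro continuous_on_Pair continuous_on_id c continuous_on_const)
  then show "continuous_on T (\<lambda>s. g s (z, y s z))"
    using continuous_on_compose2[OF g_cont, of T "\<lambda>s. (s, z, y s z)"] W by fastforce
qed

text \<open>The curve belonging to \<open>z\<close> solves the equation for \<open>z'\<close> up to
  the error \<open>\<delta>\<close>; the factor \<open>2\<close> is
  \<open>1 / (1 - 1/2)\<close>.\<close>

lemma solution_family_variation:
  assumes "z \<in> U" "z' \<in> U" "t \<in> T" "\<And>s. s \<in> T \<Longrightarrow> (z', y s z) \<in> W"
    and "\<And>s. s \<in> T \<Longrightarrow> norm (g s (z', y s z) - g s (z, y s z)) \<le> \<delta>"
  shows "norm (y t z' - y t z) \<le> 2 * \<delta>"
proof (rule fixed_point_estimate[OF solution_family_at(5)[OF assms(2)] solution_family_at(5)[OF assms(1)]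
      solution_family_at(1)[OF assms(2)] solution_family_at(1)[OF assms(1)]
      solution_family_at(3)[OF assms(2)] solution_family_at(3)[OF assms(1)] _ assms(3)])
  fix s assume s: "s \<in> T"
  show "norm (g s (z', y s z') - g s (z, y s z)) \<le> norm (y s z' - y s z) / 2 + \<delta>"
    using solution_family_lip[OF s solution_family_at(2)[OF assms(2) s] assms(4)[OF s]] assms(5)[OF s]
      norm_triangle_ineq[of "g s (z', y s z') - g s (z', y s z)" "g s (z', y s z) - g s (z, y s z)"]
    by simp
qed

lemma solution_family_continuous: "continuous_on (T \<times> U) (\<lambda>p. y (fst p) (snd p))"
  unfolding continuous_on_iff
proof (intro ballI allI impI)
  fix p0 and e :: real assume "p0 \<in> T \<times> U" and e: "e > 0"
  then obtain t0 z0 where p0: "p0 = (t0, z0)" "t0 \<in> T" "z0 \<in> U" by blast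
  obtain d1 where d1: "d1 > 0" "\<And>t p. t \<in> T \<Longrightarrow> dist p (z0, y t z0) < d1 \<Longrightarrow>
      p \<in> W \<and> dist (g t p) (g t (z0, y t z0)) < e / 8"
    using uniform_near_curve[OF compact_T solution_family_at(4)[OF p0(3)] solution_family_open(2)
        solution_family_at(2)[OF p0(3)] g_cont, of "e / 8"] e by auto
  obtain d2 where d2: "d2 > 0" "\<And>t. t \<in> T \<Longrightarrow> dist t t0 < d2 \<Longrightarrow> dist (y t z0) (y t0 z0) < e / 2"
    using bspec[OF solution_family_at(1)[OF p0(3), unfolded continuous_on_iff] p0(2), THEN spec, of "e / 2"] e
    by auto
  show "\<exists>d>0. \<forall>p\<in>T \<times> U. dist p p0 < d \<longrightarrow> dist (y (fst p) (snd p)) (y (fst p0) (snd p0)) < e"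
  proof (intro exI[of _ "min d1 d2"] conjI ballI impI)
    fix p assume p: "p \<in> T \<times> U" "dist p p0 < min d1 d2"
    obtain t z where tz: "p = (t, z)" "t \<in> T" "z \<in> U" using p by blast
    have dz: "dist z z0 < d1" and dt: "dist t t0 < d2"
      using p(2) dist_fst_le[of p p0] dist_snd_le[of p p0] by (auto simp: tz p0)
    have d: "dist (z, y s z0) (z0, y s z0) < d1" for s
      using dz by (simp add: dist_Pair_Pair)
    have "norm (y t z - y t z0) \<le> 2 * (e / 8)"
      using d1(2)[OF _ d] by (intro solution_family_variation[OF p0(3) tz(3,2)]) (auto simp: dist_norm less_imp_le)
    moreover have "dist (y t z0) (y t0 z0) < e / 2" using d2(2)[OF tz(2) dt] .
    ultimately show "dist (y (fst p) (snd p)) (y (fst p0) (snd p0)) < e"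
      using dist_triangle[of "y t z" "y t0 z0" "y t z0"] e by (simp add: tz p0 dist_norm)
  qed (use d1 d2 in simp)
qed

end

lemma solution_family_derivative_le:
  fixes U :: "'z::euclidean_space set"
  assumes sol: "solution_family U W g y" and gc: "continuous_on (T \<times> W) (\<lambda>p. g (fst p) (snd p))"
    and g: "Ck_family T W (Suc 0) g" and s: "s \<in> T" and z: "z \<in> U"
  shows "norm (frechet_derivative (g s) (at (z, y s z)) (0, k)) \<le> norm k / 2"
proof -
  note W = solution_family_at(2)[OF sol gc z s]
  obtain d where d: "d > 0" "ball (z, y s z) d \<subseteq> W"
    using solution_family_open(2)[OF sol gc] W open_contains_ball by blast
  show ?thesis
  \<comment> \<open>The summand \<open>1\<close> allows \<open>k = 0\<close>; for \<open>t\<close>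
    below this quotient the point moved by \<open>t *\<^sub>R (0, k)\<close> stays in the ball
    inside \<open>W\<close>.\<close>
  proof (rule norm_derivative_le[OF Ck_family_has_derivative[OF g s W], of "d / (norm k + 1)"])
    show "d / (norm k + 1) > 0" using d by (simp add: add_nonneg_pos)
    fix t :: real assume t: "0 < t" "t < d / (norm k + 1)"
    then have "t * norm k + t < d"
      by (simp add: pos_less_divide_eq add_nonneg_pos distrib_left)
    then have "t * norm k < d" using t by linarith
    then have "(z, y s z) + t *\<^sub>R (0, k) \<in> W"
      using d t by (intro subsetD[OF d(2)]) (simp add: dist_norm norm_Pair)
    then show "norm (g s ((z, y s z) + t *\<^sub>R (0, k)) - g s (z, y s z)) \<le> norm k / 2 * t"
      using solution_family_lip[OF sol gc s, of z "y s z + t *\<^sub>R k" "y s z"] W t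
      by (simp add: mult.commute)
  qed
qed

text \<open>The derivative of a family of fixed points solves the linearised fixed point equation, which
  is a contraction with the same constant.\<close>

lemma solution_family_derivative:
  fixes U :: "'z::euclidean_space set"
  assumes sol: "solution_family U W g y" and g: "Ck_family T W (Suc 0) g" and z: "z \<in> U"
  shows "\<exists>X. (\<forall>w. continuous_on T (\<lambda>t. X t w)) \<and> (\<forall>t\<in>T. (y t has_derivative X t) (at z)) \<and>
    (\<forall>t\<in>T. \<forall>w. X t w = I (\<lambda>s. frechet_derivative (g s) (at (z, y s z)) (w, X s w)) t)"
proof -
  have gc: "continuous_on (T \<times> W) (\<lambda>p. g (fst p) (snd p))"
    using g by (rule Ck_family_continuous)
  note at = solution_family_at[OF sol gc] and opn = solution_family_open[OF sol gc]
  define c where "c s = (z, y s z)" for s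
  have cW: "c s \<in> W" if "s \<in> T" for s using at(2)[OF z that] by (simp add: c_def)
  have cc: "continuous_on T c" using at(4)[OF z] by (simp add: c_def[abs_def])
  \<comment> \<open>Derivatives are bundled as bounded linear functions, so that continuity and
    smallness refer to the operator norm, uniformly in the direction.\<close>
  define D where "D s p = Blinfun (frechet_derivative (g s) (at p))" for s p
  have gD: "(g s has_derivative frechet_derivative (g s) (at p)) (at p)" if "s \<in> T" "p \<in> W" for s p
    using Ck_family_has_derivative[OF g that] .
  have D: "blinfun_apply (D s p) = frechet_derivative (g s) (at p)" if "s \<in> T" "p \<in> W" for s p
    unfolding D_def using gD[OF that] by (intro bounded_linear_Blinfun_apply has_derivative_bounded_linear)
  have D': "(g s has_derivative blinfun_apply (D s p)) (at p)" if "s \<in> T" "p \<in> W" for s p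
    using gD[OF that] D[OF that] by simp
  have Dc: "continuous_on (T \<times> W) (\<lambda>q. D (fst q) (snd q))"
  proof (rule continuous_on_blinfun_componentwise)
    fix i :: "'z \<times> 'b"
    have "continuous_on (T \<times> W) (\<lambda>q. frechet_derivative (g (fst q)) (at (snd q)) i)"
      using g unfolding Ck_family.simps by blast
    then show "continuous_on (T \<times> W) (\<lambda>q. blinfun_apply (D (fst q) (snd q)) i)"
      by (rule continuous_on_eq) (auto simp: D)
  qed
  have Dcc: "continuous_on T (\<lambda>s. D s (c s))"
    using continuous_on_compose2[OF Dc, of T "\<lambda>s. (s, c s)"] cc cW
    by (fastforce intro!: continuous_intros)
  have half: "norm (D s (c s) (0, k)) \<le> norm k / 2" if s: "s \<in> T" for s k
    using solution_family_derivative_le[OF sol gc g s z] D[OF s cW[OF s]] by (simp add: c_def)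
  obtain C where C: "C > 0" "\<And>s. s \<in> T \<Longrightarrow> norm (D s (c s)) \<le> C"
  proof -
    have "bounded ((\<lambda>s. D s (c s)) ` T)"
      using compact_continuous_image[OF Dcc compact_T] compact_imp_bounded by blast
    then show ?thesis using that unfolding bounded_pos by blast
  qed
  have "\<exists>x. continuous_on T x \<and> (\<forall>t\<in>T. x t = I (\<lambda>s. D s (c s) (w, x s)) t)" for w
  proof -
    define r where "r = 2 * (C * norm w)"
    obtain x where "continuous_on T x" "\<And>t. t \<in> T \<Longrightarrow> x t = I (\<lambda>s. D s (c s) (w, x s)) t"
    proof (rule fixed_point_exists[of r "\<lambda>s x. D s (c s) (w, x)"])
      have "continuous_on (T \<times> cball 0 r) (\<lambda>p. D (fst p) (c (fst p)))"
        by (rule continuous_on_compose2[OF Dcc]) (auto intro: continuous_intros)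
      then show "continuous_on (T \<times> cball 0 r) (\<lambda>p. D (fst p) (c (fst p)) (w, snd p))"
        by (intro continuous_intros)
      show "norm (D t (c t) (w, x) - D t (c t) (w, x')) \<le> norm (x - x') / 2" if "t \<in> T" for t x x'
        using half[OF that, of "x - x'"] by (simp flip: blinfun.diff_right)
      show "norm (D t (c t) (w, 0)) \<le> r / 2" if "t \<in> T" for t
      proof -
        have "norm (D t (c t) (w, 0)) \<le> norm (D t (c t)) * norm (w, 0::'b)" by (rule norm_blinfun)
        also have "\<dots> \<le> C * norm w"
          using C(2)[OF that] by (simp add: norm_Pair mult_right_mono)
        finally show ?thesis by (simp add: r_def)
      qed
    qed blast
    then show ?thesis by blast
  qed
  then obtain X where Xc: "\<And>w. continuous_on T (X w)"
    and X: "\<And>w t. t \<in> T \<Longrightarrow> X w t = I (\<lambda>s. D s (c s) (w, X w s)) t"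
    by metis
  have DXc: "continuous_on T (\<lambda>s. D s (c s) (w, x s))" if "continuous_on T x" for w x
    using that Dcc by (intro continuous_intros)
  \<comment> \<open>A curve that solves the linearised equation in direction \<open>w\<close> up to
    \<open>\<delta>\<close> is close to \<open>X w\<close>. With \<open>\<delta> = 0\<close> this
    gives linearity in \<open>w\<close>; with the Taylor remainder as \<open>\<delta>\<close> it
    gives differentiability.\<close>
  have eq: "norm (u t - X w t) \<le> 2 * \<delta>"
    if "continuous_on T u" "continuous_on T \<phi>" "\<And>s. s \<in> T \<Longrightarrow> u s = I \<phi> s"
      "\<And>s. s \<in> T \<Longrightarrow> norm (\<phi> s - D s (c s) (w, u s)) \<le> \<delta>" "t \<in> T" for u \<phi> w \<delta> t
  proof (rule fixed_point_estimate[OF that(2) DXc[OF Xc] that(1) Xc that(3) X _ that(5)])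
    fix s assume s: "s \<in> T"
    have split: "\<phi> s - D s (c s) (w, X w s) = (\<phi> s - D s (c s) (w, u s)) + D s (c s) (0, u s - X w s)"
    proof -
      have "D s (c s) (0, u s - X w s) = D s (c s) (w, u s) - D s (c s) (w, X w s)"
        by (simp flip: blinfun.diff_right)
      then show ?thesis by simp
    qed
    show "norm (\<phi> s - D s (c s) (w, X w s)) \<le> norm (u s - X w s) / 2 + \<delta>"
      unfolding split using half[OF s, of "u s - X w s"] that(4)[OF s]
        norm_triangle_ineq[of "\<phi> s - D s (c s) (w, u s)" "D s (c s) (0, u s - X w s)"] by linarith
  qed
  have lin: "linear (\<lambda>w. X w t)" if t: "t \<in> T" for t
  proof (rule linearI)
    fix v w
    have "norm ((X v t + X w t) - X (v + w) t) \<le> 2 * 0"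
    proof (rule eq[OF _ _ _ _ t])
      show "continuous_on T (\<lambda>s. X v s + X w s)" by (intro continuous_intros Xc)
      show "continuous_on T (\<lambda>s. D s (c s) (v, X v s) + D s (c s) (w, X w s))"
        by (intro continuous_on_add DXc Xc)
      show "X v s + X w s = I (\<lambda>s. D s (c s) (v, X v s) + D s (c s) (w, X w s)) s" if "s \<in> T" for s
        by (subst I_add[OF DXc[OF Xc] DXc[OF Xc] that]) (simp flip: X[OF that])
    qed (simp flip: blinfun.add_right)
    then show "X (v + w) t = X v t + X w t" by simp
  next
    fix a w
    have "norm (a *\<^sub>R X w t - X (a *\<^sub>R w) t) \<le> 2 * 0"
    proof (rule eq[OF _ _ _ _ t])
      show "continuous_on T (\<lambda>s. a *\<^sub>R X w s)" by (intro continuous_intros Xc)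
      show "continuous_on T (\<lambda>s. a *\<^sub>R D s (c s) (w, X w s))"
        by (intro continuous_on_scaleR continuous_on_const DXc Xc)
      show "a *\<^sub>R X w s = I (\<lambda>s. a *\<^sub>R D s (c s) (w, X w s)) s" if "s \<in> T" for s
        by (subst I_scale[OF DXc[OF Xc] that]) (simp flip: X[OF that])
    qed (simp flip: blinfun.scaleR_right)
    then show "X (a *\<^sub>R w) t = a *\<^sub>R X w t" by simp
  qed
  have der: "(y t has_derivative (\<lambda>w. X w t)) (at z)" if t: "t \<in> T" for t
    unfolding has_derivative_at_alt
  proof (intro conjI allI impI)
    show "bounded_linear (\<lambda>w. X w t)" using lin[OF t] linear_conv_bounded_linear by blast
    fix e :: real assume e: "e > 0"
    \<comment> \<open>The minimum with \<open>1\<close> bounds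
      \<open>1 + 2 * (C + \<epsilon>)\<close> by \<open>3 + 2 * C\<close>; the second entry then
      makes the final error at most \<open>e\<close> times the norm of the increment.\<close>
    define \<epsilon> where "\<epsilon> = min 1 (e / (2 * (3 + 2 * C)))"
    have \<epsilon>: "\<epsilon> > 0" "2 * \<epsilon> * (1 + 2 * (C + \<epsilon>)) \<le> e"
    proof -
      show "\<epsilon> > 0" using e C by (simp add: \<epsilon>_def)
      then have "2 * \<epsilon> * (1 + 2 * (C + \<epsilon>)) \<le> 2 * \<epsilon> * (3 + 2 * C)"
        by (intro mult_left_mono) (auto simp: \<epsilon>_def)
      also have "\<dots> \<le> 2 * (e / (2 * (3 + 2 * C))) * (3 + 2 * C)"
        using C by (intro mult_right_mono mult_left_mono) (auto simp: \<epsilon>_def)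
      also have "\<dots> = e" using C by (simp add: field_simps)
      finally show "2 * \<epsilon> * (1 + 2 * (C + \<epsilon>)) \<le> e" .
    qed
    obtain d where d: "d > 0" "\<And>s p. s \<in> T \<Longrightarrow> dist p (c s) < d \<Longrightarrow> p \<in> W \<and> dist (D s p) (D s (c s)) < \<epsilon>"
      using uniform_near_curve[OF compact_T cc opn(2) cW Dc \<epsilon>(1)] by blast
    have rem: "norm (g s p - g s (c s) - D s (c s) (p - c s)) \<le> norm (p - c s) * \<epsilon>"
      if s: "s \<in> T" and p: "dist p (c s) < d" for s p
    proof (rule differentiable_bound_linearization[where S = "ball (c s) d"])
      have xW: "x \<in> W" if "x \<in> ball (c s) d" for x
        using d(2)[OF s, of x] that by (simp add: dist_commute)
      show "c s + t *\<^sub>R (p - c s) \<in> ball (c s) d" if "t \<in> {0..1}" for t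
      proof -
        have "\<bar>t\<bar> * norm (p - c s) \<le> 1 * norm (p - c s)" using that by (intro mult_right_mono) auto
        then show ?thesis using p by (simp add: dist_norm)
      qed
      show "(g s has_derivative blinfun_apply (D s x)) (at x within ball (c s) d)" if "x \<in> ball (c s) d" for x
        by (rule has_derivative_at_withinI[OF D'[OF s xW[OF that]]])
      show "onorm (blinfun_apply (D s x) - blinfun_apply (D s (c s))) \<le> \<epsilon>" if "x \<in> ball (c s) d" for x
      proof -
        have "norm (D s x - D s (c s)) < \<epsilon>" using d(2)[OF s] that by (simp add: dist_commute dist_norm)
        then show ?thesis by (simp add: norm_blinfun.rep_eq minus_blinfun.rep_eq fun_diff_def)
      qed
    qed (use d in simp)
    obtain d0 where d0: "d0 > 0" "ball z d0 \<subseteq> U" using opn(1) z open_contains_ball by blast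
    \<comment> \<open>By the Lipschitz estimate \<open>k\<close> below, \<open>(z, y s z)\<close> is
      displaced by at most \<open>norm h * (1 + 2 * (C + \<epsilon>))\<close>, so it stays in the
      tube of radius \<open>d\<close> where the remainder is controlled.\<close>
    define d' where "d' = min d0 (d / (1 + 2 * (C + \<epsilon>)))"
    have pos: "1 + 2 * (C + \<epsilon>) > 0" using C \<epsilon> by simp
    have d': "d' > 0" using d0 d pos by (simp add: d'_def)
    show "\<exists>d>0. \<forall>z'. norm (z' - z) < d \<longrightarrow> norm (y t z' - y t z - X (z' - z) t) \<le> e * norm (z' - z)"
    proof (intro exI[of _ d'] conjI allI impI d')
      fix z' assume z': "norm (z' - z) < d'"
      define h where "h = z' - z"
      have h: "norm h * (1 + 2 * (C + \<epsilon>)) < d"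
        using z' pos by (simp add: h_def d'_def pos_less_divide_eq)
      have "norm h * 1 \<le> norm h * (1 + 2 * (C + \<epsilon>))" using C \<epsilon> by (intro mult_left_mono) auto
      then have hd: "norm h < d" using h by linarith
      have z'U: "z' \<in> U" using z' d0 by (auto simp: d'_def dist_norm norm_minus_commute)
      have dz: "dist (z', y s z) (c s) < d" for s
        using hd by (simp add: c_def dist_Pair_Pair h_def dist_norm)
      have k: "norm (y s z' - y s z) \<le> 2 * ((C + \<epsilon>) * norm h)" if s: "s \<in> T" for s
      proof (rule solution_family_variation[OF sol gc z z'U s])
        fix s assume s: "s \<in> T"
        show "(z', y s z) \<in> W" using d(2)[OF s dz] by blast
        have e: "(z', y s z) - c s = (h, 0)" by (simp add: c_def h_def)
        have "norm (g s (z', y s z) - g s (c s)) \<le> norm h * \<epsilon> + norm (D s (c s) (h, 0))"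
          using rem[OF s dz] norm_triangle_sub[of "g s (z', y s z) - g s (c s)" "D s (c s) (h, 0)"]
          by (simp add: e norm_Pair)
        also have "norm (D s (c s) (h, 0)) \<le> C * norm h"
          using norm_blinfun[of "D s (c s)" "(h, 0)"] C(2)[OF s]
          by (simp add: norm_Pair) (meson mult_right_mono norm_ge_zero order_trans)
        finally show "norm (g s (z', y s z) - g s (z, y s z)) \<le> (C + \<epsilon>) * norm h"
          by (simp add: c_def algebra_simps)
      qed
      define u where "u s = y s z' - y s z" for s
      have "norm (u t - X h t) \<le> 2 * (norm h * (1 + 2 * (C + \<epsilon>)) * \<epsilon>)"
      proof (rule eq[OF _ _ _ _ t])
        show "continuous_on T u" unfolding u_def[abs_def]
          by (intro continuous_on_diff at(1) z z'U)
        show "continuous_on T (\<lambda>s. g s (z', y s z') - g s (z, y s z))"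
          by (intro continuous_on_diff at(5) z z'U)
        fix s assume s: "s \<in> T"
        show "u s = I (\<lambda>s. g s (z', y s z') - g s (z, y s z)) s"
          unfolding u_def using I_diff[OF at(5)[OF z'U] at(5)[OF z] s] at(3)[OF z'U s] at(3)[OF z s] by simp
        have e: "(z', y s z') - c s = (h, u s)" by (simp add: c_def h_def u_def)
        have nu: "norm (h, u s) \<le> norm h * (1 + 2 * (C + \<epsilon>))"
          using norm_Pair_le[of h "u s"] k[OF s] by (simp add: u_def algebra_simps)
        then have "dist (z', y s z') (c s) < d" using h by (simp add: dist_norm e)
        from rem[OF s this] have "norm (g s (z', y s z') - g s (z, y s z) - D s (c s) (h, u s)) \<le> norm (h, u s) * \<epsilon>"
          by (simp add: e) (simp add: c_def)
        also have "\<dots> \<le> norm h * (1 + 2 * (C + \<epsilon>)) * \<epsilon>" using nu \<epsilon> by (intro mult_right_mono) auto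
        finally show "norm (g s (z', y s z') - g s (z, y s z) - D s (c s) (h, u s)) \<le> norm h * (1 + 2 * (C + \<epsilon>)) * \<epsilon>" .
      qed
      also have "\<dots> = 2 * \<epsilon> * (1 + 2 * (C + \<epsilon>)) * norm h" by simp
      also have "\<dots> \<le> e * norm h" using \<epsilon>(2) by (intro mult_right_mono) auto
      finally show "norm (y t z' - y t z - X (z' - z) t) \<le> e * norm (z' - z)" by (simp add: u_def h_def)
    qed
  qed
  have eqI: "X w t = I (\<lambda>s. frechet_derivative (g s) (at (z, y s z)) (w, X w s)) t" if t: "t \<in> T" for w t
  proof -
    have c': "continuous_on T (\<lambda>s. frechet_derivative (g s) (at (z, y s z)) (w, X w s))"
      by (rule continuous_on_eq[OF DXc[OF Xc, of w w]]) (use D cW in \<open>auto simp: c_def\<close>)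
    have "norm (I (\<lambda>s. D s (c s) (w, X w s) - frechet_derivative (g s) (at (z, y s z)) (w, X w s)) t) \<le> 0"
      by (rule I_bound[OF continuous_on_diff[OF DXc[OF Xc] c'] _ t]) (use D cW in \<open>auto simp: c_def\<close>)
    then show ?thesis using X[OF t, of w] I_diff[OF DXc[OF Xc] c' t, of w w] by simp
  qed
  show ?thesis
    using Xc der eqI by (intro exI[of _ "\<lambda>t w. X w t"]) blast
qed


text \<open>For fixed \<open>w\<close> the derivative is a solution family of \<open>g'\<close>, the
  derivative of \<open>g\<close> along the solution, over the same \<open>I\<close> and with the
  same constant. The induction hypothesis is used twice: for \<open>y\<close> itself, which occurs
  in \<open>g'\<close>, and then for the derivative.\<close>

theorem solution_family_Ck:
  fixes U :: "'z::euclidean_space set"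
  assumes "solution_family U W g y" "Ck_family T W m g"
  shows "Ck_family T U m y"
  using assms
proof (induction m arbitrary: W g y)
  case 0
  then show ?case using solution_family_continuous by simp
next
  case (Suc m)
  note sol = Suc.prems(1) and g = Suc.prems(2)
  note gc = Ck_family_continuous[OF g]
  note opn = solution_family_open[OF sol gc] and at = solution_family_at[OF sol gc]
  have g1: "Ck_family T W (Suc 0) g"
    using g Ck_family_continuous[of T W m] unfolding Ck_family.simps by blast
  have ym: "Ck_family T U m y" using Suc.IH[OF sol Ck_family_Suc[OF g]] .
  have "\<forall>z\<in>U. \<exists>X. (\<forall>w. continuous_on T (\<lambda>t. X t w)) \<and>
    (\<forall>t\<in>T. (y t has_derivative X t) (at z)) \<and>
    (\<forall>t\<in>T. \<forall>w. X t w = I (\<lambda>s. frechet_derivative (g s) (at (z, y s z)) (w, X s w)) t)"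
    by (intro ballI solution_family_derivative[OF sol g1])
  from bchoice[OF this] obtain X where XX: "\<forall>z\<in>U. (\<forall>w. continuous_on T (\<lambda>t. X z t w)) \<and>
    (\<forall>t\<in>T. (y t has_derivative X z t) (at z)) \<and>
    (\<forall>t\<in>T. \<forall>w. X z t w = I (\<lambda>s. frechet_derivative (g s) (at (z, y s z)) (w, X z s w)) t)"
    by blast
  have X: "\<And>z w. z \<in> U \<Longrightarrow> continuous_on T (\<lambda>t. X z t w)"
    "\<And>z t. z \<in> U \<Longrightarrow> t \<in> T \<Longrightarrow> (y t has_derivative X z t) (at z)"
    "\<And>z t w. z \<in> U \<Longrightarrow> t \<in> T \<Longrightarrow>
      X z t w = I (\<lambda>s. frechet_derivative (g s) (at (z, y s z)) (w, X z s w)) t"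
    using XX by blast+
  have gD: "(g s has_derivative frechet_derivative (g s) (at p)) (at p)" if "s \<in> T" "p \<in> W" for s p
    using Ck_family_has_derivative[OF g that] .
  show ?case
  proof (rule Ck_family_SucI[OF opn(1) Ck_family_continuous[OF ym]])
    show "(y t has_derivative X z t) (at z)" if "t \<in> T" "z \<in> U" for t z
      using X(2) that by blast
    fix w
    define g' where "g' t q = frechet_derivative (g t) (at (fst q, y t (fst q))) (w, snd q)" for t q
    have oW': "open (U \<times> (UNIV :: 'b set))" using opn by (simp add: open_Times)
    have lin: "linear (frechet_derivative (g t) (at (z, y t z)))" if "t \<in> T" "z \<in> U" for t z
      using has_derivative_linear[OF gD[OF that(1) at(2)[OF that(2,1)]]] .
    have "solution_family U (U \<times> UNIV) g' (\<lambda>t z. X z t w)"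
      unfolding solution_family_def
    proof (intro conjI ballI allI impI; (elim conjE)?)
      fix t z x x' assume t: "t \<in> T" and zx: "(z, x) \<in> U \<times> (UNIV :: 'b set)"
      then have z: "z \<in> U" by simp
      have "g' t (z, x) - g' t (z, x') = frechet_derivative (g t) (at (z, y t z)) (0, x - x')"
        using linear_diff[OF lin[OF t z], of "(w, x)" "(w, x')"] by (simp add: g'_def)
      moreover have "norm (frechet_derivative (g t) (at (z, y t z)) (0, k)) \<le> norm k / 2" for k
        by (rule solution_family_derivative_le[OF sol gc g1 t z])
      ultimately show "norm (g' t (z, x) - g' t (z, x')) \<le> norm (x - x') / 2" by simp
    qed (use opn oW' X in \<open>auto simp: g'_def\<close>)
    moreover have "Ck_family T (U \<times> UNIV) m g'"
    proof -
      let ?W = "U \<times> (UNIV :: 'b set)"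
      let ?\<gamma> = "\<lambda>t q. (fst q, y t (fst q))"
      have "Ck_family T ?W m (\<lambda>t q. y t (fst q))"
        by (rule Ck_family_compose[OF oW' opn(1) _ Ck_family_linear[OF bounded_linear_fst] ym]) auto
      then have \<gamma>: "Ck_family T ?W m ?\<gamma>"
        by (intro Ck_family_Pair[OF oW'] Ck_family_linear[OF bounded_linear_fst])
      have D: "Ck_family T ?W m (\<lambda>t q. frechet_derivative (g t) (at (?\<gamma> t q)) v)" for v
      proof (rule Ck_family_compose[OF oW' opn(2) _ \<gamma>])
        show "Ck_family T W m (\<lambda>t p. frechet_derivative (g t) (at p) v)"
          using g unfolding Ck_family.simps by blast
      qed (use at(2) in auto)
      have "Ck_family T ?W m (\<lambda>t q. snd q \<bullet> j)" for j
        by (rule Ck_family_linear) (intro bounded_linear_inner_left_comp bounded_linear_snd)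
      then have "Ck_family T ?W m (\<lambda>t q. frechet_derivative (g t) (at (?\<gamma> t q)) (w, 0) +
          (\<Sum>j\<in>Basis. (snd q \<bullet> j) *\<^sub>R frechet_derivative (g t) (at (?\<gamma> t q)) (0, j)))"
        by (intro Ck_family_add[OF oW'] Ck_family_sum[OF oW'] D Ck_family_bilinear[OF bounded_bilinear_scaleR oW'])
      then show ?thesis
      proof (rule Ck_family_cong[OF oW', rotated])
        fix t q assume t: "t \<in> T" and q: "q \<in> ?W"
        then have z: "fst q \<in> U" by auto
        let ?D = "frechet_derivative (g t) (at (?\<gamma> t q))"
        note L = lin[OF t z]
        have "(0, snd q) = (\<Sum>j\<in>Basis. (snd q \<bullet> j) *\<^sub>R (0 :: 'z, j))"
        proof -
          have "(0 :: 'z, \<Sum>j\<in>Basis. (snd q \<bullet> j) *\<^sub>R j) = (\<Sum>j\<in>Basis. (snd q \<bullet> j) *\<^sub>R (0 :: 'z, j))"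
            by (simp add: prod_eq_iff fst_sum snd_sum)
          then show ?thesis by (simp only: euclidean_representation)
        qed
        then have "?D (0, snd q) = (\<Sum>j\<in>Basis. (snd q \<bullet> j) *\<^sub>R ?D (0, j))"
          by (simp only: linear_sum[OF L] linear_cmul[OF L] o_def)
        then show "?D (w, 0) + (\<Sum>j\<in>Basis. (snd q \<bullet> j) *\<^sub>R ?D (0, j)) = g' t q"
          using linear_add[OF L, of "(w, 0)" "(0, snd q)"] by (simp add: g'_def)
      qed
    qed
    ultimately show "Ck_family T U m (\<lambda>t z. X z t w)" by (rule Suc.IH)
  qed
qed

end


section \<open>Implicit and inverse functions\<close>

lemma small_partial_derivative:
  fixes g :: "'z::euclidean_space \<times> 'b::euclidean_space \<Rightarrow> 'c::real_normed_vector"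
  assumes W: "open W" "p0 \<in> W" and g: "smooth_on UNIV g W"
    and D0: "\<And>k. frechet_derivative g (at p0) (0, k) = 0" and e: "e > 0"
  obtains \<rho> where "\<rho> > 0" "ball p0 \<rho> \<subseteq> W"
    "\<And>p k. p \<in> ball p0 \<rho> \<Longrightarrow> norm (frechet_derivative g (at p) (0, k)) \<le> e * norm k"
proof -
  define h where "h p = (\<Sum>j\<in>Basis. norm (frechet_derivative g (at p) (0, j)))" for p
  have "continuous_on W h"
    unfolding h_def[abs_def]
    by (intro continuous_on_sum continuous_on_norm smooth_on_continuous smooth_on_derivative g)
  then have "continuous (at p0) h" using W continuous_on_eq_continuous_at by blast
  moreover have "h p0 < e" using e by (simp add: h_def D0)
  ultimately have "eventually (\<lambda>p. h p < e) (nhds p0)"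
    by (simp add: continuous_within tendsto_nhds_iff order_tendstoD(2) isCont_def at_within_def[symmetric])
  then obtain \<rho>1 where \<rho>1: "\<rho>1 > 0" "\<And>p. dist p p0 < \<rho>1 \<Longrightarrow> h p < e"
    unfolding eventually_nhds_metric by blast
  obtain \<rho>2 where \<rho>2: "\<rho>2 > 0" "ball p0 \<rho>2 \<subseteq> W" using W open_contains_ball by blast
  show ?thesis
  proof (rule that[of "min \<rho>1 \<rho>2"])
    fix p and k :: 'b assume p: "p \<in> ball p0 (min \<rho>1 \<rho>2)"
    then have "p \<in> W" using \<rho>2 by auto
    let ?D = "frechet_derivative g (at p)"
    have L: "linear ?D" using has_derivative_linear[OF smooth_on_has_derivative[OF g \<open>p \<in> W\<close>]] .
    have "(0 :: 'z, \<Sum>j\<in>Basis. (k \<bullet> j) *\<^sub>R j) = (\<Sum>j\<in>Basis. (k \<bullet> j) *\<^sub>R (0 :: 'z, j))"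
      by (simp add: prod_eq_iff fst_sum snd_sum)
    then have "?D (0, k) = (\<Sum>j\<in>Basis. (k \<bullet> j) *\<^sub>R ?D (0, j))"
      by (simp only: euclidean_representation linear_sum[OF L] linear_cmul[OF L] o_def)
    also have "norm \<dots> \<le> (\<Sum>j\<in>Basis. \<bar>k \<bullet> j\<bar> * norm (?D (0, j)))"
      by (rule sum_norm_le) simp
    also have "\<dots> \<le> (\<Sum>j\<in>Basis. norm k * norm (?D (0, j)))"
      by (intro sum_mono mult_right_mono Basis_le_norm) auto
    also have "\<dots> = h p * norm k" by (simp add: h_def sum_distrib_left mult.commute)
    also have "\<dots> \<le> e * norm k"
      using \<rho>1(2)[of p] p by (intro mult_right_mono) (auto simp: dist_commute)
    finally show "norm (?D (0, k)) \<le> e * norm k" .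
  qed (use \<rho>1 \<rho>2 in auto)
qed

context sup_nonexpansive
begin

text \<open>Since \<open>g\<close> and its partial derivative in the second variable vanish at
  \<open>(z0, 0)\<close>, near this point \<open>g\<close> has small values and is a contraction
  with constant \<open>1 / 2\<close>.\<close>

theorem smooth_fixed_point:
  fixes g :: "'z::euclidean_space \<times> 'b \<Rightarrow> 'b"
  assumes W: "open W" "(z0, 0) \<in> W" and g: "smooth_on UNIV g W"
    and g0: "g (z0, 0) = 0" and D0: "\<And>k. frechet_derivative g (at (z0, 0)) (0, k) = 0"
  obtains \<delta> r y where "\<delta> > 0" "r > 0" "ball z0 \<delta> \<times> ball 0 r \<subseteq> W"
    "solution_family (ball z0 \<delta>) (ball z0 \<delta> \<times> ball 0 r) (\<lambda>_. g) y"
    "\<And>t. t \<in> T \<Longrightarrow> smooth_on UNIV (y t) (ball z0 \<delta>)"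
proof -
  obtain \<rho> where \<rho>: "\<rho> > 0" "ball (z0, 0) \<rho> \<subseteq> W"
    "\<And>p k. p \<in> ball (z0, 0) \<rho> \<Longrightarrow> norm (frechet_derivative g (at p) (0, k)) \<le> (1/2) * norm k"
    using small_partial_derivative[OF W g D0, of "1/2"] by auto
  define r where "r = \<rho> / 2"
  have r: "r > 0" using \<rho> by (simp add: r_def)
  have in\<rho>: "(z, x) \<in> ball (z0, 0) \<rho>" if "z \<in> ball z0 r" "x \<in> ball 0 r" for z and x :: 'b
  proof -
    have "dist (z0, 0) (z, x) \<le> dist z0 z + dist 0 x"
      by (simp add: dist_Pair_Pair sqrt_sum_squares_le_sum)
    then show ?thesis using that by (simp add: r_def)
  qed
  have lip: "norm (g (z, x) - g (z, x')) \<le> norm (x - x') / 2"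
    if z: "z \<in> ball z0 r" and x: "x \<in> ball 0 r" "x' \<in> ball 0 r" for z x x'
  proof -
    have "norm (g (z, x) - g (z, x')) \<le> 1/2 * norm (x - x')"
    proof (rule differentiable_bound[OF convex_ball _ _ x(1,2), where f = "\<lambda>x. g (z, x)" and
          f' = "\<lambda>v k. frechet_derivative g (at (z, v)) (0, k)"])
      fix v :: 'b assume v: "v \<in> ball 0 r"
      have g': "(g has_derivative frechet_derivative g (at (z, v))) (at (z, v))"
        using smooth_on_has_derivative[OF g] in\<rho>[OF z v] \<rho>(2) by blast
      have "((\<lambda>x. (z, x)) has_derivative (\<lambda>k. (0, k))) (at v)"
        by (auto intro!: derivative_eq_intros)
      from has_derivative_at_withinI[OF has_derivative_compose[OF this g']] show "((\<lambda>x. g (z, x)) has_derivative (\<lambda>k. frechet_derivative g (at (z, v)) (0, k))) (at v within ball 0 r)"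
        by this
      show "onorm (\<lambda>k. frechet_derivative g (at (z, v)) (0, k)) \<le> 1/2"
        by (rule onorm_bound) (use \<rho>(3)[OF in\<rho>[OF z v]] in auto)
    qed
    then show ?thesis by simp
  qed
  have "continuous_on (ball z0 r) (\<lambda>z. g (z, 0))"
    by (rule continuous_on_compose2[OF smooth_on_continuous[OF g]])
      (use in\<rho> \<rho>(2) r in \<open>auto intro!: continuous_intros\<close>)
  \<comment> \<open>The iteration runs in the closed ball of radius \<open>r / 2\<close>, which lies
    inside the open ball of radius \<open>r\<close>, and \<open>fixed_point_exists\<close> asks for
    half of its radius as a bound at zero.\<close>
  from bspec[OF this[unfolded continuous_on_iff], of z0, THEN spec, of "r / 4"]
  obtain \<delta>1 where \<delta>1: "\<delta>1 > 0" "\<And>z. z \<in> ball z0 r \<Longrightarrow> dist z z0 < \<delta>1 \<Longrightarrow> norm (g (z, 0)) < r / 4"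
    using r g0 by auto
  define \<delta> where "\<delta> = min r \<delta>1"
  have \<delta>: "\<delta> > 0" "\<delta> \<le> r" using r \<delta>1 by (auto simp: \<delta>_def)
  have sub: "ball z0 \<delta> \<times> ball 0 r \<subseteq> W"
    using in\<rho> \<rho>(2) \<delta> by (auto simp: subset_iff)
  have "\<exists>x. continuous_on T x \<and> (\<forall>t\<in>T. x t \<in> cball 0 (r/2)) \<and> (\<forall>t\<in>T. x t = I (\<lambda>s. g (z, x s)) t)"
    if z: "z \<in> ball z0 \<delta>" for z
  proof -
    have zr: "z \<in> ball z0 r" using z \<delta> by auto
    have 1: "continuous_on (T \<times> cball 0 (r/2)) (\<lambda>p. g (z, snd p))"
      by (rule continuous_on_compose2[OF smooth_on_continuous[OF g]])
        (use sub z r in \<open>auto intro!: continuous_intros\<close>)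
    have 2: "norm (g (z, 0)) \<le> r / 2 / 2"
      using \<delta>1(2)[OF zr] z by (simp add: \<delta>_def dist_commute)
    have 3: "norm (g (z, x) - g (z, x')) \<le> norm (x - x') / 2"
      if "x \<in> cball 0 (r/2)" "x' \<in> cball 0 (r/2)" for x x'
      using that r by (intro lip[OF zr]) auto
    show ?thesis
      by (rule fixed_point_exists[of "r/2" "\<lambda>_ x. g (z, x)", OF 1 3 2]) blast+
  qed
  then have "\<forall>z\<in>ball z0 \<delta>. \<exists>x. continuous_on T x \<and> (\<forall>t\<in>T. x t \<in> cball 0 (r/2)) \<and>
      (\<forall>t\<in>T. x t = I (\<lambda>s. g (z, x s)) t)" by blast
  from bchoice[OF this] obtain x where x': "\<forall>z\<in>ball z0 \<delta>. continuous_on T (x z) \<and>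
      (\<forall>t\<in>T. x z t \<in> cball 0 (r/2)) \<and> (\<forall>t\<in>T. x z t = I (\<lambda>s. g (z, x z s)) t)" by blast
  have x: "\<And>z. z \<in> ball z0 \<delta> \<Longrightarrow> continuous_on T (x z)"
    "\<And>z t. z \<in> ball z0 \<delta> \<Longrightarrow> t \<in> T \<Longrightarrow> x z t \<in> cball 0 (r/2)"
    "\<And>z t. z \<in> ball z0 \<delta> \<Longrightarrow> t \<in> T \<Longrightarrow> x z t = I (\<lambda>s. g (z, x z s)) t"
    using x' by blast+
  define y where "y t z = x z t" for t z
  have "solution_family (ball z0 \<delta>) (ball z0 \<delta> \<times> ball 0 r) (\<lambda>_. g) y"
    unfolding solution_family_def
  proof (intro conjI ballI allI impI; (elim conjE)?)
    fix z u u' assume "(z, u) \<in> ball z0 \<delta> \<times> ball (0::'b) r" "(z, u') \<in> ball z0 \<delta> \<times> ball (0::'b) r"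
    then show "norm (g (z, u) - g (z, u')) \<le> norm (u - u') / 2"
      using \<delta> by (intro lip) auto
  next
    fix z t assume z: "z \<in> ball z0 \<delta>" and t: "t \<in> T"
    show "(z, y t z) \<in> ball z0 \<delta> \<times> ball 0 r" using x(2)[OF z t] z r by (auto simp: y_def)
    show "y t z = I (\<lambda>s. g (z, y s z)) t" unfolding y_def using x(3)[OF z t] .
  next
    fix z assume "z \<in> ball z0 \<delta>"
    then show "continuous_on T (\<lambda>t. y t z)" using x(1) by (simp add: y_def)
  qed (auto simp: open_Times)
  moreover have "smooth_on UNIV (y t) (ball z0 \<delta>)" if t: "t \<in> T" for t
  proof -
    have "Ck_family T (ball z0 \<delta>) m y" for m
      by (rule solution_family_Ck[OF \<open>solution_family _ _ _ y\<close>])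
        (rule Ck_family_subset[OF smooth_on_family[OF W(1) g] order_refl sub])
    then have "Ck_family {t} (ball z0 \<delta>) m y" for m
      by (rule Ck_family_subset) (use t in auto)
    then have "Ck_family {t} (ball z0 \<delta>) m (\<lambda>_. y t)" for m
      by (rule Ck_family_cong[OF open_ball, rotated]) auto
    then show ?thesis by (subst smooth_on_iff_family[of _ "{t}"]) auto
  qed
  ultimately show ?thesis using that[OF \<delta>(1) r sub] by blast
qed

end

interpretation point: sup_nonexpansive "{0 :: real}" "\<lambda>\<phi>. \<phi>"
  by unfold_locales auto

text \<open>The interval has length one, which makes integration nonexpansive for the supremum
  norm.\<close>

interpretation integral: sup_nonexpansive "{0..1 :: real}" "\<lambda>\<phi> t. integral {0..t} \<phi>"
proof
  have sub: "{0..t} \<subseteq> {0..1}" if "t \<in> {0..1::real}" for t using that by auto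
  have int: "\<phi> integrable_on {0..t}" if "continuous_on {0..1} \<phi>" "t \<in> {0..1}" for \<phi> :: "real \<Rightarrow> 'a" and t
    using continuous_on_subset[OF that(1) sub[OF that(2)]] by (rule integrable_continuous_real)
  show "continuous_on {0..1} (\<lambda>t. integral {0..t} \<phi>)" if "continuous_on {0..1} \<phi>" for \<phi> :: "real \<Rightarrow> 'a"
    using that by (intro indefinite_integral_continuous_1 integrable_continuous_real)
  show "integral {0..t} (\<lambda>s. \<phi> s + \<psi> s) = integral {0..t} \<phi> + integral {0..t} \<psi>"
    if "continuous_on {0..1} \<phi>" "continuous_on {0..1} \<psi>" "t \<in> {0..1}" for \<phi> \<psi> :: "real \<Rightarrow> 'a" and t
    using that int by (intro integral_add) auto
  show "norm (integral {0..t} \<phi>) \<le> C"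
    if "continuous_on {0..1} \<phi>" "\<And>s. s \<in> {0..1} \<Longrightarrow> norm (\<phi> s) \<le> C" "t \<in> {0..1}"
    for \<phi> :: "real \<Rightarrow> 'a" and C t
  proof -
    have "0 \<le> C" using order_trans[OF norm_ge_zero that(2)[of 0]] by simp
    have "norm (integral {0..t} \<phi>) \<le> C * (t - 0)"
      using that by (intro integral_bound continuous_on_subset[OF that(1)]) auto
    also have "\<dots> \<le> C" using that(3) \<open>0 \<le> C\<close> by (simp add: mult_left_le)
    finally show ?thesis .
  qed
qed auto

text \<open>Zeros of \<open>F\<close> near the base point are fixed points of the simplified Newton
  map \<open>x \<mapsto> x - R (F (z, x0 + x))\<close> in the displacement \<open>x\<close> from
  \<open>x0\<close>. As \<open>R\<close> inverts the partial derivative of \<open>F\<close>, that of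
  the Newton map vanishes at the base point.\<close>

theorem smooth_implicit_function:
  fixes F :: "'z::euclidean_space \<times> 'b::euclidean_space \<Rightarrow> 'b"
  assumes W: "open W" "(z0, x0) \<in> W" and F: "smooth_on UNIV F W" and F0: "F (z0, x0) = 0"
    and R: "linear R" "\<And>k. R (frechet_derivative F (at (z0, x0)) (0, k)) = k" "\<And>v. R v = 0 \<Longrightarrow> v = 0"
  obtains \<delta> r y where "\<delta> > 0" "r > 0" "smooth_on UNIV y (ball z0 \<delta>)"
    "\<And>z. z \<in> ball z0 \<delta> \<Longrightarrow> y z \<in> ball x0 r \<and> (z, y z) \<in> W \<and> F (z, y z) = 0"
    "\<And>z x. z \<in> ball z0 \<delta> \<Longrightarrow> x \<in> ball x0 r \<Longrightarrow> F (z, x) = 0 \<Longrightarrow> x = y z"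
proof -
  define s :: "'z \<times> 'b \<Rightarrow> 'z \<times> 'b" where "s p = (fst p, x0 + snd p)" for p
  define W' where "W' = s -` W"
  have sc: "continuous_on UNIV s" unfolding s_def[abs_def] by (intro continuous_intros)
  have W': "open W'" "(z0, 0) \<in> W'"
    using W open_vimage[OF W(1) sc] by (auto simp: W'_def s_def)
  define g where "g p = snd p - R (F (s p))" for p
  have bR: "bounded_linear R" using R(1) linear_conv_bounded_linear by blast
  have ss: "smooth_on UNIV s W'"
    unfolding s_def[abs_def]
    by (intro smooth_on_Pair smooth_on_add smooth_on_const smooth_on_linear W' bounded_linear_fst bounded_linear_snd)
  have g: "smooth_on UNIV g W'"
  proof -
    have "smooth_on UNIV (\<lambda>p. F (s p)) W'"
      by (rule smooth_on_compose[OF W'(1) W(1) ss F]) (auto simp: W'_def)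
    from smooth_on_diff[OF W'(1) smooth_on_linear[OF W'(1) bounded_linear_snd]
        smooth_on_bounded_linear[OF W'(1) bR this]]
    show ?thesis by (simp add: g_def[abs_def])
  qed
  have D0: "frechet_derivative g (at (z0, 0)) (0, k) = 0" for k
  proof -
    have "(s has_derivative (\<lambda>h. h)) (at (z0, 0))"
      unfolding s_def[abs_def] by (auto intro!: derivative_eq_intros)
    moreover have "(F has_derivative frechet_derivative F (at (z0, x0))) (at (s (z0, 0)))"
      using smooth_on_has_derivative[OF F W(2)] by (simp add: s_def)
    ultimately have "((\<lambda>p. F (s p)) has_derivative (\<lambda>h. frechet_derivative F (at (z0, x0)) h)) (at (z0, 0))"
      by (rule has_derivative_compose)
    then have "(g has_derivative (\<lambda>h. snd h - R (frechet_derivative F (at (z0, x0)) h))) (at (z0, 0))"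
      unfolding g_def[abs_def]
      by (intro has_derivative_diff bounded_linear.has_derivative[OF bR] bounded_linear_imp_has_derivative bounded_linear_snd)
    then show ?thesis using R(2) by (simp add: frechet_derivative_eqI)
  qed
  have g0: "g (z0, 0) = 0" using F0 linear_0[OF R(1)] by (simp add: g_def s_def)
  obtain \<delta> r x where sol: "\<delta> > 0" "r > 0" "ball z0 \<delta> \<times> ball 0 r \<subseteq> W'"
    "point.solution_family (ball z0 \<delta>) (ball z0 \<delta> \<times> ball 0 r) (\<lambda>_. g) x"
    "\<And>t. t \<in> {0} \<Longrightarrow> smooth_on UNIV (x t) (ball z0 \<delta>)"
    by (rule point.smooth_fixed_point[OF W' g g0 D0], rule that; assumption)
  have sx: "x 0 z \<in> ball 0 r" "x 0 z = g (z, x 0 z)" if "z \<in> ball z0 \<delta>" for z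
    using sol(4) that unfolding point.solution_family_def by auto
  have lip: "norm (g (z, u) - g (z, v)) \<le> norm (u - v) / 2"
    if "z \<in> ball z0 \<delta>" "u \<in> ball 0 r" "v \<in> ball 0 r" for z u v
    using sol(4) that unfolding point.solution_family_def by auto
  show ?thesis
  proof (rule that[OF sol(1,2), of "\<lambda>z. x0 + x 0 z"])
    show "smooth_on UNIV (\<lambda>z. x0 + x 0 z) (ball z0 \<delta>)"
      by (intro smooth_on_add smooth_on_const sol(5) open_ball) simp
    fix z assume z: "z \<in> ball z0 \<delta>"
    have "R (F (z, x0 + x 0 z)) = 0" using sx(2)[OF z] by (simp add: g_def s_def)
    moreover have "(z, x 0 z) \<in> W'" using sol(3) z sx(1)[OF z] by blast
    ultimately show "x0 + x 0 z \<in> ball x0 r \<and> (z, x0 + x 0 z) \<in> W \<and> F (z, x0 + x 0 z) = 0"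
      using sx(1)[OF z] R(3) by (auto simp: dist_norm W'_def s_def)
    fix u assume u: "u \<in> ball x0 r" "F (z, u) = 0"
    have "g (z, u - x0) = u - x0" using u(2) linear_0[OF R(1)] by (simp add: g_def s_def)
    then have "norm ((u - x0) - x 0 z) \<le> norm ((u - x0) - x 0 z) / 2"
      using lip[OF z _ sx(1)[OF z], of "u - x0"] u(1) sx(2)[OF z] by (simp add: dist_norm norm_minus_commute)
    then have "norm ((u - x0) - x 0 z) = 0" by simp
    then show "u = x0 + x 0 z" by (simp add: algebra_simps)
  qed
qed

text \<open>Solve \<open>\<Psi> x = z\<close> for \<open>x\<close>. The uniqueness clause of the
  implicit function theorem, on a ball around \<open>x0\<close>, shows that the solution is a left
  inverse, and the image of \<open>N\<close> is a full ball.\<close>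

theorem smooth_inverse_function:
  fixes \<Psi> :: "'a::euclidean_space \<Rightarrow> 'a"
  assumes S: "open S" "x0 \<in> S" and \<Psi>: "smooth_on UNIV \<Psi> S" and inj: "inj (frechet_derivative \<Psi> (at x0))"
  obtains N G where "open N" "x0 \<in> N" "N \<subseteq> S" "open (\<Psi> ` N)" "smooth_on UNIV G (\<Psi> ` N)"
    "\<And>x. x \<in> N \<Longrightarrow> G (\<Psi> x) = x"
proof -
  define F where "F p = \<Psi> (snd p) - fst p" for p
  let ?W = "(UNIV :: 'a set) \<times> S"
  have W: "open ?W" "(\<Psi> x0, x0) \<in> ?W" using S by (auto simp: open_Times)
  have F: "smooth_on UNIV F ?W"
  proof -
    have "smooth_on UNIV (\<lambda>p. \<Psi> (snd p)) ?W"
      by (rule smooth_on_compose[OF W(1) S(1) smooth_on_linear[OF W(1) bounded_linear_snd] \<Psi>]) auto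
    from smooth_on_diff[OF W(1) this smooth_on_linear[OF W(1) bounded_linear_fst]]
    show ?thesis by (simp add: F_def[abs_def])
  qed
  have D\<Psi>: "(\<Psi> has_derivative frechet_derivative \<Psi> (at x0)) (at x0)"
    using smooth_on_has_derivative[OF \<Psi> S(2)] .
  note L = has_derivative_linear[OF D\<Psi>]
  obtain R where R: "linear R" "\<And>x. R (frechet_derivative \<Psi> (at x0) x) = x"
    "\<And>x. frechet_derivative \<Psi> (at x0) (R x) = x"
    using linear_injective_isomorphism[OF L inj] by metis
  have "(F has_derivative (\<lambda>h. frechet_derivative \<Psi> (at x0) (snd h) - fst h)) (at (\<Psi> x0, x0))"
    unfolding F_def[abs_def]
  proof (intro has_derivative_diff bounded_linear_imp_has_derivative bounded_linear_fst)
    show "((\<lambda>p. \<Psi> (snd p)) has_derivative (\<lambda>h. frechet_derivative \<Psi> (at x0) (snd h))) (at (\<Psi> x0, x0))"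
      using has_derivative_compose[OF bounded_linear_imp_has_derivative[OF bounded_linear_snd], of \<Psi> _ "(\<Psi> x0, x0)"] D\<Psi>
      by simp
  qed
  then have "R (frechet_derivative F (at (\<Psi> x0, x0)) (0, k)) = k" for k
    using R(2) by (simp add: frechet_derivative_eqI)
  moreover have "v = 0" if "R v = 0" for v
    using R(3)[of v] that linear_0[OF L] by simp
  moreover have "F (\<Psi> x0, x0) = 0" by (simp add: F_def)
  ultimately obtain \<delta> r y where y: "\<delta> > 0" "r > 0" "smooth_on UNIV y (ball (\<Psi> x0) \<delta>)"
    "\<And>z. z \<in> ball (\<Psi> x0) \<delta> \<Longrightarrow> y z \<in> ball x0 r \<and> (z, y z) \<in> ?W \<and> F (z, y z) = 0"
    "\<And>z x. z \<in> ball (\<Psi> x0) \<delta> \<Longrightarrow> x \<in> ball x0 r \<Longrightarrow> F (z, x) = 0 \<Longrightarrow> x = y z"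
    using smooth_implicit_function[OF W F _ R(1)] by blast
  define N where "N = (S \<inter> ball x0 r) \<inter> \<Psi> -` ball (\<Psi> x0) \<delta>"
  have "continuous_on (S \<inter> ball x0 r) \<Psi>"
    using smooth_on_continuous[OF \<Psi>] by (rule continuous_on_subset) auto
  then have oN: "open N" unfolding N_def using S by (intro continuous_open_preimage) auto
  have im: "\<Psi> ` N = ball (\<Psi> x0) \<delta>"
  proof
    show "ball (\<Psi> x0) \<delta> \<subseteq> \<Psi> ` N"
    proof
      fix z assume z: "z \<in> ball (\<Psi> x0) \<delta>"
      then have "\<Psi> (y z) = z" "y z \<in> N" using y(4)[OF z] by (auto simp: F_def N_def)
      then show "z \<in> \<Psi> ` N" by (metis imageI)
    qed
  qed (auto simp: N_def)
  show ?thesis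
  proof (rule that[OF oN])
    show "y (\<Psi> x) = x" if "x \<in> N" for x
      using y(5)[of "\<Psi> x" x] that by (auto simp: N_def F_def)
  qed (use im y S in \<open>auto simp: N_def\<close>)
qed


section \<open>Fields of spectral projections\<close>

lemma smooth_on_matrix_mult:
  "open U \<Longrightarrow> smooth_on UNIV f U \<Longrightarrow> smooth_on UNIV g U \<Longrightarrow>
    smooth_on UNIV (\<lambda>x. f x ** (g x :: real^'k^'n)) U"
  by (rule smooth_on_bilinear[OF _ bounded_bilinear_matrix_mult])

lemma smooth_on_matrix_vector_mult:
  "open U \<Longrightarrow> smooth_on UNIV f U \<Longrightarrow> smooth_on UNIV g U \<Longrightarrow>
    smooth_on UNIV (\<lambda>x. f x *v (g x :: real^'n)) U"
  by (rule smooth_on_bilinear[OF _ bounded_bilinear_matrix_vector_mult])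

text \<open>Inversion near the identity is the implicit function of \<open>M ** X = mat 1\<close>.
  The matrices to be inverted later are \<open>mat 1 + y x\<close> with
  \<open>y x0 = 0\<close>.\<close>

lemma smooth_local_matrix_inverse:
  obtains \<delta> Inv where "\<delta> > 0" "smooth_on UNIV Inv (ball (mat 1 :: real^'n^'n) \<delta>)"
    "\<And>M. M \<in> ball (mat 1) \<delta> \<Longrightarrow> M ** Inv M = mat 1"
proof -
  define F :: "(real^'n^'n) \<times> (real^'n^'n) \<Rightarrow> real^'n^'n" where "F p = fst p ** snd p - mat 1" for p
  have sm: "smooth_on UNIV F UNIV"
    unfolding F_def[abs_def]
    by (intro smooth_on_diff smooth_on_matrix_mult smooth_on_const smooth_on_linear
        bounded_linear_fst bounded_linear_snd open_UNIV)
  have "(F has_derivative (\<lambda>h. mat 1 ** snd h + fst h ** mat 1 - 0)) (at (mat 1, mat 1))"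
    unfolding F_def[abs_def]
    using has_derivative_mm[OF bounded_linear_imp_has_derivative[OF bounded_linear_fst]
        bounded_linear_imp_has_derivative[OF bounded_linear_snd], of "(mat 1, mat 1)" UNIV]
    by (intro has_derivative_diff has_derivative_const) simp
  then have D: "frechet_derivative F (at (mat 1, mat 1)) = (\<lambda>h. snd h + fst h)"
    by (simp add: frechet_derivative_eqI)
  have F0: "F (mat 1, mat 1) = 0" by (simp add: F_def)
  have R: "id (frechet_derivative F (at (mat 1, mat 1)) (0, k)) = k" "id v = 0 \<Longrightarrow> v = 0"
    for k v :: "real^'n^'n"
    by (simp_all add: D)
  obtain \<delta> r y where y: "\<delta> > 0" "r > 0" "smooth_on UNIV y (ball (mat 1 :: real^'n^'n) \<delta>)"
    "\<And>z. z \<in> ball (mat 1) \<delta> \<Longrightarrow> y z \<in> ball (mat 1) r \<and> (z, y z) \<in> UNIV \<and> F (z, y z) = 0"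
    by (rule smooth_implicit_function[OF open_UNIV UNIV_I sm F0 linear_id R], assumption, rule that; assumption)
  show ?thesis
    by (rule that[OF y(1,3)]) (use y(4) in \<open>auto simp: F_def\<close>)
qed

text \<open>\<open>f\<close> vanishes on \<open>ker P\<close> and has values in
  \<open>ker P\<close>, so its matrix is off-diagonal. This form applies to one argument of a
  bilinear map while the other is frozen.\<close>

lemma separatedD:
  assumes sep: "separated L P" and f: "linear f" "\<And>a. P *v f a = 0" "\<And>a. f (P *v a) = f a"
    and com: "\<And>a. L *v f a = f (L *v a)"
  shows "f a = 0"
proof -
  let ?X = "matrix f"
  have X: "?X *v a = f a" for a using fun_cong[OF matrix_vector_mul(2)[OF f(1)]] .
  have 1: "P ** ?X = 0" "?X ** P = ?X" "L ** ?X = ?X ** L"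
    by (simp_all add: matrix_eq X f com flip: matrix_vector_mul_assoc)
  then have "?X = P ** ?X ** (mat 1 - P) + (mat 1 - P) ** ?X ** P"
    by (simp add: matrix_ring_simps)
  then have "?X = 0" using sep 1(3) unfolding separated_def by blast
  then show ?thesis using X[of a] by simp
qed

lemma separated_compl: "separated L P \<Longrightarrow> separated L (mat 1 - P)"
  by (simp add: separated_def add.commute)

context
  fixes L P :: "real^'n^'n"
  assumes sep: "separated L P" and com: "L ** P = P ** L"
begin

text \<open>Bilinear maps from \<open>im P\<close> times \<open>im P\<close> to
  \<open>ker P\<close>, extended by zero. The \<open>ker P\<close>-components of the bracket and of
  the torsions on \<open>im P\<close> are of this kind.\<close>

definition adapted :: "(real^'n \<Rightarrow> real^'n \<Rightarrow> real^'n) \<Rightarrow> bool"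
where
  "adapted S \<longleftrightarrow> (\<forall>b. linear (\<lambda>a. S a b)) \<and> (\<forall>a. linear (S a)) \<and>
     (\<forall>a b. P *v S a b = 0 \<and> S (P *v a) b = S a b \<and> S a (P *v b) = S a b)"

definition left_comm where "left_comm S a b = L *v S a b - S (L *v a) b"
definition right_comm where "right_comm S a b = L *v S a b - S a (L *v b)"

lemma comv: "P *v (L *v x) = L *v (P *v x)"
  by (simp add: matrix_vector_mul_assoc com)

lemma adapted_left_comm: "adapted S \<Longrightarrow> adapted (left_comm S)"
  unfolding adapted_def left_comm_def
  by (auto simp: linear_iff matrix_vector_right_distrib matrix_vector_mult_scaleR scaleR_diff_right
      matrix_vector_mult_diff_distrib comv) (metis comv)

lemma adapted_right_comm: "adapted S \<Longrightarrow> adapted (right_comm S)"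
  unfolding adapted_def right_comm_def
  by (auto simp: linear_iff matrix_vector_right_distrib matrix_vector_mult_scaleR scaleR_diff_right
      matrix_vector_mult_diff_distrib comv) (metis comv)

lemma left_comm_eq_0: "adapted S \<Longrightarrow> (\<And>a b. left_comm S a b = 0) \<Longrightarrow> S a b = 0"
  using separatedD[OF sep, of "\<lambda>a. S a b" a] by (auto simp: adapted_def left_comm_def)

lemma right_comm_eq_0: "adapted S \<Longrightarrow> (\<And>a b. right_comm S a b = 0) \<Longrightarrow> S a b = 0"
  using separatedD[OF sep, of "S a" b] by (auto simp: adapted_def right_comm_def)

text \<open>The \<open>ker P\<close>-component of the Nijenhuis torsion on \<open>im P\<close> is obtained from that of the bracket by
  the operators \<open>left_comm\<close> and \<open>right_comm\<close>, and that of the Haantjes torsion by applying these once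
  more. Both are injective, so that the bracket has no \<open>ker P\<close>-component if \<open>L\<close> is Haantjes.\<close>

lemma haantjes_involutive_at:
  assumes lin: "linear D"
    and DP: "\<And>h. D h ** P + P ** D h = D h" and PP: "P ** P = P"
    and TD: "\<And>h. T h ** P + L ** D h = D h ** L + P ** T h"
    and H: "\<And>a b. haantjes_tensor L T a b = 0"
    and ab: "P *v a = a" "P *v b = b"
  shows "D a *v b = D b *v a"
proof -
  let ?Q = "mat 1 - P"
  \<comment> \<open>At the point, this is the bracket of the two sections of the image distribution
    that are obtained by projecting the constant fields \<open>P *v a\<close> and
    \<open>P *v b\<close>; it lies in \<open>ker P\<close> because
    \<open>P ** D h ** P = 0\<close>.\<close>
  define \<sigma> where "\<sigma> a b = D (P *v a) *v (P *v b) - D (P *v b) *v (P *v a)" for a b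
  have Pv: "P *v (P *v x) = P *v x" for x by (simp add: matrix_vector_mul_assoc PP)
  have PDP: "P *v (D h *v (P *v x)) = 0" for h x
  proof -
    have "(D h ** P + P ** D h) *v (P *v x) = D h *v (P *v x)" by (simp add: DP)
    then show ?thesis
      by (simp add: matrix_vector_mult_add_rdistrib Pv flip: matrix_vector_mul_assoc)
  qed
  have \<sigma>: "adapted \<sigma>"
    unfolding adapted_def \<sigma>_def
    using linear_add[OF lin] linear_cmul[OF lin]
    by (simp add: linear_iff Pv PDP matrix_vector_mult_diff_distrib matrix_vector_mult_add_rdistrib
        matrix_vector_right_distrib matrix_vector_mult_scaleR scaleR_diff_right
        flip: scaleR_matrix_vector_assoc)
  \<comment> \<open>Differentiating \<open>L ** P = P ** L\<close> expresses the
    \<open>ker P\<close>-component of \<open>T h\<close> on \<open>im P\<close> by the commutator of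
    \<open>D h\<close> with \<open>L\<close>. This removes \<open>T\<close> from the
    computation.\<close>
  have QT: "?Q *v (T h *v (P *v x)) = D h *v (L *v (P *v x)) - L *v (D h *v (P *v x))" for h x
  proof -
    have "(T h ** P + L ** D h) *v (P *v x) = (D h ** L + P ** T h) *v (P *v x)" by (simp add: TD)
    then show ?thesis
      by (simp add: matrix_vector_mult_add_rdistrib matrix_vector_mult_diff_rdistrib Pv algebra_simps
          flip: matrix_vector_mul_assoc)
  qed
  have QL: "?Q *v (L *v x) = L *v (?Q *v x)" for x
    by (simp add: matrix_vector_mult_diff_rdistrib matrix_vector_mult_diff_distrib comv)
  have lin2: "M *v (x + y) = M *v x + M *v y" "M *v (x - y) = M *v x - M *v y" for M :: "real^'n^'n" and x y
    by (simp_all add: matrix_vector_right_distrib matrix_vector_mult_diff_distrib)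
  define n where "n a b = ?Q *v nijenhuis_tensor L T (P *v a) (P *v b)" for a b
  have n: "n = left_comm (right_comm \<sigma>)"
  proof (intro ext)
    fix a b
    have "n a b = ?Q *v (T (L *v (P *v a)) *v (P *v b)) - ?Q *v (T (L *v (P *v b)) *v (P *v a))
      - L *v (?Q *v (T (P *v a) *v (P *v b))) + L *v (?Q *v (T (P *v b) *v (P *v a)))"
      unfolding n_def nijenhuis_tensor_def by (simp only: lin2 QL)
    then show "n a b = left_comm (right_comm \<sigma>) a b"
      unfolding left_comm_def right_comm_def \<sigma>_def QT by (simp add: lin2 comv)
  qed
  have "?Q *v haantjes_tensor L T (P *v a) (P *v b) = left_comm (right_comm n) a b" for a b
    unfolding haantjes_tensor_def left_comm_def right_comm_def n_def
    by (simp only: lin2 QL comv[symmetric]) (simp add: algebra_simps)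
  then have "left_comm (right_comm (left_comm (right_comm \<sigma>))) a b = 0" for a b
    by (simp add: H flip: n)
  then have "\<sigma> a b = 0"
  proof -
    note 1 = adapted_right_comm[OF \<sigma>]
    note 2 = adapted_left_comm[OF 1]
    note 3 = adapted_right_comm[OF 2]
    assume "\<And>a b. left_comm (right_comm (left_comm (right_comm \<sigma>))) a b = 0"
    from right_comm_eq_0[OF \<sigma> left_comm_eq_0[OF 1 right_comm_eq_0[OF 2 left_comm_eq_0[OF 3 this]]]]
    show ?thesis .
  qed
  then show ?thesis by (simp add: \<sigma>_def ab)
qed

end

lemma derivative_of_commuting:
  fixes L P :: "real^'m \<Rightarrow> real^'n^'n"
  assumes N: "open N" "x \<in> N" and eq: "\<And>y. y \<in> N \<Longrightarrow> L y ** P y = P y ** L y"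
    and D: "(L has_derivative T) (at x)" "(P has_derivative D) (at x)"
  shows "T h ** P x + L x ** D h = D h ** L x + P x ** T h"
proof -
  have "((\<lambda>y. L y ** P y) has_derivative (\<lambda>h. P x ** T h + D h ** L x)) (at x)"
    by (rule has_derivative_transform_within_open[OF has_derivative_mm[OF D(2,1)] N]) (simp add: eq)
  from fun_cong[OF has_derivative_unique[OF this has_derivative_mm[OF D]], of h] show ?thesis
    by (simp add: add.commute)
qed

lemma derivative_of_idempotent:
  fixes P :: "real^'m \<Rightarrow> real^'n^'n"
  assumes N: "open N" "x \<in> N" and eq: "\<And>y. y \<in> N \<Longrightarrow> P y ** P y = P y"
    and D: "(P has_derivative D) (at x)"
  shows "D h ** P x + P x ** D h = D h"
proof -
  have "(P has_derivative (\<lambda>h. P x ** D h + D h ** P x)) (at x)"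
    by (rule has_derivative_transform_within_open[OF has_derivative_mm[OF D D] N]) (simp add: eq)
  from fun_cong[OF has_derivative_unique[OF this D], of h] show ?thesis
    by (simp add: add.commute)
qed

section \<open>Block diagonal and off-diagonal matrices\<close>

definition block_diagonal :: "real^'n^'n \<Rightarrow> real^'n^'n \<Rightarrow> bool"
where
  "block_diagonal P M \<longleftrightarrow> P ** M = M ** P"

text \<open>For a projection \<open>P\<close> this is equivalent to the vanishing of both diagonal
  blocks, \<open>P ** M ** P\<close> and its analogue for \<open>mat 1 - P\<close>.\<close>

definition off_diagonal :: "real^'n^'n \<Rightarrow> real^'n^'n \<Rightarrow> bool"
where
  "off_diagonal P M \<longleftrightarrow> P ** M + M ** P = M"

definition off_part :: "real^'n^'n \<Rightarrow> real^'n^'n \<Rightarrow> real^'n^'n"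
where
  "off_part P X = P ** X ** (mat 1 - P) + (mat 1 - P) ** X ** P"

lemma off_diagonalD: "off_diagonal P M \<Longrightarrow> P ** M = M - M ** P"
  by (simp add: off_diagonal_def eq_diff_eq)

text \<open>Block diagonal and off-diagonal matrices behave as the even and the odd part of a
  grading modulo two. These rules give the parity of every term of the Riccati equation.\<close>

lemma block_off_mult:
  "block_diagonal P M \<Longrightarrow> off_diagonal P X \<Longrightarrow> off_diagonal P (M ** X)"
  "block_diagonal P M \<Longrightarrow> off_diagonal P X \<Longrightarrow> off_diagonal P (X ** M)"
  "off_diagonal P X \<Longrightarrow> off_diagonal P Y \<Longrightarrow> block_diagonal P (X ** Y)"
  "block_diagonal P M \<Longrightarrow> block_diagonal P M' \<Longrightarrow> block_diagonal P (M ** M')"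
proof -
  assume M: "block_diagonal P M"
  show "block_diagonal P (M ** M')" if "block_diagonal P M'"
    using M that unfolding block_diagonal_def by (metis matrix_mul_assoc)
  assume X: "off_diagonal P X"
  have "P ** (M ** X) = M ** (P ** X)"
    using M unfolding block_diagonal_def by (simp add: matrix_mul_assoc)
  then show "off_diagonal P (M ** X)"
    by (simp add: off_diagonal_def off_diagonalD[OF X] matrix_ring_simps)
  have "P ** (X ** M) = (X - X ** P) ** M"
    by (simp add: matrix_mul_assoc off_diagonalD[OF X])
  also have "\<dots> = X ** M - X ** (P ** M)" by (simp add: matrix_diff_rdistrib matrix_mul_assoc)
  also have "P ** M = M ** P" using M by (simp add: block_diagonal_def)
  finally show "off_diagonal P (X ** M)"
    by (simp add: off_diagonal_def matrix_mul_assoc)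
next
  assume X: "off_diagonal P X" and Y: "off_diagonal P Y"
  have "P ** (X ** Y) = (X - X ** P) ** Y"
    by (simp add: matrix_mul_assoc off_diagonalD[OF X])
  also have "\<dots> = X ** Y - X ** (P ** Y)" by (simp add: matrix_diff_rdistrib matrix_mul_assoc)
  also have "\<dots> = X ** Y ** P" by (simp add: off_diagonalD[OF Y] matrix_diff_ldistrib matrix_mul_assoc)
  finally show "block_diagonal P (X ** Y)" by (simp add: block_diagonal_def)
qed

lemma block_off_add:
  "block_diagonal P X \<Longrightarrow> block_diagonal P Y \<Longrightarrow> block_diagonal P (X + Y)"
  "block_diagonal P X \<Longrightarrow> block_diagonal P Y \<Longrightarrow> block_diagonal P (X - Y)"
  "off_diagonal P X \<Longrightarrow> off_diagonal P Y \<Longrightarrow> off_diagonal P (X + Y)"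
  "off_diagonal P X \<Longrightarrow> off_diagonal P Y \<Longrightarrow> off_diagonal P (X - Y)"
  by (auto simp: block_diagonal_def off_diagonal_def matrix_ring_simps algebra_simps)

context
  fixes P :: "real^'n^'n"
  assumes PP: "P ** P = P"
begin

lemma idem_assoc: "M ** P ** P = M ** P"
  by (simp add: PP flip: matrix_mul_assoc)

lemma off_part_mult:
  "P ** off_part P X = P ** X - P ** X ** P" "off_part P X ** P = X ** P - P ** X ** P"
  and off_part_eq: "off_part P X = P ** X - P ** X ** P + (X ** P - P ** X ** P)"
proof -
  show e: "off_part P X = P ** X - P ** X ** P + (X ** P - P ** X ** P)"
    by (simp only: off_part_def matrix_diff_ldistrib matrix_diff_rdistrib matrix_mul_assoc
        matrix_mul_lid matrix_mul_rid)
  show "P ** off_part P X = P ** X - P ** X ** P" "off_part P X ** P = X ** P - P ** X ** P"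
    unfolding e
    by (simp_all only: matrix_add_ldistrib matrix_add_rdistrib matrix_diff_ldistrib matrix_diff_rdistrib
        matrix_mul_assoc PP idem_assoc) simp_all
qed

lemma off_diagonal_off_part: "off_diagonal P (off_part P X)"
  unfolding off_diagonal_def off_part_mult by (simp only: off_part_eq)

lemma block_diagonal_off_part: "block_diagonal P (X - off_part P X)"
  unfolding block_diagonal_def by (simp add: matrix_diff_ldistrib matrix_diff_rdistrib off_part_mult)

lemma off_block_add_eq_0:
  assumes "off_diagonal P A" "block_diagonal P B" "A + B = 0"
  shows "A = 0" "B = 0"
proof -
  have "P ** A + P ** B = 0" using assms(3) by (metis matrix_add_ldistrib times0_right)
  moreover have "A ** P + B ** P = 0" using assms(3) by (metis matrix_add_rdistrib times0_left)
  ultimately have "P ** A = A ** P" using assms(2) by (simp add: block_diagonal_def add_eq_0_iff2)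
  then have A: "A = P ** A + P ** A" using assms(1) by (simp add: off_diagonal_def)
  have "P ** A = P ** (P ** A + P ** A)" using arg_cong[OF A] .
  also have "\<dots> = P ** A + P ** A" by (simp only: matrix_add_ldistrib matrix_mul_assoc PP)
  finally have "P ** A = 0" by simp
  then show "A = 0" using A by simp
  then show "B = 0" using assms(3) by simp
qed

lemma off_part_block:
  assumes "block_diagonal P X" shows "off_part P X = 0"
proof -
  have "block_diagonal P (X - off_part P X - X)" using block_diagonal_off_part assms by (rule block_off_add)
  then show ?thesis
    using off_block_add_eq_0(1)[OF off_diagonal_off_part, of _ X] by force
qed

end

lemma off_part_linear: "off_part P (X + Y) = off_part P X + off_part P Y"
  "off_part P (c *\<^sub>R X) = c *\<^sub>R off_part P X"
  by (simp_all add: off_part_def matrix_ring_simps scaleR_add_right scaleR_diff_right)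

text \<open>Separation amounts to the injectivity of this linear map, which is an open condition.\<close>

definition sylvester :: "real^'n^'n \<Rightarrow> real^'n^'n \<Rightarrow> real^'n^'n \<Rightarrow> real^'n^'n"
where
  "sylvester L P X = L ** off_part P X - off_part P X ** L + (X - off_part P X)"

lemma linear_sylvester: "linear (sylvester L P)"
  by (rule linearI) (simp_all add: sylvester_def off_part_linear matrix_ring_simps scaleR_add_right scaleR_diff_right)

text \<open>The commutator of \<open>L\<close> with an off-diagonal matrix is off-diagonal and the
  added term is block diagonal, so both vanish. Then \<open>X\<close> is off-diagonal and commutes
  with \<open>L\<close>.\<close>

lemma sylvester_eq_0:
  assumes PP: "P ** P = P" and com: "L ** P = P ** L" and sep: "separated L P" and X: "sylvester L P X = 0"
  shows "X = 0"
proof -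
  have b: "block_diagonal P L" using com by (simp add: block_diagonal_def)
  have "off_diagonal P (L ** off_part P X - off_part P X ** L)"
    using block_off_mult(1,2)[OF b off_diagonal_off_part[OF PP]] by (intro block_off_add)
  from off_block_add_eq_0[OF PP this block_diagonal_off_part[OF PP]] X
  have "L ** off_part P X = off_part P X ** L" "X = off_part P X"
    by (auto simp: sylvester_def)
  then have "L ** X = X ** L" "X = P ** X ** (mat 1 - P) + (mat 1 - P) ** X ** P"
    unfolding off_part_def by metis+
  then show "X = 0" using sep unfolding separated_def by blast
qed

text \<open>At \<open>x0\<close> the norm of the Sylvester operator has a positive minimum on the
  unit sphere. \<open>uniform_near_curve\<close>, with the sphere as parameter set and the constant
  curve \<open>x0\<close>, gives a neighbourhood on which it stays positive.\<close>

lemma separated_open: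
  fixes L P :: "real^'m \<Rightarrow> real^'n^'n"
  assumes N: "open N" "x0 \<in> N" and c: "continuous_on N L" "continuous_on N P"
    and sep: "separated (L x0) (P x0)" and PP: "P x0 ** P x0 = P x0" and com: "L x0 ** P x0 = P x0 ** L x0"
  obtains N' where "open N'" "x0 \<in> N'" "N' \<subseteq> N" "\<And>x. x \<in> N' \<Longrightarrow> separated (L x) (P x)"
proof -
  define F where "F X x = sylvester (L x) (P x) X" for X x
  note mc = bounded_bilinear.continuous_on[OF bounded_bilinear_matrix_mult]
  let ?K = "sphere (0 :: real^'n^'n) 1"
  have cL: "continuous_on (?K \<times> N) (\<lambda>p. L (snd p))" "continuous_on (?K \<times> N) (\<lambda>p. P (snd p))"
    by (rule continuous_on_compose2[OF c(1)] continuous_on_compose2[OF c(2)]; auto intro!: continuous_intros)+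
  have Fc: "continuous_on (?K \<times> N) (\<lambda>p. F (fst p) (snd p))"
    unfolding F_def sylvester_def off_part_def by (intro continuous_intros mc cL)
  have "continuous_on ?K (\<lambda>X. norm (F X x0))"
    by (rule continuous_on_norm) (rule continuous_on_compose2[OF Fc, of ?K "\<lambda>X. (X, x0)", simplified],
      use N in \<open>auto intro!: continuous_intros\<close>)
  then obtain X0 where X0: "X0 \<in> ?K" "\<And>X. X \<in> ?K \<Longrightarrow> norm (F X0 x0) \<le> norm (F X x0)"
    using continuous_attains_inf[of ?K "\<lambda>X. norm (F X x0)"] by auto
  have "F X0 x0 \<noteq> 0" using sylvester_eq_0[OF PP com sep, of X0] X0(1) by (auto simp: F_def)
  then have "norm (F X0 x0) > 0" by simp
  obtain d where d: "d > 0" "\<And>X x. X \<in> ?K \<Longrightarrow> dist x x0 < d \<Longrightarrow> x \<in> N \<and> dist (F X x) (F X x0) < norm (F X0 x0)"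
    by (rule uniform_near_curve[OF compact_sphere continuous_on_const N(1) N(2) Fc \<open>norm (F X0 x0) > 0\<close>])
      (rule that; assumption)
  show ?thesis
  proof (rule that[of "ball x0 d"])
    show "ball x0 d \<subseteq> N" using d(2)[OF X0(1)] by (auto simp: dist_commute)
    fix x assume x: "x \<in> ball x0 d"
    show "separated (L x) (P x)"
      unfolding separated_def
    proof (intro allI impI, elim conjE, rule ccontr)
      fix X assume X: "L x ** X = X ** L x" "X = P x ** X ** (mat 1 - P x) + (mat 1 - P x) ** X ** P x" "X \<noteq> 0"
      let ?Y = "(1 / norm X) *\<^sub>R X"
      have "off_part (P x) X = X" using X(2) by (simp add: off_part_def)
      then have "sylvester (L x) (P x) X = 0" by (simp add: sylvester_def X(1))
      then have "F ?Y x = 0" by (simp add: F_def linear_cmul[OF linear_sylvester])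
      moreover have "?Y \<in> ?K" using X(3) by simp
      ultimately show False using d(2)[of ?Y x] X0(2)[of ?Y] x by (simp add: dist_commute dist_norm)
    qed
  qed (use d in auto)
qed

text \<open>An off-diagonal \<open>X\<close> is sought such that conjugation by
  \<open>mat 1 + X\<close> makes \<open>L\<close> commute with \<open>P0\<close>. This is a Riccati
  equation for \<open>X\<close>, whose linearisation at \<open>x0\<close> is the Sylvester operator.
  The last conclusion records that the rank of the projections is constant.\<close>

proposition spectral_projection_field:
  fixes L :: "real^'n \<Rightarrow> real^'n^'n"
  assumes S: "open S" "x0 \<in> S" and L: "smooth_on UNIV L S"
    and PP: "P0 ** P0 = P0" and com: "L x0 ** P0 = P0 ** L x0" and sep: "separated (L x0) P0"
  obtains N P where "open N" "x0 \<in> N" "N \<subseteq> S" "smooth_on UNIV P N" "P x0 = P0"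
    "\<And>x. x \<in> N \<Longrightarrow> P x ** P x = P x" "\<And>x. x \<in> N \<Longrightarrow> L x ** P x = P x ** L x"
    "\<And>x. x \<in> N \<Longrightarrow> \<exists>R R'. R ** R' = mat 1 \<and> R' ** R = mat 1 \<and> P x = R ** P0 ** R'"
proof -
  define off where "off = off_part P0"
  define E where "E x X = off (L x) + (L x - off (L x)) ** off X - off X ** (L x - off (L x))
    - off X ** off (L x) ** off X" for x X
  \<comment> \<open>Adding the block diagonal part of the unknown makes the linearisation invertible
    on all matrices. As \<open>E\<close> is off-diagonal, both summands vanish at a zero of
    \<open>F\<close>.\<close>
  define F where "F p = E (fst p) (snd p) + (snd p - off (snd p))" for p :: "(real^'n) \<times> (real^'n^'n)"
  note offP = off_diagonal_off_part[OF PP, folded off_def] and blockP = block_diagonal_off_part[OF PP, folded off_def]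
  have boff: "bounded_linear off"
    unfolding off_def by (rule linear_linear[THEN iffD2, OF linearI]) (simp_all add: off_part_linear)
  let ?W = "S \<times> (UNIV :: (real^'n^'n) set)"
  have W: "open ?W" "(x0, 0) \<in> ?W" using S by (auto simp: open_Times)
  have sL: "smooth_on UNIV (\<lambda>p. L (fst p)) ?W"
    by (rule smooth_on_compose[OF W(1) S(1) smooth_on_linear[OF W(1) bounded_linear_fst] L]) auto
  note soL = smooth_on_bounded_linear[OF W(1) boff sL]
  have sX: "smooth_on UNIV snd ?W" by (rule smooth_on_linear[OF W(1) bounded_linear_snd])
  note soX = smooth_on_bounded_linear[OF W(1) boff sX]
  have sF: "smooth_on UNIV F ?W"
    unfolding F_def[abs_def] E_def
    by (intro smooth_on_diff[OF W(1)] smooth_on_add[OF W(1)] smooth_on_matrix_mult[OF W(1)] sL soL sX soX)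
  have oL0: "off (L x0) = 0"
    unfolding off_def by (rule off_part_block[OF PP]) (simp add: block_diagonal_def com)
  have off0: "off 0 = 0" by (simp add: off_def off_part_def)
  have F0: "F (x0, 0) = 0" by (simp add: F_def E_def oL0 off0)
  have DF: "frechet_derivative F (at (x0, 0)) (0, k) = sylvester (L x0) P0 k" for k
  proof -
    have "(F has_derivative frechet_derivative F (at (x0, 0))) (at (x0, 0))"
      using smooth_on_has_derivative[OF sF W(2)] .
    moreover have "((\<lambda>X. (x0, X)) has_derivative (\<lambda>k. (0, k))) (at 0)"
      by (auto intro!: derivative_eq_intros)
    ultimately have "((\<lambda>X. F (x0, X)) has_derivative (\<lambda>k. frechet_derivative F (at (x0, 0)) (0, k))) (at 0)"
      using has_derivative_compose by fastforce
    moreover have "F (x0, X) = sylvester (L x0) P0 X" for X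
      by (simp add: F_def E_def oL0 sylvester_def flip: off_def)
    moreover have "(sylvester (L x0) P0 has_derivative sylvester (L x0) P0) (at 0)"
      using linear_sylvester linear_conv_bounded_linear bounded_linear_imp_has_derivative by blast
    ultimately have "(\<lambda>k. frechet_derivative F (at (x0, 0)) (0, k)) = sylvester (L x0) P0"
      using has_derivative_unique by auto
    then show ?thesis by (rule fun_cong)
  qed
  have "inj (sylvester (L x0) P0)"
    using linear_injective_0[OF linear_sylvester] sylvester_eq_0[OF PP com sep] by blast
  then obtain R where R: "linear R" "\<And>X. R (sylvester (L x0) P0 X) = X" "\<And>X. sylvester (L x0) P0 (R X) = X"
    using linear_injective_isomorphism[OF linear_sylvester] by metis
  have R0: "X = 0" if "R X = 0" for X
    using R(3)[of X] that linear_0[OF linear_sylvester, of "L x0" P0] by simp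
  have RD: "R (frechet_derivative F (at (x0, 0)) (0, k)) = k" for k
    by (simp add: DF R(2))
  obtain \<delta> r y where y: "\<delta> > 0" "r > 0" "smooth_on UNIV y (ball x0 \<delta>)"
    "\<And>z. z \<in> ball x0 \<delta> \<Longrightarrow> y z \<in> ball 0 r \<and> (z, y z) \<in> ?W \<and> F (z, y z) = 0"
    "\<And>z x. z \<in> ball x0 \<delta> \<Longrightarrow> x \<in> ball 0 r \<Longrightarrow> F (z, x) = 0 \<Longrightarrow> x = y z"
    by (rule smooth_implicit_function[OF W sF F0 R(1) RD R0], assumption, rule that; assumption)
  have y0: "y x0 = 0" using y(5)[OF _ _ F0] y(1,2) by simp
  obtain \<epsilon> Inv where Inv: "\<epsilon> > 0" "smooth_on UNIV Inv (ball (mat 1 :: real^'n^'n) \<epsilon>)"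
    "\<And>M. M \<in> ball (mat 1) \<epsilon> \<Longrightarrow> M ** Inv M = mat 1"
    by (rule smooth_local_matrix_inverse, rule that; assumption)
  define s where "s x = mat 1 + y x" for x
  have ss: "smooth_on UNIV s (ball x0 \<delta>)"
    unfolding s_def[abs_def] by (intro smooth_on_add smooth_on_const y open_ball)
  define N where "N = ball x0 \<delta> \<inter> s -` ball (mat 1) \<epsilon>"
  have oN: "open N"
    unfolding N_def by (rule continuous_open_preimage[OF smooth_on_continuous[OF ss]]) auto
  have NS: "N \<subseteq> S" "x0 \<in> N" using y(4) y(1) Inv(1) by (auto simp: N_def s_def y0)
  have sN: "smooth_on UNIV s N" using smooth_on_subset[OF ss open_ball oN] by (auto simp: N_def)
  define P where "P x = s x ** P0 ** Inv (s x)" for x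
  have inv: "s x ** Inv (s x) = mat 1" "Inv (s x) ** s x = mat 1" if "x \<in> N" for x
    using Inv(3)[of "s x"] that by (auto simp: N_def matrix_left_right_inverse)
  have sInv: "smooth_on UNIV (\<lambda>x. Inv (s x)) N"
    by (rule smooth_on_compose[OF oN open_ball sN Inv(2)]) (auto simp: N_def)
  have "smooth_on UNIV P N"
    unfolding P_def[abs_def] by (intro smooth_on_matrix_mult smooth_on_const oN sN sInv)
  moreover have "P x0 = P0"
    using inv[OF NS(2)] by (simp add: P_def s_def y0)
  moreover have "P x ** P x = P x" if x: "x \<in> N" for x
  proof -
    have "P x ** P x = s x ** P0 ** (Inv (s x) ** s x) ** P0 ** Inv (s x)"
      by (simp add: P_def matrix_mul_assoc)
    also have "\<dots> = s x ** (P0 ** P0) ** Inv (s x)"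
      by (simp add: inv[OF x] matrix_mul_assoc)
    finally show ?thesis by (simp add: PP P_def)
  qed
  moreover have "L x ** P x = P x ** L x" if x: "x \<in> N" for x
  proof -
    have Fx: "F (x, y x) = 0" using y(4) x by (auto simp: N_def)
    let ?X = "y x" and ?D = "L x - off (L x)"
    have "off_diagonal P0 (E x ?X)"
      unfolding E_def by (intro block_off_add offP block_off_mult blockP)
    then have "E x ?X = 0" "?X - off ?X = 0"
      using off_block_add_eq_0[OF PP _ blockP, of "E x ?X" ?X] Fx by (auto simp: F_def)
    then have E0: "E x ?X = 0" and oX: "off ?X = ?X" by auto
    \<comment> \<open>\<open>M\<close> is \<open>L\<close> in the moved frame: expanding
      \<open>L x ** s x - s x ** M\<close> leaves exactly \<open>E x ?X\<close>.\<close>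
    define M where "M = ?D + off (L x) ** ?X"
    have LS: "L x ** s x = s x ** M"
      using E0 unfolding E_def oX by (simp add: s_def M_def matrix_ring_simps algebra_simps)
    have "off_diagonal P0 ?X" using offP[of ?X] by (simp add: oX)
    then have "block_diagonal P0 M"
      unfolding M_def by (intro block_off_add block_off_mult offP blockP)
    then have MP: "M ** P0 = P0 ** M" by (simp add: block_diagonal_def)
    have LI: "Inv (s x) ** L x = M ** Inv (s x)"
    proof -
      have "Inv (s x) ** L x = Inv (s x) ** (L x ** s x) ** Inv (s x)"
        by (simp add: inv[OF x] flip: matrix_mul_assoc)
      also have "\<dots> = (Inv (s x) ** s x) ** M ** Inv (s x)" by (simp add: LS matrix_mul_assoc)
      finally show ?thesis by (simp add: inv[OF x])
    qed
    have "L x ** P x = s x ** (M ** P0) ** Inv (s x)"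
      by (simp add: P_def matrix_mul_assoc LS)
    also have "\<dots> = s x ** P0 ** (Inv (s x) ** L x)"
      by (simp add: MP LI matrix_mul_assoc)
    finally show ?thesis by (simp add: P_def matrix_mul_assoc)
  qed
  moreover have "\<exists>R R'. R ** R' = mat 1 \<and> R' ** R = mat 1 \<and> P x = R ** P0 ** R'" if "x \<in> N" for x
    using inv[OF that] by (auto simp: P_def)
  ultimately show ?thesis using that[OF oN NS(2,1)] by blast
qed


section \<open>Integrable distributions\<close>

text \<open>Gronwall argument: \<open>exp (- (2 * C * t))\<close> times the squared norm of
  \<open>V\<close> does not increase and starts at zero.\<close>

lemma linear_ode_zero:
  fixes V :: "real \<Rightarrow> 'a::euclidean_space"
  assumes V: "\<And>t. t \<in> {0..1} \<Longrightarrow> (V has_vector_derivative V' t) (at t within {0..1})"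
    and le: "\<And>t. t \<in> {0..1} \<Longrightarrow> norm (V' t) \<le> C * norm (V t)" and V0: "V 0 = 0" and t: "t \<in> {0..1}"
  shows "V t = 0"
proof -
  define \<phi> where "\<phi> t = exp (- (2 * C * t)) * (V t \<bullet> V t)" for t
  have d: "(\<phi> has_real_derivative exp (- (2 * C * s)) * (2 * (V s \<bullet> V' s) - 2 * C * (V s \<bullet> V s))) (at s within {0..1})"
    if "s \<in> {0..1}" for s
  proof -
    have "((\<lambda>t. V t \<bullet> V t) has_real_derivative (V s \<bullet> V' s + V' s \<bullet> V s)) (at s within {0..1})"
      using has_derivative_inner[OF V[OF that, unfolded has_vector_derivative_def] V[OF that, unfolded has_vector_derivative_def]]
      by (simp add: has_field_derivative_def algebra_simps inner_commute[of "V' s"] mult_commute_abs)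
    then show ?thesis
      unfolding \<phi>_def by (auto intro!: derivative_eq_intros simp: algebra_simps inner_commute[of "V' s"])
  qed
  have "\<phi> t \<le> \<phi> 0"
  proof -
    have sub: "{0..t} \<subseteq> {0..1}" using t by auto
    show ?thesis
    proof (rule DERIV_nonpos_imp_decreasing_open[where f = \<phi> and a = 0 and b = t])
      show "0 \<le> t" using t by simp
      show "continuous_on {0..t} \<phi>"
        by (rule continuous_on_subset[OF DERIV_continuous_on[OF d] sub])
      fix s assume s: "0 < s" "s < t"
      then have s': "s \<in> {0..1}" using t by simp
      have "at s within {0..1} = at s" using s t by (intro at_within_interior) auto
      then have "(\<phi> has_real_derivative exp (- (2 * C * s)) * (2 * (V s \<bullet> V' s) - 2 * C * (V s \<bullet> V s))) (at s)"
        using d[OF s'] by simp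
      moreover have "V s \<bullet> V' s \<le> C * (V s \<bullet> V s)"
      proof -
        have "V s \<bullet> V' s \<le> norm (V s) * norm (V' s)" by (rule norm_cauchy_schwarz)
        also have "\<dots> \<le> norm (V s) * (C * norm (V s))" using le[OF s'] by (intro mult_left_mono) auto
        also have "\<dots> = C * (V s \<bullet> V s)" by (simp add: power2_norm_eq_inner[symmetric] power2_eq_square)
        finally show ?thesis .
      qed
      ultimately show "\<exists>y. (\<phi> has_real_derivative y) (at s) \<and> y \<le> 0"
        by (intro exI conjI) (auto simp: mult_le_0_iff)
    qed
  qed
  then have "V t \<bullet> V t \<le> 0" by (simp add: \<phi>_def V0 mult_le_0_iff)
  then show ?thesis using inner_ge_zero[of "V t"] inner_eq_zero_iff[of "V t"] by linarith
qed

lemma linear_basis_bound: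
  fixes B :: "'t \<Rightarrow> 'a::euclidean_space \<Rightarrow> 'b::real_normed_vector"
  assumes lin: "\<And>t. t \<in> T \<Longrightarrow> linear (B t)" and b: "\<And>i. i \<in> Basis \<Longrightarrow> bounded ((\<lambda>t. B t i) ` T)"
  obtains C where "\<And>t v. t \<in> T \<Longrightarrow> norm (B t v) \<le> C * norm v"
proof -
  have "\<forall>i\<in>Basis. \<exists>C. \<forall>t\<in>T. norm (B t i) \<le> C" using b by (auto simp: bounded_iff)
  from bchoice[OF this] obtain C where C: "\<And>i t. i \<in> Basis \<Longrightarrow> t \<in> T \<Longrightarrow> norm (B t i) \<le> C i" by blast
  have "norm (B t v) \<le> (\<Sum>i\<in>Basis. C i) * norm v" if t: "t \<in> T" for t v
  proof -
    have "B t v = B t (\<Sum>i\<in>Basis. (v \<bullet> i) *\<^sub>R i)" by (simp add: euclidean_representation)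
    also have "\<dots> = (\<Sum>i\<in>Basis. (v \<bullet> i) *\<^sub>R B t i)"
      by (simp only: linear_sum[OF lin[OF t]] linear_cmul[OF lin[OF t]] o_def)
    also have "norm \<dots> \<le> (\<Sum>i\<in>Basis. norm v * C i)"
    proof (rule sum_norm_le)
      fix i :: 'a assume i: "i \<in> Basis"
      have "norm ((v \<bullet> i) *\<^sub>R B t i) = \<bar>v \<bullet> i\<bar> * norm (B t i)" by simp
      also have "\<dots> \<le> norm v * C i"
        by (rule mult_mono[OF Basis_le_norm[OF i] C[OF i t]]) auto
      finally show "norm ((v \<bullet> i) *\<^sub>R B t i) \<le> norm v * C i" .
    qed
    finally show ?thesis by (simp add: sum_distrib_left mult.commute)
  qed
  then show ?thesis using that by blast
qed

lemma smooth_on_derivative_apply: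
  fixes f :: "'a::euclidean_space \<Rightarrow> 'b::real_normed_vector"
  assumes S: "open S" and f: "smooth_on UNIV f S" and v: "smooth_on UNIV v S"
  shows "smooth_on UNIV (\<lambda>x. frechet_derivative f (at x) (v x)) S"
proof -
  have "Ck_family (UNIV :: real set) S m (\<lambda>_ x. \<Sum>i\<in>Basis. (v x \<bullet> i) *\<^sub>R frechet_derivative f (at x) i)" for m
    by (intro Ck_family_sum[OF S] Ck_family_bilinear[OF bounded_bilinear_scaleR S]
        smooth_on_family[OF S smooth_on_derivative[OF f]]
        Ck_family_bounded_linear[OF bounded_linear_inner_left S] smooth_on_family[OF S v])
  then have s: "smooth_on UNIV (\<lambda>x. \<Sum>i\<in>Basis. (v x \<bullet> i) *\<^sub>R frechet_derivative f (at x) i) S"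
    using smooth_onI_family[OF S] by blast
  show ?thesis
  proof (rule smooth_on_cong[OF S s])
    fix x assume x: "x \<in> S"
    note L = has_derivative_linear[OF smooth_on_has_derivative[OF f x]]
    have "frechet_derivative f (at x) (\<Sum>i\<in>Basis. (v x \<bullet> i) *\<^sub>R i) =
        (\<Sum>i\<in>Basis. (v x \<bullet> i) *\<^sub>R frechet_derivative f (at x) i)"
      by (simp only: linear_sum[OF L] linear_cmul[OF L] o_def)
    then show "(\<Sum>i\<in>Basis. (v x \<bullet> i) *\<^sub>R frechet_derivative f (at x) i) = frechet_derivative f (at x) (v x)"
      by (simp only: euclidean_representation)
  qed
qed

text \<open>Joining \<open>x0 + Q0 z\<close> to \<open>\<Psi> z\<close> by the curve \<open>\<gamma>\<close> with \<open>\<gamma>' = P(\<gamma>) (P0 z)\<close> produces a local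
  diffeomorphism \<open>\<Psi>\<close> that carries the parallel copies of \<open>im P0\<close> to integral manifolds of \<open>im P\<close>:
  involutivity makes the \<open>ker P\<close>-component of a variation of \<open>\<gamma>\<close> in the direction of \<open>im P0\<close> solve a
  homogeneous linear equation.\<close>

proposition frobenius_submersion:
  fixes P :: "real^'n \<Rightarrow> real^'n^'n"
  assumes S: "open S" "x0 \<in> S" and P: "smooth_on UNIV P S"
    and PP: "\<And>x. x \<in> S \<Longrightarrow> P x ** P x = P x"
    and conj: "\<And>x. x \<in> S \<Longrightarrow> \<exists>R R'. R ** R' = mat 1 \<and> R' ** R = mat 1 \<and> P x = R ** P x0 ** R'"
    and invol: "\<And>x a b. x \<in> S \<Longrightarrow> P x *v a = a \<Longrightarrow> P x *v b = b \<Longrightarrow>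
      frechet_derivative P (at x) a *v b = frechet_derivative P (at x) b *v a"
  obtains N g where "open N" "x0 \<in> N" "N \<subseteq> S" "smooth_on UNIV g N"
    "\<And>x a. x \<in> N \<Longrightarrow> frechet_derivative g (at x) (P x *v a) = 0"
    "\<And>x a. x \<in> N \<Longrightarrow> P x0 *v frechet_derivative g (at x) a = 0"
    "\<And>a. frechet_derivative g (at x0) a = (mat 1 - P x0) *v a"
proof -
  define P0 where "P0 = P x0"
  define Q0 where "Q0 = mat 1 - P0"
  define DP where "DP x = frechet_derivative P (at x)" for x
  have PP0: "P0 ** P0 = P0" using PP S by (simp add: P0_def)
  have QP0: "Q0 ** P0 = 0" "P0 ** Q0 = 0" by (simp_all add: Q0_def matrix_ring_simps PP0)
  have DP: "(P has_derivative DP x) (at x)" if "x \<in> S" for x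
    unfolding DP_def using smooth_on_has_derivative[OF P that] .
  have linDP: "linear (DP x)" if "x \<in> S" for x using has_derivative_linear[OF DP[OF that]] .
  have DPP: "DP x h ** P x + P x ** DP x h = DP x h" if "x \<in> S" for x h
    using derivative_of_idempotent[OF S(1) that PP DP[OF that]] .
  \<comment> \<open>The unknown \<open>snd p\<close> is the displacement of the curve from
    \<open>x0 + Q0 *v z\<close>. The factor \<open>P0 *v z\<close> in \<open>g\<close> vanishes at
    \<open>z = 0\<close>, which provides both vanishing hypotheses of
    \<open>smooth_fixed_point\<close>.\<close>
  define c where "c p = x0 + Q0 *v fst p + snd p" for p :: "(real^'n) \<times> (real^'n)"
  define g where "g p = P (c p) *v (P0 *v fst p)" for p :: "(real^'n) \<times> (real^'n)"
  define W where "W = c -` S"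
  have bl: "bounded_linear (\<lambda>p. M *v fst p)" for M :: "real^'n^'n"
    by (intro bounded_linear_compose[OF _ bounded_linear_fst] matrix_vector_mul_bounded_linear)
  have cD: "(c has_derivative (\<lambda>h. Q0 *v fst h + snd h)) (at p)" for p
    unfolding c_def[abs_def]
    by (auto intro!: derivative_eq_intros bounded_linear_imp_has_derivative[OF bl])
  have "continuous_on UNIV c" using cD by (meson has_derivative_continuous_on)
  then have oW: "open W" unfolding W_def using S(1) by (simp add: open_vimage)
  have W0: "(0, 0) \<in> W" using S by (simp add: W_def c_def)
  have sc: "smooth_on UNIV c W"
    unfolding c_def[abs_def]
    by (intro smooth_on_add[OF oW] smooth_on_const[OF oW] smooth_on_linear[OF oW bl]
        smooth_on_linear[OF oW bounded_linear_snd])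
  have sPc: "smooth_on UNIV (\<lambda>p. P (c p)) W"
    by (rule smooth_on_compose[OF oW S(1) sc P]) (simp add: W_def)
  have sg: "smooth_on UNIV g W"
    unfolding g_def[abs_def]
    by (intro smooth_on_matrix_vector_mult[OF oW] sPc smooth_on_linear[OF oW bl])
  have gD: "(g has_derivative (\<lambda>h. P (c p) *v (P0 *v fst h) + DP (c p) (Q0 *v fst h + snd h) *v (P0 *v fst p))) (at p)"
    if "p \<in> W" for p
    unfolding g_def[abs_def]
    by (rule has_derivative_mv[OF has_derivative_compose[OF cD DP] bounded_linear_imp_has_derivative[OF bl]])
      (use that in \<open>simp add: W_def\<close>)
  have Dg: "frechet_derivative g (at p) h =
      P (c p) *v (P0 *v fst h) + DP (c p) (Q0 *v fst h + snd h) *v (P0 *v fst p)" if "p \<in> W" for p h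
    using frechet_derivative_eqI[OF gD[OF that]] by simp
  have g0: "g (0, 0) = 0" and D0: "frechet_derivative g (at (0, 0)) (0, k) = 0" for k
    using Dg[OF W0] by (simp_all add: g_def)
  obtain \<delta> r y where sol: "\<delta> > 0" "r > 0" "ball 0 \<delta> \<times> ball 0 r \<subseteq> W"
    "integral.solution_family (ball 0 \<delta>) (ball 0 \<delta> \<times> ball 0 r) (\<lambda>_. g) y"
    "\<And>t. t \<in> {0..1} \<Longrightarrow> smooth_on UNIV (y t) (ball 0 \<delta>)"
    by (rule integral.smooth_fixed_point[OF oW W0 sg g0 D0], rule that; assumption)
  let ?B = "ball (0 :: real^'n) \<delta>" and ?W = "ball (0 :: real^'n) \<delta> \<times> ball (0 :: real^'n) r"
  have ck: "Ck_family {0..1::real} ?W (Suc 0) (\<lambda>_. g)"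
    by (rule Ck_family_subset[OF smooth_on_family[OF oW sg] order_refl sol(3)])
  note at = integral.solution_family_at[OF sol(4) Ck_family_continuous[OF ck]]
  have \<gamma>S: "c (z, y t z) \<in> S" and inW: "(z, y t z) \<in> W" if "z \<in> ?B" "t \<in> {0..1}" for z t
    using subsetD[OF sol(3) at(2)[OF that]] by (simp_all add: W_def)
  define \<Psi> where "\<Psi> z = c (z, y 1 z)" for z
  have zero: "0 \<in> ?B" using sol by simp
  have y0: "y t 0 = 0" if "t \<in> {0..1}" for t
    using at(3)[OF zero that] by (simp add: g_def)
  have \<Psi>0: "\<Psi> 0 = x0" by (simp add: \<Psi>_def c_def y0)
  have s\<Psi>: "smooth_on UNIV \<Psi> ?B"
    unfolding \<Psi>_def[abs_def] c_def fst_conv snd_conv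
    by (intro smooth_on_add smooth_on_const open_ball sol(5) smooth_on_linear[OF open_ball matrix_vector_mul_bounded_linear]) simp
  have variation: "\<exists>X. continuous_on {0..1} X \<and> frechet_derivative \<Psi> (at z) w = Q0 *v w + X 1 \<and>
      (\<forall>t\<in>{0..1}. X t = integral {0..t} (\<lambda>s. frechet_derivative g (at (z, y s z)) (w, X s)))"
    if z: "z \<in> ?B" for z w
  proof -
    obtain X where X: "\<And>w. continuous_on {0..1} (\<lambda>t. X t w)"
      "\<And>t. t \<in> {0..1} \<Longrightarrow> (y t has_derivative X t) (at z)"
      "\<And>t w. t \<in> {0..1} \<Longrightarrow> X t w = integral {0..t} (\<lambda>s. frechet_derivative g (at (z, y s z)) (w, X s w))"
      using integral.solution_family_derivative[OF sol(4) ck z] by blast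
    have "((\<lambda>z. x0 + Q0 *v z + y 1 z) has_derivative (\<lambda>h. 0 + Q0 *v h + X 1 h)) (at z)"
      by (intro has_derivative_add has_derivative_const X(2) bounded_linear_imp_has_derivative
          matrix_vector_mul_bounded_linear) simp
    then have "frechet_derivative \<Psi> (at z) w = Q0 *v w + X 1 w"
      by (simp add: \<Psi>_def[abs_def] c_def frechet_derivative_eqI)
    then show ?thesis using X(1,3) by (intro exI[of _ "\<lambda>t. X t w"]) auto
  qed
  \<comment> \<open>For \<open>z = 0\<close> the curve is constant, so its variation integrates
    \<open>P0 *v w\<close> over unit time, and \<open>Q0 *v w + P0 *v w = w\<close>.\<close>
  have D\<Psi>0: "frechet_derivative \<Psi> (at 0) w = w" for w
  proof -
    obtain X where X: "frechet_derivative \<Psi> (at 0) w = Q0 *v w + X 1"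
      "X 1 = integral {0..1} (\<lambda>s. frechet_derivative g (at (0, y s 0)) (w, X s))"
      using variation[OF zero, of w] by auto
    have "X 1 = integral {0..1::real} (\<lambda>s. P0 *v w)"
      unfolding X(2)
    proof (rule integral_cong)
      fix s :: real assume s: "s \<in> {0..1}"
      show "frechet_derivative g (at (0, y s 0)) (w, X s) = P0 *v w"
        using Dg[OF inW[OF zero s]]
        by (simp add: y0[OF s] c_def matrix_vector_mul_assoc PP0 flip: P0_def)
    qed
    then show ?thesis using X(1) by (simp add: Q0_def matrix_vector_mult_diff_rdistrib)
  qed
  have tangent: "P (\<Psi> z) *v frechet_derivative \<Psi> (at z) w = frechet_derivative \<Psi> (at z) w"
    if z: "z \<in> ?B" and w: "P0 *v w = w" for z w
  proof -
    have Qw: "Q0 *v w = 0" using w by (simp add: Q0_def matrix_vector_mult_diff_rdistrib)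
    obtain Y where Y: "continuous_on {0..1} Y" "frechet_derivative \<Psi> (at z) w = Y 1"
      "\<And>t. t \<in> {0..1} \<Longrightarrow> Y t = integral {0..t} (\<lambda>s. frechet_derivative g (at (z, y s z)) (w, Y s))"
      using variation[OF z, of w] Qw by auto
    define \<gamma> where "\<gamma> t = c (z, y t z)" for t
    define h where "h = P0 *v z"
    have \<gamma>: "\<gamma> t \<in> S" if "t \<in> {0..1}" for t using \<gamma>S[OF z that] by (simp add: \<gamma>_def)
    have \<gamma>c: "continuous_on {0..1} \<gamma>"
      unfolding \<gamma>_def c_def fst_conv snd_conv using at(1)[OF z] by (intro continuous_intros)
    define f where "f s = P (\<gamma> s) *v w + DP (\<gamma> s) (Y s) *v h" for s
    have f: "frechet_derivative g (at (z, y s z)) (w, Y s) = f s" if "s \<in> {0..1}" for s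
      using Dg[OF inW[OF z that], of "(w, Y s)"] by (simp add: f_def \<gamma>_def h_def w Qw)
    have Pc: "continuous_on {0..1} (\<lambda>s. P (\<gamma> s))"
      using continuous_on_compose2[OF smooth_on_continuous[OF P] \<gamma>c] \<gamma> by blast
    have DPc: "continuous_on {0..1} (\<lambda>s. DP (\<gamma> s) v)" for v
      unfolding DP_def
      using continuous_on_compose2[OF smooth_on_continuous[OF smooth_on_derivative[OF P]] \<gamma>c] \<gamma> by blast
    note mvc = bounded_bilinear.continuous_on[OF bounded_bilinear_matrix_vector_mult]
    have DPYc: "continuous_on {0..1} (\<lambda>s. DP (\<gamma> s) (Y s))"
    proof -
      have "continuous_on {0..1} (\<lambda>s. \<Sum>i\<in>Basis. (Y s \<bullet> i) *\<^sub>R DP (\<gamma> s) i)"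
        by (intro continuous_intros Y(1) DPc)
      then show ?thesis
      proof (rule continuous_on_eq)
        fix s :: real assume "s \<in> {0..1}"
        note L = linDP[OF \<gamma>[OF this]]
        have "DP (\<gamma> s) (\<Sum>i\<in>Basis. (Y s \<bullet> i) *\<^sub>R i) = (\<Sum>i\<in>Basis. (Y s \<bullet> i) *\<^sub>R DP (\<gamma> s) i)"
          by (simp only: linear_sum[OF L] linear_cmul[OF L] o_def)
        then show "(\<Sum>i\<in>Basis. (Y s \<bullet> i) *\<^sub>R DP (\<gamma> s) i) = DP (\<gamma> s) (Y s)"
          by (simp only: euclidean_representation)
      qed
    qed
    have fc: "continuous_on {0..1} f"
      unfolding f_def by (intro continuous_on_add mvc Pc DPYc continuous_on_const)
    have Yf: "Y t = integral {0..t} f" if "t \<in> {0..1}" for t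
      unfolding Y(3)[OF that] by (rule integral_cong) (use that f in auto)
    have Yd: "(Y has_vector_derivative f t) (at t within {0..1})" if "t \<in> {0..1}" for t
      by (rule has_vector_derivative_transform[OF that Yf integral_has_vector_derivative[OF fc that]])
    have yd: "((\<lambda>t. y t z) has_vector_derivative P (\<gamma> t) *v h) (at t within {0..1})" if "t \<in> {0..1}" for t
    proof (rule has_vector_derivative_transform[OF that])
      show "((\<lambda>t. integral {0..t} (\<lambda>s. g (z, y s z))) has_vector_derivative P (\<gamma> t) *v h) (at t within {0..1})"
        using integral_has_vector_derivative[OF at(5)[OF z] that] by (simp add: g_def \<gamma>_def h_def)
    qed (use at(3)[OF z] in auto)
    have \<gamma>d: "(\<gamma> has_vector_derivative P (\<gamma> t) *v h) (at t within {0..1})" if "t \<in> {0..1}" for t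
      unfolding \<gamma>_def[abs_def] c_def fst_conv snd_conv
      using has_vector_derivative_add[OF has_vector_derivative_const yd[OF that]]
      by (simp add: \<gamma>_def c_def)
    \<comment> \<open>The component of the variation \<open>Y\<close> in the kernel of
      \<open>P\<close> at the moving point; it has to vanish at time \<open>1\<close>.\<close>
    define V where "V t = Y t - P (\<gamma> t) *v Y t" for t
    define V' where "V' t = f t - (P (\<gamma> t) *v f t + DP (\<gamma> t) (P (\<gamma> t) *v h) *v Y t)" for t
    have Vd: "(V has_vector_derivative V' t) (at t within {0..1})" if t: "t \<in> {0..1}" for t
    proof -
      have "((\<lambda>t. P (\<gamma> t)) has_derivative (\<lambda>u. DP (\<gamma> t) (u *\<^sub>R (P (\<gamma> t) *v h)))) (at t within {0..1})"
        by (rule has_derivative_compose[OF \<gamma>d[OF t, unfolded has_vector_derivative_def] DP[OF \<gamma>[OF t]]])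
      from has_derivative_mv[OF this Yd[OF t, unfolded has_vector_derivative_def]]
      have "((\<lambda>t. P (\<gamma> t) *v Y t) has_vector_derivative
          (P (\<gamma> t) *v f t + DP (\<gamma> t) (P (\<gamma> t) *v h) *v Y t)) (at t within {0..1})"
        by (simp add: has_vector_derivative_def linear_cmul[OF linDP[OF \<gamma>[OF t]]] scaleR_add_right
            matrix_vector_mult_scaleR flip: scaleR_matrix_vector_assoc)
      from has_vector_derivative_diff[OF Yd[OF t] this] show ?thesis
        by (simp add: V_def[abs_def] V'_def)
    qed
    \<comment> \<open>\<open>V' t\<close> depends linearly on \<open>Y t\<close> through
      \<open>B t\<close>. Involutivity, combined with the derivative of \<open>P ** P = P\<close>,
      shows that \<open>B t\<close> kills the part of \<open>Y t\<close> in the image of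
      \<open>P\<close>, so that only \<open>V t\<close> is left.\<close>
    define B where "B t v = (DP (\<gamma> t) v *v h - P (\<gamma> t) *v (DP (\<gamma> t) v *v h)) - DP (\<gamma> t) (P (\<gamma> t) *v h) *v v" for t v
    have V'B: "V' t = B t (V t)" if t: "t \<in> {0..1}" for t
    proof -
      note x = \<gamma>[OF t]
      have Pv: "P (\<gamma> t) *v (P (\<gamma> t) *v v) = P (\<gamma> t) *v v" for v
        using PP[OF x] by (simp add: matrix_vector_mul_assoc)
      define b where "b = P (\<gamma> t) *v Y t"
      have Yb: "Y t = b + V t" by (simp add: b_def V_def)
      have "(DP (\<gamma> t) b ** P (\<gamma> t) + P (\<gamma> t) ** DP (\<gamma> t) b) *v h = DP (\<gamma> t) b *v h" by (simp add: DPP[OF x])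
      then have "DP (\<gamma> t) b *v h - P (\<gamma> t) *v (DP (\<gamma> t) b *v h) = DP (\<gamma> t) b *v (P (\<gamma> t) *v h)"
        by (simp add: matrix_vector_mult_add_rdistrib algebra_simps flip: matrix_vector_mul_assoc)
      also have "\<dots> = DP (\<gamma> t) (P (\<gamma> t) *v h) *v b"
        unfolding DP_def by (rule invol[OF x]) (simp_all add: b_def Pv)
      finally have bt: "B t b = 0" by (simp add: B_def)
      have "V' t = B t (Y t)"
        by (simp add: V'_def f_def B_def matrix_vector_right_distrib Pv)
      also have "\<dots> = B t b + B t (V t)"
        unfolding Yb B_def linear_add[OF linDP[OF x]]
        by (simp add: matrix_vector_right_distrib matrix_vector_mult_add_rdistrib)
      finally show ?thesis by (simp add: bt)
    qed
    have linB: "linear (B t)" if "t \<in> {0..1}" for t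
      unfolding B_def linear_iff
      by (simp add: linear_add[OF linDP[OF \<gamma>[OF that]]] linear_cmul[OF linDP[OF \<gamma>[OF that]]]
          matrix_vector_right_distrib matrix_vector_mult_add_rdistrib matrix_vector_mult_scaleR scaleR_diff_right
          flip: scaleR_matrix_vector_assoc)
    have "bounded ((\<lambda>t. B t i) ` {0..1})" for i
    proof -
      have "smooth_on UNIV (\<lambda>x. P x *v h) S"
        by (intro smooth_on_matrix_vector_mult[OF S(1)] P smooth_on_const[OF S(1)])
      then have "continuous_on S (\<lambda>x. DP x (P x *v h))"
        unfolding DP_def by (intro smooth_on_continuous smooth_on_derivative_apply[OF S(1) P])
      then have "continuous_on {0..1} (\<lambda>t. DP (\<gamma> t) (P (\<gamma> t) *v h))"
        using continuous_on_compose2[OF _ \<gamma>c] \<gamma> by blast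
      then have "continuous_on {0..1} (\<lambda>t. B t i)"
        unfolding B_def by (intro continuous_on_diff mvc Pc DPc continuous_on_const)
      then show ?thesis using compact_continuous_image compact_imp_bounded by blast
    qed
    then obtain C where C: "\<And>t v. t \<in> {0..1} \<Longrightarrow> norm (B t v) \<le> C * norm v"
      using linear_basis_bound[of "{0..1}" B, OF linB] by blast
    have "V 1 = 0"
    proof (rule linear_ode_zero[OF Vd])
      show "norm (V' t) \<le> C * norm (V t)" if "t \<in> {0..1}" for t
        using C[OF that] V'B[OF that] by simp
      show "V 0 = 0" using Y(3)[of 0] by (simp add: V_def)
    qed auto
    then show ?thesis by (simp add: V_def Y(2) \<gamma>_def \<Psi>_def)
  qed
  have "frechet_derivative \<Psi> (at 0) = (\<lambda>w. w)" using D\<Psi>0 by blast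
  then have injD: "inj (frechet_derivative \<Psi> (at 0))" by (simp add: inj_def)
  obtain N0 G where N0: "open N0" "0 \<in> N0" "N0 \<subseteq> ?B" "open (\<Psi> ` N0)" "smooth_on UNIV G (\<Psi> ` N0)"
    "\<And>x. x \<in> N0 \<Longrightarrow> G (\<Psi> x) = x"
    by (rule smooth_inverse_function[OF open_ball zero s\<Psi> injD], rule that; assumption)
  let ?N = "\<Psi> ` N0"
  have GD: "(G has_derivative frechet_derivative G (at x)) (at x)" if "x \<in> ?N" for x
    using smooth_on_has_derivative[OF N0(5) that] .
  have chain: "frechet_derivative G (at (\<Psi> z)) (frechet_derivative \<Psi> (at z) w) = w" if z: "z \<in> N0" for z w
  proof -
    have "(\<Psi> has_derivative frechet_derivative \<Psi> (at z)) (at z)"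
      using smooth_on_has_derivative[OF s\<Psi>] N0(3) z by blast
    from has_derivative_compose[OF this GD] z
    have "((\<lambda>z. G (\<Psi> z)) has_derivative (\<lambda>w. frechet_derivative G (at (\<Psi> z)) (frechet_derivative \<Psi> (at z) w))) (at z)"
      by blast
    moreover have "((\<lambda>z. G (\<Psi> z)) has_derivative (\<lambda>w. w)) (at z)"
      by (rule has_derivative_transform_within_open[OF has_derivative_ident N0(1) z]) (simp add: N0(6))
    ultimately show ?thesis using has_derivative_unique fun_cong by metis
  qed
  \<comment> \<open>The integral manifolds are images of parallel copies of \<open>im P0\<close>, so
    the \<open>Q0\<close>-part of the inverse of \<open>\<Psi>\<close> is constant on them.\<close>
  define G' where "G' x = Q0 *v G x" for x
  have G'D: "frechet_derivative G' (at x) a = Q0 *v frechet_derivative G (at x) a" if "x \<in> ?N" for x a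
  proof -
    have "(G' has_derivative (\<lambda>a. Q0 *v frechet_derivative G (at x) a)) (at x)"
      unfolding G'_def[abs_def]
      by (rule bounded_linear.has_derivative[OF matrix_vector_mul_bounded_linear GD[OF that]])
    then show ?thesis by (simp add: frechet_derivative_eqI)
  qed
  show ?thesis
  proof (rule that[OF N0(4)])
    show "x0 \<in> ?N" using N0(2) \<Psi>0 by force
    show "?N \<subseteq> S" using N0(3) \<gamma>S[of _ 1] by (auto simp: \<Psi>_def)
    show "smooth_on UNIV G' ?N" unfolding G'_def[abs_def]
      by (rule smooth_on_bounded_linear[OF N0(4) matrix_vector_mul_bounded_linear N0(5)])
    show "P x0 *v frechet_derivative G' (at x) a = 0" if "x \<in> ?N" for x a
      by (simp add: G'D[OF that] matrix_vector_mul_assoc QP0 flip: P0_def)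
    show "frechet_derivative G' (at x0) a = (mat 1 - P x0) *v a" for a
      using G'D[of x0 a] chain[OF N0(2), of a] \<open>x0 \<in> ?N\<close> by (simp add: \<Psi>0 D\<Psi>0 Q0_def P0_def)
    fix x a assume "x \<in> ?N"
    then obtain z where z: "z \<in> N0" "x = \<Psi> z" by blast
    then have zB: "z \<in> ?B" using N0(3) by blast
    have xS: "x \<in> S" using \<gamma>S[OF zB, of 1] by (simp add: z \<Psi>_def)
    let ?D = "frechet_derivative \<Psi> (at z)"
    have linD: "linear ?D"
      using has_derivative_linear[OF smooth_on_has_derivative[OF s\<Psi> zB]] .
    have sub: "subspace (range ((*v) M))" for M :: "real^'n^'n"
      by (simp add: linear_subspace_image)
    \<comment> \<open>\<open>tangent\<close> gives one inclusion only. Equality follows by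
      dimension, because \<open>P x\<close> is conjugate to \<open>P0\<close> and \<open>?D\<close>
      is injective.\<close>
    have "?D ` range ((*v) P0) = range ((*v) (P x))"
    proof (rule subspace_dim_equal)
      show "subspace (?D ` range ((*v) P0))" by (rule linear_subspace_image[OF linD sub])
      show "subspace (range ((*v) (P x)))" by (rule sub)
      show "?D ` range ((*v) P0) \<subseteq> range ((*v) (P x))"
      proof
        fix b assume "b \<in> ?D ` range ((*v) P0)"
        then obtain w where "b = ?D (P0 *v w)" by blast
        moreover have "P0 *v (P0 *v w) = P0 *v w" by (simp add: matrix_vector_mul_assoc PP0)
        ultimately show "b \<in> range ((*v) (P x))" using tangent[OF zB, of "P0 *v w"] z(2) by (metis rangeI)
      qed
      obtain R R' where R: "R ** R' = mat 1" "R' ** R = mat 1" "P x = R ** P x0 ** R'"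
        using conj[OF xS] by blast
      have "range ((*v) (P x)) \<subseteq> (*v) R ` range ((*v) P0)"
        by (auto simp: R(3) P0_def simp flip: matrix_vector_mul_assoc)
      then have "dim (range ((*v) (P x))) \<le> dim ((*v) R ` range ((*v) P0))" by (rule dim_subset)
      also have "\<dots> \<le> dim (range ((*v) P0))" by (rule dim_image_le) simp
      also have "\<dots> = dim (?D ` range ((*v) P0))"
      proof (rule dim_image_eq[symmetric, OF linD])
        show "inj_on ?D (span (range ((*v) P0)))" using chain[OF z(1)] by (metis inj_on_inverseI)
      qed
      finally show "dim (range ((*v) (P x))) \<le> dim (?D ` range ((*v) P0))" .
    qed
    then obtain w where "P x *v a = ?D (P0 *v w)" by blast
    then have "frechet_derivative G (at x) (P x *v a) = P0 *v w" using chain[OF z(1)] z(2) by simp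
    then show "frechet_derivative G' (at x) (P x *v a) = 0"
      using G'D[OF \<open>x \<in> ?N\<close>] by (simp add: matrix_vector_mul_assoc QP0)
  qed
qed


section \<open>Splitting coordinates\<close>

lemma compl_coord_proj: "mat 1 - coord_proj K = coord_proj (- K)"
  using coord_proj_add_compl[of K] by (simp add: diff_eq_eq add.commute)

text \<open>For fixed \<open>a\<close>, the \<open>K\<close>-part of the mixed Haantjes component is
  the square of a Sylvester operator applied to \<open>b \<mapsto> C b a\<close>, and separation
  makes this operator injective. The other block is obtained by exchanging \<open>K\<close> and
  \<open>- K\<close>.\<close>

lemma haantjes_block_necessary:
  fixes A B :: "real^'n^'n"
  assumes m: "matrix_on K A" "matrix_on (- K) B" "\<And>h. matrix_on K (T h)" "\<And>h. matrix_on (- K) (U h)"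
    and lin: "linear T" and sep: "separated (A + B) (coord_proj K)"
    and H: "\<And>a b. haantjes_tensor (A + B) (\<lambda>h. T h + U h) a b = 0"
  shows "\<forall>a\<in>coord_space K. \<forall>b\<in>coord_space K. haantjes_tensor A T a b = 0"
    and "\<forall>b\<in>coord_space (- K). \<forall>x. A *v (T b *v x) - T b *v (A *v x) = 0"
proof -
  show "\<forall>a\<in>coord_space K. \<forall>b\<in>coord_space K. haantjes_tensor A T a b = 0"
    using haantjes_tensor_block[where T = T and U = U, OF m] by (simp add: H)
  define C where "C h x = A *v (T h *v x) - T h *v (A *v x)" for h x
  define E where "E h x = B *v (U h *v x) - U h *v (B *v x)" for h x
  let ?Pr = "coord_proj (- K)"
  have CK: "C h x \<in> coord_space K" for h x
    using m by (simp add: C_def matrix_on_in)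
  have EK: "E h x \<in> coord_space (- K)" for h x
    using m by (simp add: E_def matrix_on_in)
  have linC: "linear (\<lambda>h. C h x)" for x
    unfolding C_def by (rule linear_matrix_commutator[OF lin])
  have MK: "(A + B) *v x = A *v x" if "x \<in> coord_space K" for x
    using m that by (simp add: matrix_vector_mult_add_rdistrib matrix_on_kill')
  have PrM: "?Pr *v ((A + B) *v x) = B *v (?Pr *v x)" for x
  proof -
    have "(A + B) *v x = (A + B) *v (coord_proj K *v x) + (A + B) *v (?Pr *v x)"
      by (metis coord_decomp matrix_vector_right_distrib)
    also have "(A + B) *v (?Pr *v x) = B *v (?Pr *v x)"
      using m by (simp add: matrix_vector_mult_add_rdistrib matrix_on_kill)
    finally show ?thesis
      using m by (simp add: MK matrix_vector_right_distrib coord_proj_id matrix_on_in)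
        (rule coord_proj_kill, simp add: matrix_on_in)
  qed
  have Pr0: "?Pr *v x = 0" if "x \<in> coord_space K" for x
    using that by (intro coord_proj_kill) simp
  have PrPr: "?Pr *v (?Pr *v x) = ?Pr *v x" for x by (simp add: coord_proj_id)
  have sep': "separated (A + B) ?Pr" using separated_compl[OF sep] by (simp add: compl_coord_proj)
  have zero: "f b = 0"
    if f: "linear f" "\<And>b. f b \<in> coord_space K" "\<And>b. f (?Pr *v b) = f b" "\<And>b. A *v f b = f ((A + B) *v b)"
    for f b
    by (rule separatedD[OF sep' f(1) _ f(3)]) (use f in \<open>simp_all add: Pr0 MK\<close>)
  have CKK: "C b a = 0" if a: "a \<in> coord_space K" and b: "b \<in> coord_space (- K)" for a b
  proof -
    \<comment> \<open>Composition with \<open>?Pr\<close> extends the map from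
      \<open>coord_space (- K)\<close> to the whole space, as \<open>separatedD\<close> expects;
      \<open>F2\<close> is the Sylvester operator applied to \<open>F1\<close>.\<close>
    define F1 where "F1 b = C (?Pr *v b) a" for b
    define F2 where "F2 b = A *v F1 b - F1 ((A + B) *v b)" for b
    have F1B: "F1 ((A + B) *v b) = C (B *v (?Pr *v b)) a" for b by (simp add: F1_def PrM)
    have lin1: "linear F1"
      using linear_compose[OF matrix_vector_mul_linear[of ?Pr] linC[of a]] by (simp add: F1_def[abs_def] o_def)
    have lin2: "linear F2"
      unfolding F2_def[abs_def] linear_iff
      by (simp add: linear_add[OF lin1] linear_cmul[OF lin1] matrix_vector_right_distrib
          matrix_vector_mult_scaleR scaleR_diff_right)
    have K1: "F1 b \<in> coord_space K" for b by (simp add: F1_def CK)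
    have K2: "F2 b \<in> coord_space K" for b using m K1 by (simp add: F2_def matrix_on_in)
    have P1: "F1 (?Pr *v b) = F1 b" for b by (simp add: F1_def PrPr)
    have P2: "F2 (?Pr *v b) = F2 b" for b
      unfolding F2_def F1B by (simp add: P1 PrPr)
    have "F2 b = 0" for b
    proof (rule zero[OF lin2 K2 P2])
      fix b
      let ?b = "?Pr *v b"
      have bK: "?b \<in> coord_space (- K)" by simp
      note mixed = haantjes_tensor_mixed[where T = T and U = U and C = C and E = E, OF m a bK C_def E_def]
      let ?X = "A *v (A *v C ?b a - C (B *v ?b) a) - (A *v C (B *v ?b) a - C (B *v (B *v ?b)) a)"
      let ?Y = "B *v (B *v E a ?b - E (A *v a) ?b) - (B *v E (A *v a) ?b - E (A *v (A *v a)) ?b)"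
      \<comment> \<open>The contributions of the two blocks lie in complementary coordinate spaces,
        hence vanish separately.\<close>
      have "?X + (- ?Y) = 0" using mixed H by simp
      moreover have "?X \<in> coord_space K" using m CK by (simp add: matrix_on_in)
      moreover have "- ?Y \<in> coord_space (- K)" using m EK by (intro coord_space_closed(5)) (simp add: matrix_on_in)
      ultimately have X0: "?X = 0" using coord_space_add_eq_0(1) by blast
      have "F2 ((A + B) *v b) = A *v C (B *v ?b) a - C (B *v (B *v ?b)) a"
        unfolding F2_def F1B by (simp add: F1B PrM)
      moreover have "A *v F2 b = A *v (A *v C ?b a - C (B *v ?b) a)"
        unfolding F2_def F1B by (simp add: F1_def)
      ultimately show "A *v F2 b = F2 ((A + B) *v b)" using X0 by simp
    qed
    then have "A *v F1 b = F1 ((A + B) *v b)" for b unfolding F2_def by simp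
    then have "F1 b = 0" by (intro zero[OF lin1 K1 P1])
    then show ?thesis using b by (simp add: F1_def coord_proj_id)
  qed
  show "\<forall>b\<in>coord_space (- K). \<forall>x. A *v (T b *v x) - T b *v (A *v x) = 0"
  proof (intro ballI allI)
    fix b x assume b: "b \<in> coord_space (- K)"
    have k: "A *v v = 0" "T h *v v = 0" if "v \<in> coord_space (- K)" for v h
      using m(1,3) that matrix_on_kill by blast+
    have "C b x = C b (coord_proj K *v x + coord_proj (- K) *v x)" by (simp flip: coord_decomp)
    also have "\<dots> = C b (coord_proj K *v x)"
      unfolding C_def matrix_vector_right_distrib k[OF coord_proj_in] by simp
    also have "\<dots> = 0" using CKK[OF _ b] by simp
    finally show "A *v (T b *v x) - T b *v (A *v x) = 0" by (simp add: C_def)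
  qed
qed

proposition block_diag_of_haantjes:
  fixes L :: "real^'n \<Rightarrow> real^'n^'n"
  assumes W: "open W" and L: "smooth_on UNIV L W" and H: "haantjes_on UNIV W L"
    and com: "\<And>x. x \<in> W \<Longrightarrow> L x ** coord_proj K = coord_proj K ** L x"
    and sep: "\<And>x. x \<in> W \<Longrightarrow> separated (L x) (coord_proj K)"
  obtains A B where "smooth_block K W A" "smooth_block (- K) W B"
    "\<forall>x\<in>W. L x = block_diag K (A x) (B x)" "haantjes_wrt K W A" "haantjes_wrt (- K) W B"
    "\<forall>x\<in>W. \<forall>j. j \<notin> K \<longrightarrow> A x ** partial_deriv j A x - partial_deriv j A x ** A x = 0"
    "\<forall>x\<in>W. \<forall>i\<in>K. B x ** partial_deriv i B x - partial_deriv i B x ** B x = 0"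
proof -
  define blk where "blk S x = coord_proj S ** L x ** coord_proj S" for S x
  have mon: "matrix_on S (blk S x)" for S x
    unfolding matrix_on_def
  proof (intro allI impI)
    fix i j assume ij: "\<not> (i \<in> S \<and> j \<in> S)"
    have "(blk S x *v axis j 1) $ i = 0"
    proof (cases "i \<in> S")
      case True
      then have "axis j 1 \<in> coord_space (- S)" using ij by (auto simp: coord_space_def axis_def)
      then have "coord_proj S *v axis j 1 = 0" by (rule coord_proj_kill)
      then show ?thesis by (simp add: blk_def flip: matrix_vector_mul_assoc)
    next
      case False
      then show ?thesis by (simp add: blk_def coord_proj_mv flip: matrix_vector_mul_assoc)
    qed
    then show "blk S x $ i $ j = 0" by (simp add: matrix_vector_mult_basis column_def)
  qed
  have smooth: "smooth_on UNIV (blk S) W" for S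
    unfolding blk_def[abs_def] by (intro smooth_on_matrix_mult[OF W] smooth_on_const[OF W] L)
  have Leq: "L x = blk K x + blk (- K) x" if x: "x \<in> W" for x
  proof -
    have p: "coord_proj S ** coord_proj S = coord_proj S" for S :: "'n set"
      by (simp add: matrix_eq coord_proj_id flip: matrix_vector_mul_assoc)
    have com': "coord_proj (- K) ** L x = L x ** coord_proj (- K)"
      using com[OF x] by (simp add: matrix_diff_ldistrib matrix_diff_rdistrib flip: compl_coord_proj)
    have "blk K x + blk (- K) x = L x ** (coord_proj K + coord_proj (- K))"
      unfolding blk_def com' com[OF x, symmetric]
      by (simp add: matrix_add_ldistrib p flip: matrix_mul_assoc)
    then show ?thesis by (simp add: coord_proj_add_compl)
  qed
  define T where "T S x = frechet_derivative (blk S) (at x)" for S x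
  have D: "(blk S has_derivative T S x) (at x)" if "x \<in> W" for S x
    unfolding T_def using smooth_on_has_derivative[OF smooth that] .
  have mT: "matrix_on S (T S x h)" if "x \<in> W" for S x h
    using matrix_on_derivative[OF W that mon D[OF that]] .
  have linT: "linear (T S x)" if "x \<in> W" for S x
    using has_derivative_linear[OF D[OF that]] .
  have LD: "(L has_derivative (\<lambda>h. T K x h + T (- K) x h)) (at x)" if x: "x \<in> W" for x
    by (rule has_derivative_transform_within_open[OF has_derivative_add[OF D[OF x] D[OF x]] W x])
      (simp flip: Leq)
  have H0: "haantjes_tensor (L x) (\<lambda>h. T K x h + T (- K) x h) a b = 0" if x: "x \<in> W" for x a b
    using H haantjes_on_iff_tensor[OF subspace_UNIV subset_UNIV UNIV_I LD, of W] x by blast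
  have cond: "(\<forall>a\<in>coord_space S. \<forall>b\<in>coord_space S. haantjes_tensor (blk S x) (T S x) a b = 0) \<and>
      (\<forall>b\<in>coord_space (- S). \<forall>y. blk S x *v (T S x b *v y) - T S x b *v (blk S x *v y) = 0)"
    if x: "x \<in> W" and S: "S = K \<or> S = - K" for x S
  proof -
    have s: "separated (blk S x + blk (- S) x) (coord_proj S)"
      using S separated_compl[OF sep[OF x]] sep[OF x] Leq[OF x] by (auto simp: compl_coord_proj add.commute)
    have h: "haantjes_tensor (blk S x + blk (- S) x) (\<lambda>h. T S x h + T (- S) x h) a b = 0" for a b
      using S H0[OF x] Leq[OF x] by (auto simp: add.commute)
    show ?thesis
      using haantjes_block_necessary[OF mon mon mT[OF x] mT[OF x] linT[OF x] s h] by blast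
  qed
  have wrt: "haantjes_wrt S W (blk S)" if "S = K \<or> S = - K" for S
    using haantjes_wrt_iff_tensor[of W "blk S", OF D mon] cond that by blast
  have part: "\<forall>j\<in>- S. blk S x ** partial_deriv j (blk S) x - partial_deriv j (blk S) x ** blk S x = 0"
    if "S = K \<or> S = - K" "x \<in> W" for S x
    using commutes_partial_iff[OF linT[OF that(2)], of "- S" "blk S x"] cond[OF that(2,1)]
    unfolding partial_deriv_def T_def by blast
  show ?thesis
  proof (rule that[of "blk K" "blk (- K)"])
    show "\<forall>x\<in>W. L x = block_diag K (blk K x) (blk (- K) x)"
      by (simp add: block_diag_eq_add mon Leq)
  qed (use mon smooth wrt part[of K] part[of "- K"] in \<open>auto simp: smooth_block_def\<close>)
qed

text \<open>Conjugating a commuting off-diagonal \<open>X\<close> by \<open>J\<close> gives one for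
  \<open>L\<close> and \<open>P\<close>, which is zero. In the application \<open>J\<close> is the
  Jacobi matrix of the new coordinates.\<close>

lemma separated_transport:
  fixes J :: "real^'n^'n"
  assumes sep: "separated L P" and J: "J ** J' = mat 1" "J' ** J = mat 1"
    and M: "M ** J = J ** L" and Pi: "Pr ** J = J ** P"
  shows "separated M Pr"
  unfolding separated_def
proof (intro allI impI, elim conjE)
  fix X assume X: "M ** X = X ** M" "X = Pr ** X ** (mat 1 - Pr) + (mat 1 - Pr) ** X ** Pr"
  have cancel: "J' ** (J ** N) = N" "J ** (J' ** N) = N" for N :: "real^'n^'n"
    by (simp_all add: J matrix_mul_assoc)
  have conj: "J' ** N = N' ** J'" if "N ** J = J ** N'" for N N'
  proof -
    have "J' ** N = J' ** (N ** J) ** J'" by (simp add: J flip: matrix_mul_assoc)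
    then show ?thesis by (simp add: that J matrix_mul_assoc)
  qed
  have Q: "(mat 1 - Pr) ** J = J ** (mat 1 - P)" using Pi by (simp add: matrix_ring_simps)
  define Y where "Y = J' ** X ** J"
  have "L ** Y = (L ** J') ** X ** J" by (simp add: Y_def matrix_mul_assoc)
  also have "L ** J' = J' ** M" using conj[OF M] by simp
  also have "J' ** M ** X ** J = J' ** (X ** M) ** J" by (simp add: X(1) flip: matrix_mul_assoc)
  also have "\<dots> = Y ** L" by (simp add: Y_def M flip: matrix_mul_assoc)
  finally have LY: "L ** Y = Y ** L" .
  have "Y = J' ** (Pr ** X ** (mat 1 - Pr) + (mat 1 - Pr) ** X ** Pr) ** J"
    unfolding Y_def using arg_cong[OF X(2), of "\<lambda>Z. J' ** Z ** J"] by simp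
  also have "\<dots> = J' ** Pr ** X ** ((mat 1 - Pr) ** J) + J' ** (mat 1 - Pr) ** X ** (Pr ** J)"
    by (simp only: matrix_add_ldistrib matrix_add_rdistrib matrix_mul_assoc)
  also have "\<dots> = P ** Y ** (mat 1 - P) + (mat 1 - P) ** Y ** P"
    unfolding Q Pi conj[OF Pi] conj[OF Q] Y_def by (simp only: matrix_mul_assoc)
  finally have "Y = 0" using sep LY unfolding separated_def by blast
  then have "J ** Y ** J' = 0" by simp
  then show "X = 0" by (simp add: Y_def J cancel flip: matrix_mul_assoc)
qed

text \<open>\<open>g1\<close> is constant along \<open>im P\<close> and \<open>g2\<close> along
  \<open>ker P\<close>, with differentials valued in \<open>ker P0\<close> and \<open>im P0\<close>.
  Hence the differential of \<open>g1 + g2\<close> intertwines \<open>P\<close> with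
  \<open>P0\<close>, and at \<open>x0\<close> it is the identity. The linear map \<open>T\<close>
  turns \<open>P0\<close> into the coordinate projection.\<close>

proposition splitting_coordinates:
  fixes L :: "real^'n \<Rightarrow> real^'n^'n" and K :: "'n set"
  assumes S: "open S" "x0 \<in> S" and L: "smooth_on UNIV L S" and H: "haantjes_on UNIV S L"
    and chi: "charpoly (L x0) = p1 * p2" "coprime p1 p2" "p1 \<noteq> 0" "p2 \<noteq> 0"
    and card: "card K = degree p1" "card (- K) = degree p2"
  obtains N \<phi> G where "open N" "x0 \<in> N" "N \<subseteq> S" "smooth_on UNIV \<phi> N" "open (\<phi> ` N)"
    "smooth_on UNIV G (\<phi> ` N)" "\<And>x. x \<in> N \<Longrightarrow> G (\<phi> x) = x"
    "\<And>x. x \<in> N \<Longrightarrow> \<exists>P. separated (L x) P \<and> L x ** P = P ** L x \<and>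
      coord_proj K ** matrix (frechet_derivative \<phi> (at x)) = matrix (frechet_derivative \<phi> (at x)) ** P"
proof -
  have deg: "degree p1 + degree p2 = CARD('n)" using card card_add_card_Compl[of K] by simp
  obtain P0 where P0: "P0 ** P0 = P0" "L x0 ** P0 = P0 ** L x0" "separated (L x0) P0"
    "dim (range ((*v) P0)) = degree p1"
    using spectral_projection[OF chi deg] .
  obtain N1 P where N1: "open N1" "x0 \<in> N1" "N1 \<subseteq> S" "smooth_on UNIV P N1" "P x0 = P0"
    "\<And>x. x \<in> N1 \<Longrightarrow> P x ** P x = P x" "\<And>x. x \<in> N1 \<Longrightarrow> L x ** P x = P x ** L x"
    "\<And>x. x \<in> N1 \<Longrightarrow> \<exists>R R'. R ** R' = mat 1 \<and> R' ** R = mat 1 \<and> P x = R ** P0 ** R'"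
    by (rule spectral_projection_field[OF S L P0(1-3)], rule that; assumption)
  have cont: "continuous_on N1 L" "continuous_on N1 P"
    using smooth_on_continuous[OF L] continuous_on_subset N1(3) smooth_on_continuous[OF N1(4)] by blast+
  obtain N2 where N2: "open N2" "x0 \<in> N2" "N2 \<subseteq> N1" "\<And>x. x \<in> N2 \<Longrightarrow> separated (L x) (P x)"
    by (rule separated_open[OF N1(1,2) cont]) (use P0 N1 that in auto)
  have sL: "smooth_on UNIV L N2" using smooth_on_subset[OF L S(1) N2(1)] N1(3) N2(3) by blast
  have sP: "smooth_on UNIV P N2" using smooth_on_subset[OF N1(4,1) N2(1,3)] .
  have sQ: "smooth_on UNIV (\<lambda>x. mat 1 - P x) N2"
    by (intro smooth_on_diff[OF N2(1)] smooth_on_const[OF N2(1)] sP)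
  note LD = smooth_on_has_derivative[OF L]
  have H0: "haantjes_tensor (L x) (frechet_derivative L (at x)) a b = 0" if "x \<in> S" for x a b
    using H haantjes_on_iff_tensor[OF subspace_UNIV subset_UNIV UNIV_I LD, of S] that by blast
  \<comment> \<open>Stated for an arbitrary field \<open>R\<close> of separating projections, since
    it is needed for \<open>P\<close> and for \<open>mat 1 - P\<close>.\<close>
  have invol: "frechet_derivative R (at x) a *v b = frechet_derivative R (at x) b *v a"
    if R: "smooth_on UNIV R N2" "\<And>x. x \<in> N2 \<Longrightarrow> R x ** R x = R x" "\<And>x. x \<in> N2 \<Longrightarrow> L x ** R x = R x ** L x"
      "\<And>x. x \<in> N2 \<Longrightarrow> separated (L x) (R x)" and x: "x \<in> N2" and ab: "R x *v a = a" "R x *v b = b"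
    for R x a b
  proof -
    have xS: "x \<in> S" using x N1 N2 by blast
    note RD = smooth_on_has_derivative[OF R(1) x]
    show ?thesis
      by (rule haantjes_involutive_at[OF R(4)[OF x] R(3)[OF x] has_derivative_linear[OF RD]
            derivative_of_idempotent[OF N2(1) x R(2) RD] R(2)[OF x]
            derivative_of_commuting[OF N2(1) x R(3) LD[OF xS] RD] H0[OF xS] ab]) auto
  qed
  have PP: "P x ** P x = P x" "L x ** P x = P x ** L x" if "x \<in> N2" for x using N1 N2 that by blast+
  have QQ: "(mat 1 - P x) ** (mat 1 - P x) = mat 1 - P x" "L x ** (mat 1 - P x) = (mat 1 - P x) ** L x"
    if "x \<in> N2" for x
    using PP[OF that] by (simp_all add: matrix_diff_ldistrib matrix_diff_rdistrib)
  have sepQ: "separated (L x) (mat 1 - P x)" if "x \<in> N2" for x by (rule separated_compl[OF N2(4)[OF that]])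
  have conjP: "\<exists>R R'. R ** R' = mat 1 \<and> R' ** R = mat 1 \<and> P x = R ** P x0 ** R'" if "x \<in> N2" for x
    using N1(5,8) N2(3) that by blast
  have conjQ: "\<exists>R R'. R ** R' = mat 1 \<and> R' ** R = mat 1 \<and> mat 1 - P x = R ** (mat 1 - P x0) ** R'"
    if "x \<in> N2" for x
    using conjP[OF that] by (elim exE conjE, intro exI conjI)
      (assumption, assumption, simp add: matrix_diff_ldistrib matrix_diff_rdistrib)
  obtain N3 g1 where g1: "open N3" "x0 \<in> N3" "N3 \<subseteq> N2" "smooth_on UNIV g1 N3"
    "\<And>x a. x \<in> N3 \<Longrightarrow> frechet_derivative g1 (at x) (P x *v a) = 0"
    "\<And>x a. x \<in> N3 \<Longrightarrow> P x0 *v frechet_derivative g1 (at x) a = 0"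
    "\<And>a. frechet_derivative g1 (at x0) a = (mat 1 - P x0) *v a"
    by (rule frobenius_submersion[OF N2(1,2) sP PP(1) conjP invol[OF sP PP N2(4)]])
      (assumption | rule that)+
  obtain N4 g2 where g2: "open N4" "x0 \<in> N4" "N4 \<subseteq> N2" "smooth_on UNIV g2 N4"
    "\<And>x a. x \<in> N4 \<Longrightarrow> frechet_derivative g2 (at x) ((mat 1 - P x) *v a) = 0"
    "\<And>x a. x \<in> N4 \<Longrightarrow> (mat 1 - P x0) *v frechet_derivative g2 (at x) a = 0"
    "\<And>a. frechet_derivative g2 (at x0) a = (mat 1 - (mat 1 - P x0)) *v a"
    by (rule frobenius_submersion[OF N2(1,2) sQ QQ(1) conjQ invol[OF sQ QQ sepQ]])
      (assumption | rule that)+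
  obtain T T' where T: "T ** T' = mat 1" "T' ** T = mat 1" "T ** P0 = coord_proj K ** T"
    using projection_normal_form[OF P0(1), of K] P0(4) card(1) by metis
  define \<phi> where "\<phi> x = T *v (g1 x + g2 x)" for x
  define M where "M = N3 \<inter> N4"
  have M: "open M" "x0 \<in> M" "M \<subseteq> N2" using g1 g2 by (auto simp: M_def)
  have s1: "smooth_on UNIV g1 M" and s2: "smooth_on UNIV g2 M"
    using smooth_on_subset[OF g1(4,1) M(1)] smooth_on_subset[OF g2(4,1) M(1)] by (auto simp: M_def)
  have s\<phi>: "smooth_on UNIV \<phi> M"
    unfolding \<phi>_def[abs_def]
    by (rule smooth_on_bounded_linear[OF M(1) matrix_vector_mul_bounded_linear smooth_on_add[OF M(1) s1 s2]])
  have D\<phi>: "frechet_derivative \<phi> (at x) a =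
      T *v (frechet_derivative g1 (at x) a + frechet_derivative g2 (at x) a)" if "x \<in> M" for x a
  proof -
    have "(\<phi> has_derivative (\<lambda>a. T *v (frechet_derivative g1 (at x) a + frechet_derivative g2 (at x) a))) (at x)"
      unfolding \<phi>_def[abs_def]
      by (intro bounded_linear.has_derivative[OF matrix_vector_mul_bounded_linear] has_derivative_add
          smooth_on_has_derivative[OF s1 that] smooth_on_has_derivative[OF s2 that])
    then show ?thesis by (simp add: frechet_derivative_eqI)
  qed
  have "frechet_derivative \<phi> (at x0) a = T *v a" for a
    using D\<phi>[OF M(2)] by (simp add: g1(7) g2(7) matrix_vector_mult_diff_rdistrib)
  then have inj: "inj (frechet_derivative \<phi> (at x0))"
    by (intro inj_on_inverseI[of _ "(*v) T'"]) (simp add: matrix_vector_mul_assoc T)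
  obtain N G where N: "open N" "x0 \<in> N" "N \<subseteq> M" "open (\<phi> ` N)" "smooth_on UNIV G (\<phi> ` N)"
    "\<And>x. x \<in> N \<Longrightarrow> G (\<phi> x) = x"
    by (rule smooth_inverse_function[OF M(1,2) s\<phi> inj], rule that; assumption)
  show ?thesis
  proof (rule that[OF N(1,2) _ _ N(4-6)])
    show "N \<subseteq> S" using N M N2 N1 by blast
    show "smooth_on UNIV \<phi> N" using smooth_on_subset[OF s\<phi> M(1) N(1,3)] .
    fix x assume x: "x \<in> N"
    then have xM: "x \<in> M" and x3: "x \<in> N3" and x4: "x \<in> N4" and x2: "x \<in> N2" using N M by (auto simp: M_def)
    let ?D = "frechet_derivative \<phi> (at x)"
    have lin: "linear ?D" using has_derivative_linear[OF smooth_on_has_derivative[OF s\<phi> xM]] .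
    have TP: "coord_proj K *v (T *v y) = T *v (P0 *v y)" for y by (simp add: matrix_vector_mul_assoc T)
    have 1: "coord_proj K *v ?D (P x *v a) = ?D (P x *v a)" for a
      using g2(6)[OF x4, of "P x *v a"]
      by (simp add: D\<phi>[OF xM] g1(5)[OF x3] TP N1(5) matrix_vector_mult_diff_rdistrib)
    have 2: "coord_proj K *v ?D ((mat 1 - P x) *v a) = 0" for a
      using g1(6)[OF x3, of "(mat 1 - P x) *v a"]
      by (simp add: D\<phi>[OF xM] g2(5)[OF x4] TP N1(5))
    have "coord_proj K *v ?D a = ?D (P x *v a)" for a
    proof -
      have "?D a = ?D (P x *v a + (mat 1 - P x) *v a)" by (simp add: matrix_vector_mult_diff_rdistrib)
      also have "\<dots> = ?D (P x *v a) + ?D ((mat 1 - P x) *v a)" by (rule linear_add[OF lin])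
      finally show ?thesis using 1[of a] 2[of a] by (simp add: matrix_vector_right_distrib)
    qed
    then have "coord_proj K ** matrix ?D = matrix ?D ** P x"
      by (simp add: matrix_eq fun_cong[OF matrix_vector_mul(2)[OF lin]] flip: matrix_vector_mul_assoc)
    then show "\<exists>P. separated (L x) P \<and> L x ** P = P ** L x \<and> coord_proj K ** matrix ?D = matrix ?D ** P"
      using N2(4)[OF x2] PP(2)[OF x2] by blast
  qed
qed


section \<open>Charts obtained from a local diffeomorphism\<close>

lemma topological_chart_open_image:
  assumes c: "topological_chart X (U, \<phi>)" and D: "openin X D"
  shows "open (\<phi> ` (U \<inter> D))"
proof -
  have U: "open (\<phi> ` U)" and h: "homeomorphic_map (subtopology X U) (top_of_set (\<phi> ` U)) \<phi>"
    using c by (auto simp: topological_chart_def)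
  have "openin (subtopology X U) (U \<inter> D)" using D by (rule openin_subtopology_Int2)
  then have "openin (top_of_set (\<phi> ` U)) (\<phi> ` (U \<inter> D))"
    using homeomorphic_imp_open_map[OF h] unfolding open_map_def by blast
  then show ?thesis using U openin_open_trans by blast
qed

lemma topological_chart_inj: "topological_chart X (U, \<phi>) \<Longrightarrow> inj_on \<phi> U"
  using openin_subset by (fastforce simp: topological_chart_def homeomorphic_eq_everything_map Int_absorb1)

text \<open>By maximality of the atlas it suffices that the new pair is a topological chart
  compatible with each given one. Its transition maps are those of \<open>(V, \<psi>)\<close>
  composed with \<open>\<phi>\<close> or with its inverse \<open>G\<close>.\<close>

lemma chart_of_diffeomorphism:
  assumes man: "smooth_manifold X \<A>" and c: "(V, \<psi>) \<in> \<A>"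
    and N: "open N" "N \<subseteq> \<psi> ` V" and \<phi>: "smooth_on UNIV \<phi> N" "open (\<phi> ` N)"
    and G: "smooth_on UNIV G (\<phi> ` N)" "\<And>x. x \<in> N \<Longrightarrow> G (\<phi> x) = x"
  defines "U \<equiv> {q \<in> V. \<psi> q \<in> N}" and "\<kappa> \<equiv> \<phi> \<circ> \<psi>"
  shows "(U, \<kappa>) \<in> \<A>" "\<kappa> ` U = \<phi> ` N"
    "\<And>x. x \<in> N \<Longrightarrow> transition (V, \<psi>) (U, \<kappa>) x = \<phi> x"
proof -
  have tc: "\<And>c. c \<in> \<A> \<Longrightarrow> topological_chart X c" using man by (simp add: smooth_manifold_def)
  have tV: "topological_chart X (V, \<psi>)" using tc[OF c] .
  have V: "openin X V" and oV: "open (\<psi> ` V)" and h: "homeomorphic_map (subtopology X V) (top_of_set (\<psi> ` V)) \<psi>"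
    using tV by (auto simp: topological_chart_def)
  have VX: "V \<subseteq> topspace X" using V by (rule openin_subset)
  have inj\<psi>: "inj_on \<psi> V" using topological_chart_inj[OF tV] .
  have im\<psi>: "\<psi> ` U = N" using N(2) by (auto simp: U_def)
  then show im: "\<kappa> ` U = \<phi> ` N" by (simp only: \<kappa>_def image_comp[symmetric])
  have UV: "U \<subseteq> V" by (auto simp: U_def)
  have inj\<phi>: "inj_on \<phi> N" using G(2) by (rule inj_on_inverseI)
  have inj\<kappa>: "inj_on \<kappa> U"
    unfolding \<kappa>_def using comp_inj_on[OF inj_on_subset[OF inj\<psi> UV]] inj\<phi> im\<psi> by simp
  have inv\<psi>: "inv_into V \<psi> (\<psi> q) = q" if "q \<in> V" for q using inv_into_f_f[OF inj\<psi> that] .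
  have inv\<kappa>: "inv_into U \<kappa> (\<kappa> q) = q" if "q \<in> U" for q using inv_into_f_f[OF inj\<kappa> that] .
  have N\<psi>: "\<exists>q\<in>U. x = \<psi> q" if "x \<in> N" for x using that im\<psi> by blast
  show trans: "transition (V, \<psi>) (U, \<kappa>) x = \<phi> x" if x: "x \<in> N" for x
    using N\<psi>[OF x] UV inv\<psi> by (auto simp: transition_def \<kappa>_def)
  have oU: "openin X U"
  proof -
    have "continuous_map (subtopology X V) (top_of_set (\<psi> ` V)) \<psi>"
      using h homeomorphic_imp_continuous_map by blast
    moreover have "openin (top_of_set (\<psi> ` V)) N"
      using N by (metis openin_open Int_absorb1)
    ultimately have "openin (subtopology X V) {q \<in> topspace (subtopology X V). \<psi> q \<in> N}"
      by (rule openin_continuous_map_preimage)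
    moreover have "{q \<in> topspace (subtopology X V). \<psi> q \<in> N} = U"
      using VX by (auto simp: U_def)
    ultimately show ?thesis using V openin_trans_full by metis
  qed
  have "homeomorphic_map (subtopology (subtopology X V) U) (subtopology (top_of_set (\<psi> ` V)) N) \<psi>"
    using h by (rule homeomorphic_map_subtopologies_alt) (use VX in \<open>auto simp: U_def\<close>)
  then have h1: "homeomorphic_map (subtopology X U) (top_of_set N) \<psi>"
    using UV N(2) by (simp add: subtopology_subtopology Int_absorb1)
  have "homeomorphic_maps (top_of_set N) (top_of_set (\<phi> ` N)) \<phi> G"
    using smooth_on_continuous[OF \<phi>(1)] smooth_on_continuous[OF G(1)] G(2)
    by (auto simp: homeomorphic_maps_def)
  then have h2: "homeomorphic_map (top_of_set N) (top_of_set (\<phi> ` N)) \<phi>"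
    using homeomorphic_map_maps by blast
  have tU: "topological_chart X (U, \<kappa>)"
    unfolding topological_chart_def
    using oU \<phi>(2) homeomorphic_map_compose[OF h1 h2] by (simp add: im) (simp add: \<kappa>_def)
  have "smoothly_compatible (U, \<kappa>) d" if d: "d \<in> \<A>" for d
  proof -
    obtain D \<eta> where de: "d = (D, \<eta>)" by (cases d)
    have tD: "topological_chart X (D, \<eta>)" using tc[OF d] by (simp add: de)
    then have oD: "openin X D" by (simp add: topological_chart_def)
    have inj\<eta>: "inj_on \<eta> D" using topological_chart_inj[OF tD] .
    have inv\<eta>: "inv_into D \<eta> (\<eta> q) = q" if "q \<in> D" for q using inv_into_f_f[OF inj\<eta> that] .
    have comp: "smooth_on UNIV (transition (V, \<psi>) d) (\<psi> ` (V \<inter> D))"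
      "smooth_on UNIV (transition d (V, \<psi>)) (\<eta> ` (D \<inter> V))"
    proof -
      have "smoothly_compatible (V, \<psi>) d" using man c d unfolding smooth_manifold_def by blast
      then show "smooth_on UNIV (transition (V, \<psi>) d) (\<psi> ` (V \<inter> D))"
        "smooth_on UNIV (transition d (V, \<psi>)) (\<eta> ` (D \<inter> V))"
        by (simp_all add: smoothly_compatible_def de Int_commute)
    qed
    have o1: "open (\<kappa> ` (U \<inter> D))" using topological_chart_open_image[OF tU oD] .
    have o2: "open (\<eta> ` (D \<inter> U))" using topological_chart_open_image[OF tD oU] .
    have o3: "open (\<psi> ` (V \<inter> D))" using topological_chart_open_image[OF tV oD] .
    have o4: "open (\<eta> ` (D \<inter> V))" using topological_chart_open_image[OF tD V] .
    have GU: "G (\<kappa> q) = \<psi> q" if "q \<in> U" for q using G(2)[of "\<psi> q"] that by (simp add: \<kappa>_def U_def)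
    have "smooth_on UNIV (\<lambda>x. transition (V, \<psi>) d (G x)) (\<kappa> ` (U \<inter> D))"
    proof (rule smooth_on_compose[OF o1 o3 _ comp(1)])
      show "smooth_on UNIV G (\<kappa> ` (U \<inter> D))"
        by (rule smooth_on_subset[OF G(1) \<phi>(2) o1]) (use im in blast)
      show "G x \<in> \<psi> ` (V \<inter> D)" if "x \<in> \<kappa> ` (U \<inter> D)" for x
        using that GU UV by auto
    qed
    then have "smooth_on UNIV (transition (U, \<kappa>) d) (\<kappa> ` (U \<inter> D))"
      by (rule smooth_on_cong[OF o1])
        (use GU UV inv\<psi> inv\<kappa> in \<open>auto simp: transition_def de subset_iff\<close>)
    moreover have "smooth_on UNIV (\<lambda>x. \<phi> (transition d (V, \<psi>) x)) (\<eta> ` (D \<inter> U))"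
    proof (rule smooth_on_compose[OF o2 N(1) _ \<phi>(1)])
      show "smooth_on UNIV (transition d (V, \<psi>)) (\<eta> ` (D \<inter> U))"
        by (rule smooth_on_subset[OF comp(2) o4 o2]) (use UV in blast)
      show "transition d (V, \<psi>) x \<in> N" if "x \<in> \<eta> ` (D \<inter> U)" for x
        using that inv\<eta> by (auto simp: transition_def de U_def)
    qed
    then have "smooth_on UNIV (transition d (U, \<kappa>)) (\<eta> ` (D \<inter> U))"
      by (rule smooth_on_cong[OF o2]) (auto simp: transition_def de \<kappa>_def)
    ultimately show ?thesis
      by (simp add: smoothly_compatible_def de Int_commute)
  qed
  then show "(U, \<kappa>) \<in> \<A>"
    using man tU unfolding smooth_manifold_def by blast
qed

theorem theorem1p3:
  shows
    "(\<forall>(X :: 'a topology) (\<A> :: ('a, 'n::finite) chart set) L p V \<psi> p1 p2 (K :: 'n set).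
        smooth_manifold X \<A> \<and> haantjes_operator \<A> L \<and>
        p \<in> topspace X \<and> (V, \<psi>) \<in> \<A> \<and> p \<in> V \<and>
        charpoly (L (V, \<psi>) (\<psi> p)) = p1 * p2 \<and>
        coprime p1 p2 \<and> lead_coeff p1 = 1 \<and> lead_coeff p2 = 1 \<and>
        card K = degree p1 \<and> card (- K) = degree p2 \<longrightarrow>
        (\<exists>U \<phi> A B. (U, \<phi>) \<in> \<A> \<and> p \<in> U \<and>
           smooth_block K (\<phi> ` U) A \<and> smooth_block (- K) (\<phi> ` U) B \<and>
           (\<forall>x \<in> \<phi> ` U. L (U, \<phi>) x = block_diag K (A x) (B x)) \<and>
           haantjes_wrt K (\<phi> ` U) A \<and> haantjes_wrt (- K) (\<phi> ` U) B \<and>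
           (\<forall>x \<in> \<phi> ` U. \<forall>j. j \<notin> K \<longrightarrow>
              A x ** partial_deriv j A x - partial_deriv j A x ** A x = 0) \<and>
           (\<forall>x \<in> \<phi> ` U. \<forall>i \<in> K.
              B x ** partial_deriv i B x - partial_deriv i B x ** B x = 0)))
     \<and>
     (\<forall>(K :: 'n set) W A B.
        open W \<and> smooth_block K W A \<and> smooth_block (- K) W B \<and>
        haantjes_wrt K W A \<and> haantjes_wrt (- K) W B \<and>
        (\<forall>x\<in>W. \<forall>j. j \<notin> K \<longrightarrow>
           A x ** partial_deriv j A x - partial_deriv j A x ** A x = 0) \<and>
        (\<forall>x\<in>W. \<forall>i\<in>K.
           B x ** partial_deriv i B x - partial_deriv i B x ** B x = 0) \<longrightarrow>
        haantjes_on UNIV W (\<lambda>x. block_diag K (A x) (B x)))"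
proof (rule conjI; intro allI impI; elim conjE)
  fix X :: "'a topology" and \<A> :: "('a, 'n) chart set" and L p V \<psi> p1 p2 and K :: "'n set"
  assume man: "smooth_manifold X \<A>" and op: "haantjes_operator \<A> L" and c: "(V, \<psi>) \<in> \<A>" and p: "p \<in> V"
    and chi: "charpoly (L (V, \<psi>) (\<psi> p)) = p1 * p2" "coprime p1 p2" "lead_coeff p1 = 1" "lead_coeff p2 = 1"
    and card: "card K = degree p1" "card (- K) = degree p2"
  have sm: "smooth_on UNIV (L e) (snd e ` fst e)" and H: "haantjes_on UNIV (snd e ` fst e) (L e)" if "e \<in> \<A>" for e
    using op that by (auto simp: haantjes_operator_def operator_field_def)
  have oV: "open (\<psi> ` V)"
    using man c by (auto simp: smooth_manifold_def topological_chart_def)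
  have x0: "\<psi> p \<in> \<psi> ` V" using p by blast
  have nz: "p1 \<noteq> 0" "p2 \<noteq> 0" using chi(3,4) by auto
  have LV: "smooth_on UNIV (L (V, \<psi>)) (\<psi> ` V)" "haantjes_on UNIV (\<psi> ` V) (L (V, \<psi>))"
    using sm[OF c] H[OF c] by simp_all
  obtain N \<phi> G where N: "open N" "\<psi> p \<in> N" "N \<subseteq> \<psi> ` V" "smooth_on UNIV \<phi> N" "open (\<phi> ` N)"
    "smooth_on UNIV G (\<phi> ` N)" "\<And>x. x \<in> N \<Longrightarrow> G (\<phi> x) = x"
    "\<And>x. x \<in> N \<Longrightarrow> \<exists>P. separated (L (V, \<psi>) x) P \<and> L (V, \<psi>) x ** P = P ** L (V, \<psi>) x \<and>
      coord_proj K ** matrix (frechet_derivative \<phi> (at x)) = matrix (frechet_derivative \<phi> (at x)) ** P"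
    by (rule splitting_coordinates[OF oV x0 LV chi(1,2) nz card], rule that; assumption)
  define U where "U = {q \<in> V. \<psi> q \<in> N}"
  define \<kappa> where "\<kappa> = \<phi> \<circ> \<psi>"
  note ch = chart_of_diffeomorphism[OF man c N(1,3-7), folded U_def \<kappa>_def]
  have oW: "open (\<kappa> ` U)" using ch(2) N(5) by simp
  \<comment> \<open>In the new chart \<open>L\<close> is conjugated by the Jacobi matrix of
    \<open>\<phi>\<close>, which intertwines \<open>P\<close> with \<open>coord_proj K\<close>.
    Commutation with \<open>P\<close> and separation are therefore carried over to the coordinate
    projection.\<close>
  have blk: "L (U, \<kappa>) y ** coord_proj K = coord_proj K ** L (U, \<kappa>) y \<and> separated (L (U, \<kappa>) y) (coord_proj K)"
    if y: "y \<in> \<kappa> ` U" for y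
  proof -
    obtain q where q: "q \<in> U" "y = \<kappa> q" using y by blast
    let ?x = "\<psi> q"
    have x: "?x \<in> N" and qV: "q \<in> V" using q by (auto simp: U_def)
    let ?L = "L (V, \<psi>) ?x" and ?M = "L (U, \<kappa>) y"
    let ?J = "matrix (frechet_derivative \<phi> (at ?x))"
    have "jacobian (transition (V, \<psi>) (U, \<kappa>)) (at ?x) = ?J"
      unfolding jacobian_def using frechet_derivative_transform[OF N(1) x ch(3)] by simp
    moreover have "L (U, \<kappa>) (\<kappa> q) ** jacobian (transition (V, \<psi>) (U, \<kappa>)) (at ?x)
        = jacobian (transition (V, \<psi>) (U, \<kappa>)) (at ?x) ** ?L"
      using op c ch(1) q(1) qV unfolding haantjes_operator_def operator_field_def Let_def
      by (metis IntI fst_conv snd_conv)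
    ultimately have MJ: "?M ** ?J = ?J ** ?L" using q(2) by simp
    have D\<phi>: "(\<phi> has_derivative frechet_derivative \<phi> (at ?x)) (at ?x)"
      using smooth_on_has_derivative[OF N(4) x] .
    have DG: "(G has_derivative frechet_derivative G (at (\<phi> ?x))) (at (\<phi> ?x))"
      using smooth_on_has_derivative[OF N(6)] x by blast
    let ?J' = "matrix (frechet_derivative G (at (\<phi> ?x)))"
    have "((\<lambda>z. G (\<phi> z)) has_derivative (\<lambda>z. z)) (at ?x)"
      by (rule has_derivative_transform_within_open[OF has_derivative_ident N(1) x]) (simp add: N(7))
    from has_derivative_unique[OF has_derivative_compose[OF D\<phi> DG] this]
    have "frechet_derivative G (at (\<phi> ?x)) (frechet_derivative \<phi> (at ?x) v) = v" for v
      by (rule fun_cong)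
    then have J'J: "?J' ** ?J = mat 1"
      by (simp add: matrix_eq fun_cong[OF matrix_vector_mul(2)[OF has_derivative_linear[OF D\<phi>]]]
          fun_cong[OF matrix_vector_mul(2)[OF has_derivative_linear[OF DG]]] flip: matrix_vector_mul_assoc)
    then have JJ': "?J ** ?J' = mat 1" by (simp add: matrix_left_right_inverse)
    obtain P where P: "separated ?L P" "?L ** P = P ** ?L" "coord_proj K ** ?J = ?J ** P"
      using N(8)[OF x] by blast
    have "?M ** coord_proj K ** ?J = coord_proj K ** ?M ** ?J"
    proof -
      have "?M ** coord_proj K ** ?J = (?M ** ?J) ** P" by (simp add: P(3) flip: matrix_mul_assoc)
      also have "\<dots> = (?J ** P) ** ?L" unfolding MJ by (simp add: P(2) flip: matrix_mul_assoc)
      also have "\<dots> = coord_proj K ** (?M ** ?J)" unfolding MJ by (simp add: P(3)[symmetric] matrix_mul_assoc)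
      finally show ?thesis by (simp add: matrix_mul_assoc)
    qed
    then have "?M ** coord_proj K ** (?J ** ?J') = coord_proj K ** ?M ** (?J ** ?J')"
      by (simp add: matrix_mul_assoc)
    then show ?thesis
      using separated_transport[OF P(1) JJ' J'J MJ P(3)] by (simp add: JJ')
  qed
  have LU: "smooth_on UNIV (L (U, \<kappa>)) (\<kappa> ` U)" "haantjes_on UNIV (\<kappa> ` U) (L (U, \<kappa>))"
    using sm[OF ch(1)] H[OF ch(1)] by simp_all
  have pU: "p \<in> U" using p N(2) by (simp add: U_def)
  obtain A B where AB: "smooth_block K (\<kappa> ` U) A" "smooth_block (- K) (\<kappa> ` U) B"
    "\<forall>x\<in>\<kappa> ` U. L (U, \<kappa>) x = block_diag K (A x) (B x)"
    "haantjes_wrt K (\<kappa> ` U) A" "haantjes_wrt (- K) (\<kappa> ` U) B"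
    "\<forall>x\<in>\<kappa> ` U. \<forall>j. j \<notin> K \<longrightarrow> A x ** partial_deriv j A x - partial_deriv j A x ** A x = 0"
    "\<forall>x\<in>\<kappa> ` U. \<forall>i\<in>K. B x ** partial_deriv i B x - partial_deriv i B x ** B x = 0"
    by (rule block_diag_of_haantjes[OF oW LU conjunct1[OF blk] conjunct2[OF blk]],
      assumption, assumption, rule that; assumption)
  show "\<exists>U \<phi> A B. (U, \<phi>) \<in> \<A> \<and> p \<in> U \<and>
     smooth_block K (\<phi> ` U) A \<and> smooth_block (- K) (\<phi> ` U) B \<and>
     (\<forall>x \<in> \<phi> ` U. L (U, \<phi>) x = block_diag K (A x) (B x)) \<and>
     haantjes_wrt K (\<phi> ` U) A \<and> haantjes_wrt (- K) (\<phi> ` U) B \<and>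
     (\<forall>x \<in> \<phi> ` U. \<forall>j. j \<notin> K \<longrightarrow>
        A x ** partial_deriv j A x - partial_deriv j A x ** A x = 0) \<and>
     (\<forall>x \<in> \<phi> ` U. \<forall>i \<in> K.
        B x ** partial_deriv i B x - partial_deriv i B x ** B x = 0)"
    by (rule exI[of _ U], rule exI[of _ \<kappa>], rule exI[of _ A], rule exI[of _ B])
      (intro conjI ch(1) pU AB)
next
  fix K :: "'n set" and W A B
  assume "open W" "smooth_block K W A" "smooth_block (- K) W B"
    "haantjes_wrt K W A" "haantjes_wrt (- K) W B"
    "\<forall>x\<in>W. \<forall>j. j \<notin> K \<longrightarrow> A x ** partial_deriv j A x - partial_deriv j A x ** A x = 0"
    "\<forall>x\<in>W. \<forall>i\<in>K. B x ** partial_deriv i B x - partial_deriv i B x ** B x = 0"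
  then show "haantjes_on UNIV W (\<lambda>x. block_diag K (A x) (B x))"
    by (rule block_diag_haantjes)
qed

end
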